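(* Let $\Bbbk$ be a field of characteristic $0$ and $V$ an $n$-dimensional $\Bbbk$-vector space. For every point $x\in U_{\mathrm{Lie}}$, $$T_x\mathrm{Lie}(V)=T_x(\mathrm{GL}(V)\cdot x)\quad\text{and}\quad T_{[x]}[\mathrm{Lie}(V)/\mathrm{GL}(V)]=0.$$ Equivalently, the $\mathrm{GL}(V)$-orbit of $x$ is Zariski open in $\mathrm{Lie}(V)$ near $x$ and the corresponding point in the coarse moduli space $\mathrm{Lie}(V)/\!/\mathrm{GL}(V)$ is isolated.
   Context: Fix a basis $(e_i)_{i=1}^n$ of $V$. $V^{2,1}=\mathrm{Hom}(V\otimes V,V)$; each $x\in V^{2,1}$ corresponds to a bilinear product $\mu_x$ with structure constants $x_{i,j}^\ell$. $\mathrm{Lie}(V)\subset V^{2,1}$ is the closed subscheme cut out by the linear skew-symmetry equations $x_{i,j}^\ell+x_{j,i}^\ell=0$ and the quadratic equations expressing the right Leibniz identity $\mu_x(\mu_x(a,b),c)=\mu_x(\mu_x(a,c),b)+\mu_x(a,\mu_x(b,c))$ (equivalent to Jacobi under skew-symmetry); it parameterizes Lie brackets on $V$. $\mathrm{GL}(V)$ acts by $(g\cdot\mu)(a,b)=g\,\mu(g^{-1}a,g^{-1}b)$. With $R_a(b)=\mu_x(b,a)$ and $D_x=(\mathrm{Tr}(R_{e_i}R_{e_j}))_{i,j}$, set $U_{\mathrm{Lie}}=\{x\in\mathrm{Lie}(V):\det D_x\neq0\}$ (this is the locus of semisimple Lie brackets). The tangent space of the quotient stack $[\mathrm{Lie}(V)/\mathrm{GL}(V)]$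 at $[x]$ is $T_x\mathrm{Lie}(V)/T_x(\mathrm{GL}(V)\cdot x)$. $\mathrm{Lie}(V)/\!/\mathrm{GL}(V)$ is the coarse GIT quotient. *)

theory Defs
  imports
    "HOL-Analysis.Analysis"
    "HOL-Computational_Algebra.Polynomial"
    "HOL-Library.Poly_Mapping"
    "HOL-Algebra.QuotRing"
    "HOL-Algebra.Algebraic_Closure_Type"
begin

section \<open>Polynomial rings and affine schemes\<close>

text \<open>
  Polynomials over \<open>'k\<close> in the variables \<open>'v\<close> are finitely supported functions on
  finitely supported exponent vectors; the library makes them a commutative ring.
\<close>

type_synonym ('v, 'k) mpoly = "('v \<Rightarrow>\<^sub>0 nat) \<Rightarrow>\<^sub>0 'k"

definition mconst :: "'k \<Rightarrow> ('v, 'k::zero) mpoly" where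
  "mconst c = Poly_Mapping.single 0 c"

definition mvar :: "'v \<Rightarrow> ('v, 'k::zero_neq_one) mpoly" where
  "mvar v = Poly_Mapping.single (Poly_Mapping.single v 1) 1"

text \<open>
  For a ring homomorphism \<open>\<iota>\<close> this is the homomorphism from the polynomial ring that
  extends \<open>\<iota>\<close> and sends each variable \<open>v\<close> to \<open>\<rho> v\<close>.
\<close>

definition msubst ::
    "('k \<Rightarrow> 'r) \<Rightarrow> ('v \<Rightarrow> 'r) \<Rightarrow> ('v, 'k::zero) mpoly \<Rightarrow> 'r::comm_ring_1" where
  "msubst \<iota> \<rho> f =
     (\<Sum>m \<in> Poly_Mapping.keys f. \<iota> (Poly_Mapping.lookup f m) *
        (\<Prod>v \<in> Poly_Mapping.keys m. \<rho> v ^ Poly_Mapping.lookup m v))"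

abbreviation meval :: "('v \<Rightarrow> 'k) \<Rightarrow> ('v, 'k::comm_ring_1) mpoly \<Rightarrow> 'k" where
  "meval \<equiv> msubst (\<lambda>c. c)"

abbreviation mpoly_ring :: "('v, 'k::comm_ring_1) mpoly ring" where
  "mpoly_ring \<equiv> ring_of_type_algebra"

definition Spec :: "('a, 'b) ring_scheme \<Rightarrow> 'a set set" where
  "Spec R = {P. primeideal P R}"

definition zariski_topology :: "('a, 'b) ring_scheme \<Rightarrow> 'a set topology" where
  "zariski_topology R = topology_generated_by {{P \<in> Spec R. f \<notin> P} | f. f \<in> carrier R}"

text \<open>
  The tangent space at the rational point \<open>x\<close> of the closed subscheme of affine space
  defined by the ideal \<open>J\<close>, as a set of vectors \<open>y\<close> of the ambient space: the points
  \<open>x + t y\<close> of the subscheme over the dual numbers \<open>k[t]/(t\<^sup>2)\<close>.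
\<close>

definition tangent_space ::
    "('v, 'k::field) mpoly set \<Rightarrow> ('v \<Rightarrow> 'k) \<Rightarrow> ('v \<Rightarrow> 'k) set" where
  "tangent_space J x =
     {y. \<forall>f \<in> J. [:0, 0, 1:] dvd msubst (\<lambda>c. [:c:]) (\<lambda>v. [:x v, y v:]) f}"

definition vcoset :: "('v \<Rightarrow> 'k) \<Rightarrow> ('v \<Rightarrow> 'k::ab_group_add) set \<Rightarrow> ('v \<Rightarrow> 'k) set" where
  "vcoset y W = {\<lambda>v. y v + w v | w. w \<in> W}"

definition quotient_space ::
    "('v \<Rightarrow> 'k::ab_group_add) set \<Rightarrow> ('v \<Rightarrow> 'k) set \<Rightarrow> ('v \<Rightarrow> 'k) set set" where
  "quotient_space U W = {vcoset y W | y. y \<in> U}"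


section \<open>The scheme of Lie brackets\<close>

text \<open>
  We use the fixed basis to identify \<open>V\<close> with \<open>'r^'n\<close> and a bilinear product with the
  family of its structure constants: \<open>x (i, j, l)\<close> is the \<open>l\<close>-th coordinate of the product
  of \<open>e\<^sub>i\<close> and \<open>e\<^sub>j\<close>. The coefficients \<open>'r\<close> are an arbitrary commutative ring, so that the
  same formulas apply to points and to the universal product over the coordinate ring.
\<close>

type_synonym ('r, 'n) struct_consts = "'n \<times> 'n \<times> 'n \<Rightarrow> 'r"

abbreviation basis_vec :: "'n \<Rightarrow> 'r::zero_neq_one ^ 'n" where
  "basis_vec i \<equiv> axis i 1"

definition bprod ::
    "('r::comm_ring_1, 'n::finite) struct_consts \<Rightarrow> 'r^'n \<Rightarrow> 'r^'n \<Rightarrow> 'r^'n" where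
  "bprod x a b = (\<chi> l. \<Sum>i\<in>UNIV. \<Sum>j\<in>UNIV. a $ i * b $ j * x (i, j, l))"

definition struct_consts_of ::
    "('r^'n \<Rightarrow> 'r^'n \<Rightarrow> 'r^'n) \<Rightarrow> ('r::comm_ring_1, 'n::finite) struct_consts" where
  "struct_consts_of \<mu> = (\<lambda>(i, j, l). \<mu> (basis_vec i) (basis_vec j) $ l)"

definition leibniz_defect ::
    "('r::comm_ring_1, 'n::finite) struct_consts \<Rightarrow> 'r^'n \<Rightarrow> 'r^'n \<Rightarrow> 'r^'n \<Rightarrow> 'r^'n" where
  "leibniz_defect x a b c =
     bprod x (bprod x a b) c - (bprod x (bprod x a c) b + bprod x a (bprod x b c))"

definition lie_equations :: "('r::comm_ring_1, 'n::finite) struct_consts \<Rightarrow> 'r set" where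
  "lie_equations x =
     {x (i, j, l) + x (j, i, l) | i j l. True} \<union>
     {leibniz_defect x (basis_vec i) (basis_vec j) (basis_vec k) $ l | i j k l. True}"

definition lie_points :: "('k::field, 'n::finite) struct_consts set" where
  "lie_points = {x. \<forall>e \<in> lie_equations x. e = 0}"

definition lie_ideal :: "('n::finite \<times> 'n \<times> 'n, 'k::field) mpoly set" where
  "lie_ideal = Idl\<^bsub>mpoly_ring\<^esub> (lie_equations mvar)"

definition lie_ring :: "('n::finite \<times> 'n \<times> 'n, 'k::field) mpoly set ring" where
  "lie_ring = mpoly_ring Quot lie_ideal"

definition lie_class ::
    "('n::finite \<times> 'n \<times> 'n, 'k::field) mpoly \<Rightarrow> ('n \<times> 'n \<times> 'n, 'k) mpoly set" where
  "lie_class f = lie_ideal +>\<^bsub>mpoly_ring\<^esub> f"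

text \<open>The maximal ideal of the coordinate ring belonging to a rational point.\<close>

definition scheme_point ::
    "('k::field, 'n::finite) struct_consts \<Rightarrow> ('n \<times> 'n \<times> 'n, 'k) mpoly set set" where
  "scheme_point x = {lie_class f | f. meval x f = 0}"

definition right_mult ::
    "('r::comm_ring_1, 'n::finite) struct_consts \<Rightarrow> 'r^'n \<Rightarrow> 'r^'n \<Rightarrow> 'r^'n" where
  "right_mult x a = (\<lambda>b. bprod x b a)"

definition trace_form :: "('r::comm_ring_1, 'n::finite) struct_consts \<Rightarrow> 'r^'n^'n" where
  "trace_form x = (\<chi> i j.
     trace (matrix (right_mult x (basis_vec i) \<circ> right_mult x (basis_vec j))))"

definition U_Lie :: "('k::field, 'n::finite) struct_consts set" where
  "U_Lie = {x \<in> lie_points. det (trace_form x) \<noteq> 0}"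


section \<open>The action of the general linear group\<close>

text \<open>
  Over a general coefficient ring a point of \<open>GL(V)\<close> is a pair \<open>(g, h)\<close> of mutually inverse
  matrices, so that \<open>k[GL(V)]\<close> is \<open>k[g, h] / (g h = 1, h g = 1)\<close>. The variables \<open>Inl (i, j)\<close>
  are the entries of \<open>g\<close> and the variables \<open>Inr (i, j)\<close> those of \<open>h\<close>.
\<close>

definition gl_act ::
    "'r^'n^'n \<Rightarrow> 'r^'n^'n \<Rightarrow> ('r::comm_ring_1, 'n::finite) struct_consts
      \<Rightarrow> ('r, 'n) struct_consts" where
  "gl_act g h x = struct_consts_of (\<lambda>a b. g *v bprod x (h *v a) (h *v b))"

type_synonym 'n gl_var = "('n \<times> 'n) + ('n \<times> 'n)"

definition gl_gen :: "('n gl_var, 'k::field) mpoly ^ 'n ^ 'n::finite" where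
  "gl_gen = (\<chi> i j. mvar (Inl (i, j)))"

definition gl_gen_inv :: "('n gl_var, 'k::field) mpoly ^ 'n ^ 'n::finite" where
  "gl_gen_inv = (\<chi> i j. mvar (Inr (i, j)))"

definition gl_ideal :: "('n::finite gl_var, 'k::field) mpoly set" where
  "gl_ideal = Idl\<^bsub>mpoly_ring\<^esub>
     ({(gl_gen ** gl_gen_inv - mat 1) $ i $ j | i j. True} \<union>
      {(gl_gen_inv ** gl_gen - mat 1) $ i $ j | i j. True})"

definition gl_ring :: "('n::finite gl_var, 'k::field) mpoly set ring" where
  "gl_ring = mpoly_ring Quot gl_ideal"

definition gl_class :: "('n::finite gl_var, 'k::field) mpoly \<Rightarrow> ('n gl_var, 'k) mpoly set" where
  "gl_class f = gl_ideal +>\<^bsub>mpoly_ring\<^esub> f"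

subsection \<open>Orbits\<close>

text \<open>
  The map on coordinate rings of the orbit morphism, which sends \<open>g\<close> to \<open>g \<cdot> x\<close>: it
  substitutes the structure constants of \<open>g \<cdot> x\<close>, for the universal \<open>g\<close>, into a polynomial
  on \<open>V\<^sup>2\<^sup>,\<^sup>1\<close>. Its values represent elements of \<open>k[GL(V)]\<close>.
\<close>

definition orbit_comorphism ::
    "('k::field, 'n::finite) struct_consts \<Rightarrow> ('n \<times> 'n \<times> 'n, 'k) mpoly
      \<Rightarrow> ('n gl_var, 'k) mpoly" where
  "orbit_comorphism x f = msubst mconst (gl_act gl_gen gl_gen_inv (\<lambda>v. mconst (x v))) f"

text \<open>
  The orbit as a subset of the scheme \<open>Lie(V)\<close> is the set-theoretic image of the orbit
  morphism. When the field is not algebraically closed this contains more rational points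
  than the orbit of \<open>x\<close> under the group of rational points of \<open>GL(V)\<close>.
\<close>

definition scheme_orbit ::
    "('k::field, 'n::finite) struct_consts \<Rightarrow> ('n \<times> 'n \<times> 'n, 'k) mpoly set set set" where
  "scheme_orbit x =
     {P \<in> Spec lie_ring. \<exists>Q \<in> Spec gl_ring.
        P = {lie_class f | f. gl_class (orbit_comorphism x f) \<in> Q}}"

text \<open>
  The ideal of the orbit closure, i.e. of the scheme-theoretic image of the orbit morphism.
  The orbit with its reduced structure is open in its closure, so the two have the same
  tangent space at \<open>x\<close>.
\<close>

definition orbit_ideal ::
    "('k::field, 'n::finite) struct_consts \<Rightarrow> ('n \<times> 'n \<times> 'n, 'k) mpoly set" where
  "orbit_ideal x = {f. orbit_comorphism x f \<in> gl_ideal}"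

definition tangent_Lie ::
    "('k::field, 'n::finite) struct_consts \<Rightarrow> ('k, 'n) struct_consts set" where
  "tangent_Lie x = tangent_space lie_ideal x"

definition tangent_orbit ::
    "('k::field, 'n::finite) struct_consts \<Rightarrow> ('k, 'n) struct_consts set" where
  "tangent_orbit x = tangent_space (orbit_ideal x) x"

definition tangent_stack ::
    "('k::field, 'n::finite) struct_consts \<Rightarrow> ('k, 'n) struct_consts set set" where
  "tangent_stack x = quotient_space (tangent_Lie x) (tangent_orbit x)"

subsection \<open>The quotient \<open>Lie(V)//GL(V)\<close>\<close>

text \<open>
  The action on functions, \<open>(g \<cdot> f)(y) = f(g\<^sup>-\<^sup>1 \<cdot> y)\<close>. The field is infinite in the
  application, so the rational points of \<open>GL(V)\<close> are dense and invariance under them is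
  invariance under the group scheme.
\<close>

definition translate ::
    "'k^'n^'n \<Rightarrow> ('n \<times> 'n \<times> 'n, 'k) mpoly \<Rightarrow> ('n::finite \<times> 'n \<times> 'n, 'k::field) mpoly" where
  "translate g f =
     msubst mconst
       (gl_act (\<chi> i j. mconst (matrix_inv g $ i $ j)) (\<chi> i j. mconst (g $ i $ j)) mvar) f"

definition invariant_ring :: "('n::finite \<times> 'n \<times> 'n, 'k::field) mpoly set ring" where
  "invariant_ring = lie_ring
     \<lparr> carrier := {lie_class f | f. \<forall>g. invertible g \<longrightarrow> lie_class (translate g f) = lie_class f} \<rparr>"

definition git_point ::
    "('k::field, 'n::finite) struct_consts \<Rightarrow> ('n \<times> 'n \<times> 'n, 'k) mpoly set set" where
  "git_point x = scheme_point x \<inter> carrier invariant_ring"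

end

theory Submission
  imports Defs
begin

text \<open>
  Since the trace form is nondegenerate, the Casimir element
  acts on \<open>V\<close> as the identity and gives an explicit homotopy showing that every infinitesimal
  deformation of \<open>x\<close> is a coboundary, that is, a tangent vector of the orbit. The same homotopy,
  applied order by order, trivialises the universal bracket modulo every power of the maximal ideal
  of \<open>x\<close>. Hence the ideal of the orbit closure lies in the intersection of these powers, which Krull's
  theorem kills near \<open>x\<close>: the orbit closure contains a neighbourhood of \<open>x\<close>. By extension of primes
  from the coordinate ring of the orbit closure to that of the group (Chevalley), the orbit contains a
  nonempty open subset of its closure, and a translation by a rational group element moves it to \<open>x\<close>.
  Finally, the scalars in \<open>GL(V)\<close> rescale brackets, so an invariant function has no components of
  positive degree; the invariant ring is the base field and its spectrum is a point.
\<close>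

text \<open>Nothing is presupposed about reducedness of Lie(V), no dimensions are counted, and the
  field need not be algebraically closed; so openness cannot be read off from the tangent spaces and
  has to be proved for prime ideals. This is why the homotopy is an explicit identity over an
  arbitrary commutative ring, with the inverse of the trace form as a datum. Over the field it
  computes the tangent space; over the polynomial ring, with the constants \<open>x v\<close> as
  base point and the variables as deformed bracket, the same identity removes the error of each
  order. The Casimir element acts by the scalar 1, without any splitting into simple ideals, because
  the form is the trace form of the very representation on which the element acts. Characteristic 0
  enters through the number 2: its powers are pairwise distinct, so a nonzero polynomial has a
  nonzero value and rational points of GL(V) are dense; and 1 - 2^d is nonzero for d > 0, so that
  the scalar matrix 2 alone separates constants from higher degrees.\<close>

no_notation fps_nth (infixl "$" 75)
hide_const (open) up_ring.coeff up_ring.monom Polynomials.degree Polynomials.lead_coeff Poly_Mapping.degree module.smult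

type_synonym ('n, 'k) bracket_poly = "('n \<times> 'n \<times> 'n, 'k) mpoly"

abbreviation "lookup \<equiv> Poly_Mapping.lookup"
abbreviation "keys \<equiv> Poly_Mapping.keys"
abbreviation "single \<equiv> Poly_Mapping.single"

section \<open>Polynomial rings\<close>

text \<open>Rings are types here, so one predicate covers evaluations, inclusions of constants, dual
  numbers and the passage to a fraction field.\<close>

locale comm_ring_hom =
  fixes h :: "'a::comm_ring_1 \<Rightarrow> 'b::comm_ring_1"
  assumes hom_add: "h (a + b) = h a + h b"
    and hom_mult: "h (a * b) = h a * h b"
    and hom_one: "h 1 = 1"
begin

lemma hom_zero: "h 0 = 0"
  using hom_add[of 0 0] by simp

lemma hom_uminus: "h (- a) = - h a"
  using hom_add[of a "- a"] by (simp add: hom_zero eq_neg_iff_add_eq_0 add.commute)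

lemma hom_diff: "h (a - b) = h a - h b"
  using hom_add[of a "- b"] by (simp add: hom_uminus)

lemma hom_sum: "h (\<Sum>i\<in>A. f i) = (\<Sum>i\<in>A. h (f i))"
  by (induction A rule: infinite_finite_induct) (auto simp: hom_zero hom_add)

lemma hom_prod: "h (\<Prod>i\<in>A. f i) = (\<Prod>i\<in>A. h (f i))"
  by (induction A rule: infinite_finite_induct) (auto simp: hom_one hom_mult)

lemma hom_power: "h (a ^ k) = h a ^ k"
  by (induction k) (auto simp: hom_one hom_mult)

lemma hom_of_int: "h (of_int k) = of_int k"
proof -
  have "h (of_nat m) = of_nat m" for m
    by (induction m) (auto simp: hom_zero hom_one hom_add)
  then show ?thesis
    by (cases k rule: int_diff_cases) (simp add: hom_diff)
qed

lemmas homs = hom_add hom_mult hom_one hom_zero hom_uminus hom_diff hom_sum hom_prod hom_power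

end

lemma comm_ring_hom_id: "comm_ring_hom (\<lambda>a. a)"
  by unfold_locales auto

lemma comm_ring_hom_comp:
  assumes "comm_ring_hom h" "comm_ring_hom h'"
  shows "comm_ring_hom (\<lambda>a. h' (h a))"
proof -
  interpret h: comm_ring_hom h by fact
  interpret h': comm_ring_hom h' by fact
  show ?thesis by unfold_locales (auto simp: h.homs h'.homs)
qed

lemma poly_mapping_sum_single:
  "f = (\<Sum>m\<in>keys f. single m (lookup f m))"
  by (rule poly_mapping_eqI)
    (simp add: lookup_sum lookup_single when_def sum.delta in_keys_iff flip: sum.inter_filter)

lemma poly_mapping_single_induct [case_names zero single]:
  fixes f :: "'a \<Rightarrow>\<^sub>0 'b::comm_monoid_add"
  assumes zero: "P 0" and single: "\<And>f m c. P f \<Longrightarrow> P (single m c + f)"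
  shows "P f"
proof -
  have "P (\<Sum>m\<in>K. single m (lookup f m))" if "finite K" for K
    using that by induction (auto intro: assms)
  then show ?thesis
    by (metis poly_mapping_sum_single finite_keys)
qed

definition monomial_eval :: "('v \<Rightarrow> 'r) \<Rightarrow> ('v \<Rightarrow>\<^sub>0 nat) \<Rightarrow> 'r::comm_ring_1" where
  "monomial_eval \<rho> m = (\<Prod>v\<in>keys m. \<rho> v ^ lookup m v)"

lemma monomial_eval_superset:
  assumes "finite K" "keys m \<subseteq> K"
  shows "monomial_eval \<rho> m = (\<Prod>v\<in>K. \<rho> v ^ lookup m v)"
  unfolding monomial_eval_def
  by (rule prod.mono_neutral_left) (use assms in \<open>auto simp: in_keys_iff\<close>)

lemma monomial_eval_add: "monomial_eval \<rho> (m + m') = monomial_eval \<rho> m * monomial_eval \<rho> m'"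
proof -
  let ?K = "keys m \<union> keys m'"
  have "monomial_eval \<rho> u = (\<Prod>v\<in>?K. \<rho> v ^ lookup u v)"
    if "u \<in> {m, m', m + m'}" for u
    by (rule monomial_eval_superset) (use that keys_add[of m m'] in auto)
  then show ?thesis
    by (simp add: lookup_add power_add prod.distrib)
qed

lemma monomial_eval_zero: "monomial_eval \<rho> 0 = 1"
  by (simp add: monomial_eval_def)

lemma msubst_eq:
  "msubst \<iota> \<rho> f = (\<Sum>m\<in>keys f. \<iota> (lookup f m) * monomial_eval \<rho> m)"
  by (simp add: msubst_def monomial_eval_def)

context comm_ring_hom
begin

lemma msubst_superset:
  assumes "finite K" "keys f \<subseteq> K"
  shows "msubst h \<rho> f = (\<Sum>m\<in>K. h (lookup f m) * monomial_eval \<rho> m)"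
  unfolding msubst_eq
  by (rule sum.mono_neutral_left) (use assms in \<open>auto simp: in_keys_iff hom_zero\<close>)

lemma msubst_add: "msubst h \<rho> (f + g) = msubst h \<rho> f + msubst h \<rho> g"
proof -
  let ?K = "keys f \<union> keys g"
  have "msubst h \<rho> u = (\<Sum>m\<in>?K. h (lookup u m) * monomial_eval \<rho> m)"
    if "u \<in> {f, g, f + g}" for u
    by (rule msubst_superset) (use that keys_add[of f g] in auto)
  then show ?thesis
    by (simp add: lookup_add hom_add distrib_right sum.distrib)
qed

lemma msubst_zero: "msubst h \<rho> 0 = 0"
  by (simp add: msubst_def)

lemma msubst_single: "msubst h \<rho> (single m c) = h c * monomial_eval \<rho> m"
  by (simp add: msubst_eq hom_zero)

lemma msubst_mult: "msubst h \<rho> (f * g) = msubst h \<rho> f * msubst h \<rho> g"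
proof (induction f rule: poly_mapping_single_induct)
  case zero
  then show ?case by (simp add: msubst_zero)
next
  case (single f m c)
  have "msubst h \<rho> (single m c * g) = h c * monomial_eval \<rho> m * msubst h \<rho> g"
    by (induction g rule: poly_mapping_single_induct)
      (simp_all add: msubst_zero msubst_add msubst_single mult_single monomial_eval_add hom_mult
        distrib_left mult_ac)
  with single show ?case
    by (simp add: distrib_right msubst_add msubst_single)
qed

lemma msubst_hom: "comm_ring_hom (msubst h \<rho>)"
  by unfold_locales
    (simp_all add: msubst_add msubst_mult msubst_single monomial_eval_zero hom_one flip: single_one)

lemma msubst_mconst: "msubst h \<rho> (mconst c) = h c"
  by (simp add: mconst_def msubst_single monomial_eval_zero)

lemma msubst_mvar: "msubst h \<rho> (mvar v) = \<rho> v"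
  by (simp add: mvar_def msubst_single monomial_eval_def hom_one)

lemma hom_msubst: "h (msubst \<iota> \<rho> f) = msubst (\<lambda>c. h (\<iota> c)) (\<lambda>v. h (\<rho> v)) f"
  by (simp add: msubst_def homs)

end

lemma mconst_hom: "comm_ring_hom (mconst :: 'k::comm_ring_1 \<Rightarrow> ('v, 'k) mpoly)"
  by unfold_locales (auto simp: mconst_def single_add mult_single)

interpretation mconst: comm_ring_hom "mconst :: 'k::comm_ring_1 \<Rightarrow> ('v, 'k) mpoly"
  by (rule mconst_hom)

interpretation ident: comm_ring_hom "\<lambda>a :: 'a::comm_ring_1. a"
  by (rule comm_ring_hom_id)

lemma monomial_eval_mvar:
  "monomial_eval (mvar :: 'v \<Rightarrow> ('v, 'k::comm_ring_1) mpoly) m = single m 1"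
proof (induction m rule: poly_mapping_single_induct)
  case zero
  then show ?case by (simp add: monomial_eval_zero)
next
  case (single m v k)
  have "mvar v ^ k = (single (single v k) 1 :: ('v, 'k) mpoly)"
    by (induction k) (simp_all add: mvar_def mult_single flip: single_add)
  then have "monomial_eval (mvar :: 'v \<Rightarrow> ('v, 'k) mpoly) (single v k) =
      single (single v k) 1"
    by (subst monomial_eval_superset[of "{v}"]) auto
  with single show ?case
    by (simp add: monomial_eval_add mult_single)
qed

lemma msubst_mconst_mvar: "msubst mconst mvar f = (f :: ('v, 'k::comm_ring_1) mpoly)"
  by (induction f rule: poly_mapping_single_induct)
    (simp_all add: mconst.msubst_zero mconst.msubst_add mconst.msubst_single monomial_eval_mvar
      mult_single, simp add: mconst_def mult_single)

lemma mpoly_induct [case_names const var add mult]: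
  fixes f :: "('v, 'k::comm_ring_1) mpoly"
  assumes "\<And>c. P (mconst c)" "\<And>v. P (mvar v)"
    "\<And>f g. P f \<Longrightarrow> P g \<Longrightarrow> P (f + g)" "\<And>f g. P f \<Longrightarrow> P g \<Longrightarrow> P (f * g)"
  shows "P f"
proof -
  have one: "P 1" using assms(1)[of 1] by (simp add: mconst.hom_one)
  have zero: "P 0" using assms(1)[of 0] by (simp add: mconst.hom_zero)
  have pow: "P (mvar v ^ k)" for v k
    by (induction k) (auto intro: one assms)
  have prod: "P (\<Prod>v\<in>K. mvar v ^ e v)" for K :: "'v set" and e
    by (induction K rule: infinite_finite_induct) (auto intro: one assms pow)
  have "P (\<Sum>m\<in>K. mconst (c m) * monomial_eval mvar m)" for K and c :: "_ \<Rightarrow> 'k"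
    by (induction K rule: infinite_finite_induct)
      (auto intro: zero assms prod simp: monomial_eval_def)
  then have "P (msubst mconst mvar f)"
    unfolding msubst_eq .
  then show ?thesis by (simp add: msubst_mconst_mvar)
qed

lemma mpoly_hom_eqI:
  assumes "comm_ring_hom h" "comm_ring_hom h'"
    and "\<And>c. h (mconst c) = h' (mconst c)" "\<And>v. h (mvar v) = h' (mvar v)"
  shows "h f = h' (f :: ('v, 'k::comm_ring_1) mpoly)"
proof -
  interpret h: comm_ring_hom h by fact
  interpret h': comm_ring_hom h' by fact
  show ?thesis
    by (induction f rule: mpoly_induct) (simp_all add: assms h.homs h'.homs)
qed

section \<open>Ideals of a ring given by a type, and congruences modulo them\<close>

locale tideal =
  fixes I :: "'a::comm_ring_1 set"
  assumes ideal_zero: "0 \<in> I"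
    and ideal_add: "a \<in> I \<Longrightarrow> b \<in> I \<Longrightarrow> a + b \<in> I"
    and ideal_mult: "a \<in> I \<Longrightarrow> r * a \<in> I"
begin

lemma ideal_mult': "a \<in> I \<Longrightarrow> a * r \<in> I"
  using ideal_mult[of a r] by (simp add: mult.commute)

lemma ideal_uminus: "a \<in> I \<Longrightarrow> - a \<in> I"
  using ideal_mult[of a "- 1"] by simp

lemma ideal_diff: "a \<in> I \<Longrightarrow> b \<in> I \<Longrightarrow> a - b \<in> I"
  using ideal_add[of a "- b"] by (simp add: ideal_uminus)

lemma ideal_sum: "(\<And>i. i \<in> A \<Longrightarrow> f i \<in> I) \<Longrightarrow> (\<Sum>i\<in>A. f i) \<in> I"
  by (induction A rule: infinite_finite_induct) (auto intro: ideal_zero ideal_add)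

lemma cong_sym: "a - b \<in> I \<Longrightarrow> b - a \<in> I"
  using ideal_uminus[of "a - b"] by simp

lemma cong_trans: "a - b \<in> I \<Longrightarrow> b - c \<in> I \<Longrightarrow> a - c \<in> I"
  using ideal_add[of "a - b" "b - c"] by simp

lemma cong_mult: 
  assumes "a - b \<in> I" "c - d \<in> I" shows "a * c - b * d \<in> I"
proof -
  have "a * c - b * d = c * (a - b) + b * (c - d)" by (simp add: algebra_simps)
  then show ?thesis using assms by (simp add: ideal_add ideal_mult)
qed

lemma cong_mem: "a - b \<in> I \<Longrightarrow> b \<in> I \<Longrightarrow> a \<in> I"
  using ideal_add[of "a - b" b] by simp

lemma msubst_cong_ideal:
  assumes "comm_ring_hom \<iota>" "\<And>v. \<rho> v - \<sigma> v \<in> I"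
  shows "msubst \<iota> \<rho> f - msubst \<iota> \<sigma> f \<in> I"
proof -
  interpret \<iota>: comm_ring_hom \<iota> by fact
  show ?thesis
  proof (induction f rule: mpoly_induct)
    case (add f g)
    then show ?case using ideal_add[OF add] by (simp add: \<iota>.msubst_add algebra_simps)
  next
    case (mult f g)
    then show ?case by (simp add: \<iota>.msubst_mult cong_mult)
  qed (use assms in \<open>auto simp: \<iota>.msubst_mconst \<iota>.msubst_mvar ideal_zero\<close>)
qed

end

lemma tideal_vimage:
  assumes "comm_ring_hom h" "tideal I" shows "tideal {a. h a \<in> I}"
proof -
  interpret h: comm_ring_hom h by fact
  interpret tideal I by fact
  show ?thesis
    by unfold_locales (auto simp: h.homs intro: ideal_zero ideal_add ideal_mult)
qed

lemma type_ring_simps: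
  "carrier (ring_of_type_algebra :: 'a::ring_1 ring) = UNIV"
  "a \<oplus>\<^bsub>(ring_of_type_algebra :: 'a::ring_1 ring)\<^esub> b = a + b"
  "a \<otimes>\<^bsub>(ring_of_type_algebra :: 'a::ring_1 ring)\<^esub> b = a * b"
  "\<zero>\<^bsub>(ring_of_type_algebra :: 'a::ring_1 ring)\<^esub> = 0"
  "\<one>\<^bsub>(ring_of_type_algebra :: 'a::ring_1 ring)\<^esub> = 1"
  by (simp_all add: ring_of_type_algebra_def)

text \<open>The bridge to the carrier-based notion in which the coordinate rings and spectra are
  defined; calculations stay on the side of types.\<close>

lemma ideal_iff_tideal: "ideal I (ring_of_type_algebra :: 'a::comm_ring_1 ring) \<longleftrightarrow> tideal I"
proof
  assume "ideal I (ring_of_type_algebra :: 'a ring)"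
  then interpret ideal I "ring_of_type_algebra :: 'a ring" .
  show "tideal I"
    using additive_subgroup.zero_closed[OF additive_subgroup_axioms]
      additive_subgroup.a_closed[OF additive_subgroup_axioms] I_l_closed
    by (auto simp: type_ring_simps tideal_def)
next
  assume "tideal I"
  then interpret tideal I .
  interpret R: cring "ring_of_type_algebra :: 'a ring" by (rule cring_from_type_algebra)
  have inv: "\<ominus>\<^bsub>(ring_of_type_algebra :: 'a ring)\<^esub> a = - a" for a
    by (rule R.sum_zero_eq_neg[symmetric]) (simp_all add: type_ring_simps)
  have "subgroup I (add_monoid (ring_of_type_algebra :: 'a ring))"
    by (rule R.add.subgroupI)
      (use ideal_zero in \<open>auto simp: type_ring_simps inv ideal_uminus ideal_add simp flip: a_inv_def\<close>)
  then show "ideal I (ring_of_type_algebra :: 'a ring)"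
    by (intro idealI R.ring_axioms) (auto simp: type_ring_simps ideal_mult ideal_mult')
qed

lemma Idl_eq: "Idl\<^bsub>(ring_of_type_algebra :: 'a::comm_ring_1 ring)\<^esub> S = \<Inter>{I. tideal I \<and> S \<subseteq> I}"
  by (simp add: genideal_def ideal_iff_tideal)

lemma tideal_Idl: "tideal (Idl\<^bsub>(ring_of_type_algebra :: 'a::comm_ring_1 ring)\<^esub> S)"
  unfolding Idl_eq by unfold_locales
    (auto intro: tideal.ideal_zero tideal.ideal_add tideal.ideal_mult)

lemma Idl_subset: "S \<subseteq> Idl\<^bsub>(ring_of_type_algebra :: 'a::comm_ring_1 ring)\<^esub> S"
  unfolding Idl_eq by auto

lemma Idl_least:
  "tideal I \<Longrightarrow> S \<subseteq> I \<Longrightarrow> Idl\<^bsub>(ring_of_type_algebra :: 'a::comm_ring_1 ring)\<^esub> S \<subseteq> I"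
  unfolding Idl_eq by auto

section \<open>The Casimir homotopy\<close>

lemma bprod_consts:
  "bprod (\<lambda>v. x v + y v) a b = bprod x a b + bprod y a b"
  "bprod (\<lambda>v. r * x v) a b = r *s bprod x a b"
  by (simp_all add: bprod_def vec_eq_iff sum.distrib sum_distrib_left algebra_simps)

lemma bprod_add: "bprod x (a + a') b = bprod x a b + bprod x a' b"
    "bprod x a (b + b') = bprod x a b + bprod x a b'"
  and bprod_diff: "bprod x (a - a') b = bprod x a b - bprod x a' b"
    "bprod x a (b - b') = bprod x a b - bprod x a b'"
  and bprod_minus: "bprod x (- a) b = - bprod x a b" "bprod x a (- b) = - bprod x a b"
  and bprod_smult: "bprod x (r *s a) b = r *s bprod x a b" "bprod x a (r *s b) = r *s bprod x a b"
  and bprod_zero: "bprod x 0 b = 0" "bprod x a 0 = 0"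
  by (simp_all add: bprod_def vec_eq_iff sum.distrib sum_distrib_left sum_subtractf sum_negf algebra_simps)

lemma bprod_sum: "bprod x (\<Sum>i\<in>A. f i) b = (\<Sum>i\<in>A. bprod x (f i) b)"
    "bprod x a (\<Sum>i\<in>A. f i) = (\<Sum>i\<in>A. bprod x a (f i))"
  by (induction A rule: infinite_finite_induct) (auto simp: bprod_zero bprod_add)

lemmas bprod_linear = bprod_add bprod_diff bprod_minus bprod_smult bprod_zero bprod_sum

lemma bprod_basis: "bprod x (basis_vec i) (basis_vec j) $ l = x (i, j, l)"
  by (simp add: bprod_def axis_def if_distrib [of "\<lambda>u. u * _"] if_distrib [of "\<lambda>u. _ * u"] cong: if_cong)

section \<open>Linear maps and congruences of vectors over a commutative ring\<close>

lemma smult_sum_right: "r *s (\<Sum>i\<in>A. f i) = (\<Sum>i\<in>A. r *s (f i :: 'r::comm_ring_1^'n))"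
  by (simp add: vec_eq_iff sum_distrib_left)

lemma smult_sum_left: "(\<Sum>i\<in>A. f i) *s v = (\<Sum>i\<in>A. f i *s (v :: 'r::comm_ring_1^'n))"
  by (simp add: vec_eq_iff sum_distrib_right)

text \<open>Linearity over a commutative ring, since the coefficients include polynomial rings;
  vectors still have a basis, on which identities can be checked.\<close>

definition linear_vec :: "('r::comm_ring_1^'n \<Rightarrow> 'r^'n) \<Rightarrow> bool" where
  "linear_vec T \<longleftrightarrow> (\<forall>a b. T (a + b) = T a + T b) \<and> (\<forall>r a. T (r *s a) = r *s T a)"

lemma linear_vec_expansion:
  fixes T :: "'r::comm_ring_1^'n \<Rightarrow> 'r^'n::finite"
  assumes "linear_vec T"
  shows "T a = (\<Sum>i\<in>UNIV. a $ i *s T (basis_vec i))"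
proof -
  have 0: "T 0 = 0" using assms unfolding linear_vec_def by (metis add_cancel_right_right)
  have sum: "T (\<Sum>i\<in>A. f i) = (\<Sum>i\<in>A. T (f i))" for A :: "'n set" and f
    by (induction A rule: infinite_finite_induct) (use assms 0 in \<open>auto simp: linear_vec_def\<close>)
  have "T a = T (\<Sum>i\<in>UNIV. a $ i *s basis_vec i)" by (simp add: basis_expansion)
  also have "\<dots> = (\<Sum>i\<in>UNIV. a $ i *s T (basis_vec i))"
    using assms by (simp add: sum linear_vec_def)
  finally show ?thesis .
qed

lemma linear_vec_ext:
  fixes T :: "'r::comm_ring_1^'n \<Rightarrow> 'r^'n::finite"
  assumes "linear_vec T" "linear_vec S" "\<And>i. T (basis_vec i) = S (basis_vec i)"
  shows "T a = S a"
  unfolding linear_vec_expansion[OF assms(1), of a] linear_vec_expansion[OF assms(2), of a]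
  by (simp only: assms(3))

lemma linear_vec_leibniz_defect:
  "linear_vec (leibniz_defect x a b)" "linear_vec (\<lambda>b. leibniz_defect x a b c)"
  "linear_vec (\<lambda>a. leibniz_defect x a b c)"
  by (simp_all add: leibniz_defect_def linear_vec_def bprod_linear vec_eq_iff algebra_simps)

lemma lie_equations_skew: "x (i, j, l) + x (j, i, l) \<in> lie_equations x"
  unfolding lie_equations_def by blast

lemma lie_equations_leibniz:
  "leibniz_defect x (basis_vec i) (basis_vec j) (basis_vec k) $ l \<in> lie_equations x"
  unfolding lie_equations_def by blast

lemma lie_equationsE [consumes 1, case_names skew leibniz]:
  assumes "e \<in> lie_equations x"
  obtains i j l where "e = x (i, j, l) + x (j, i, l)"
  | i j k l where "e = leibniz_defect x (basis_vec i) (basis_vec j) (basis_vec k) $ l"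
  using assms unfolding lie_equations_def by blast

context tideal
begin

text \<open>Calculations modulo an ideal are done with representatives, so that vectors and matrices
  keep their coefficients in a type.\<close>

definition vcong :: "'a^'n \<Rightarrow> 'a^'n \<Rightarrow> bool" where
  "vcong a b \<longleftrightarrow> (\<forall>l. a $ l - b $ l \<in> I)"

lemma vcong_refl: "vcong a a"
  by (simp add: vcong_def ideal_zero)

lemma vcong_trans: "vcong a b \<Longrightarrow> vcong b c \<Longrightarrow> vcong a c"
  unfolding vcong_def by (blast intro: cong_trans)

lemma vcong_sym: "vcong a b \<Longrightarrow> vcong b a"
  unfolding vcong_def by (blast intro: cong_sym)

lemma vcong_add: "vcong a b \<Longrightarrow> vcong c d \<Longrightarrow> vcong (a + c) (b + d)"
  unfolding vcong_def vector_add_component add_diff_add by (blast intro: ideal_add)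

lemma vcong_diff: "vcong a b \<Longrightarrow> vcong c d \<Longrightarrow> vcong (a - c) (b - d)"
proof -
  have *: "(a $ l - c $ l) - (b $ l - d $ l) = (a $ l - b $ l) - (c $ l - d $ l)" for l by simp
  show "vcong a b \<Longrightarrow> vcong c d \<Longrightarrow> vcong (a - c) (b - d)"
    unfolding vcong_def vector_minus_component * by (blast intro: ideal_diff)
qed

lemma cong_sum: "(\<And>i. i \<in> A \<Longrightarrow> f i - g i \<in> I) \<Longrightarrow> (\<Sum>i\<in>A. f i) - (\<Sum>i\<in>A. g i) \<in> I"
  unfolding sum_subtractf[symmetric] by (rule ideal_sum)

lemma vcong_bprod:
  assumes "\<And>v. x v - y v \<in> I" "vcong a c" "vcong b d"
  shows "vcong (bprod x a b) (bprod y c d)"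
  using assms unfolding vcong_def bprod_def by (auto intro!: cong_sum cong_mult)

lemma vcong_mult:
  assumes "\<And>i j. A $ i $ j - B $ i $ j \<in> I" "vcong a b"
  shows "vcong (A *v a) (B *v b)"
  using assms unfolding vcong_def matrix_vector_mult_def by (auto intro!: cong_sum cong_mult)

lemma linear_vec_mem:
  assumes "linear_vec T" "\<And>i. vcong (T (basis_vec i)) 0" shows "vcong (T a) 0"
  unfolding linear_vec_expansion[OF assms(1), of a] using assms(2)
  by (auto simp: vcong_def intro!: ideal_sum ideal_mult)

text \<open>The defect is linear in each argument, so the equations on basis vectors propagate to
  all vectors.\<close>

lemma leibniz_defect_mem:
  assumes "\<And>i j k. vcong (leibniz_defect Y (basis_vec i) (basis_vec j) (basis_vec k)) 0"
  shows "vcong (leibniz_defect Y a b c) 0"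
  by (rule linear_vec_mem[OF linear_vec_leibniz_defect(1)],
      rule linear_vec_mem[OF linear_vec_leibniz_defect(2)],
      rule linear_vec_mem[OF linear_vec_leibniz_defect(3)], rule assms)

lemma skew_mem:
  assumes "\<And>i j l. x (i, j, l) + x (j, i, l) \<in> I"
  shows "vcong (bprod x a b + bprod x b a) 0"
proof -
  have "bprod x b a $ l = (\<Sum>i\<in>UNIV. \<Sum>j\<in>UNIV. a $ i * b $ j * x (j, i, l))" for l
    unfolding bprod_def by (simp, subst sum.swap) (simp add: mult_ac)
  then have "bprod x a b $ l + bprod x b a $ l =
      (\<Sum>i\<in>UNIV. \<Sum>j\<in>UNIV. a $ i * b $ j * (x (i, j, l) + x (j, i, l)))" for l
    by (simp add: bprod_def sum.distrib distrib_left)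
  then show ?thesis using assms by (simp add: vcong_def ideal_sum ideal_mult)
qed

end

lemma tideal_zero: "tideal {0}"
  by unfold_locales auto

text \<open>The linear part in \<open>z\<close> of the Leibniz defect of \<open>x + z\<close>.\<close>

definition leibniz_linear ::
    "('r::comm_ring_1, 'n::finite) struct_consts \<Rightarrow> ('r, 'n) struct_consts
      \<Rightarrow> 'r^'n \<Rightarrow> 'r^'n \<Rightarrow> 'r^'n \<Rightarrow> 'r^'n" where
  "leibniz_linear x z a b c =
     bprod z (bprod x a b) c + bprod x (bprod z a b) c
     - (bprod z (bprod x a c) b + bprod x (bprod z a c) b + bprod z a (bprod x b c) + bprod x a (bprod z b c))"

lemma linear_vec_leibniz_linear:
  "linear_vec (leibniz_linear x z a b)" "linear_vec (\<lambda>b. leibniz_linear x z a b c)"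
  "linear_vec (\<lambda>a. leibniz_linear x z a b c)"
  by (simp_all add: leibniz_linear_def linear_vec_def bprod_linear vec_eq_iff algebra_simps)

section \<open>Adjoint matrices, the Killing form and its Casimir element\<close>

definition ad_mat :: "('r::comm_ring_1, 'n::finite) struct_consts \<Rightarrow> 'r^'n \<Rightarrow> 'r^'n^'n" where
  "ad_mat x a = (\<chi> l j. bprod x a (basis_vec j) $ l)"

lemma matrix_vector_basis: "(A :: 'r::comm_ring_1^'n^'n) *v basis_vec j = column j A"
  by (simp add: matrix_vector_mult_def column_def axis_def vec_eq_iff if_distrib cong: if_cong)

lemma linear_vec_mult: "linear_vec ((*v) (A :: 'r::comm_ring_1^'n^'n::finite))"
  by (simp add: linear_vec_def matrix_vector_right_distrib vec.scale)
    (simp add: matrix_vector_mult_def vec_eq_iff sum_distrib_left algebra_simps)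

lemma ad_mat_mult: "ad_mat x a *v b = bprod x a b"
proof (rule linear_vec_ext[OF linear_vec_mult])
  show "linear_vec (bprod x a)"
    by (simp add: linear_vec_def bprod_linear)
qed (simp add: matrix_vector_basis ad_mat_def column_def vec_eq_iff)

lemma matrix_eq_mult: "(\<And>v. (A :: 'r::comm_ring_1^'n^'n::finite) *v v = B *v v) \<Longrightarrow> A = B"
  using matrix_vector_basis[of A] matrix_vector_basis[of B] by (simp add: vec_eq_iff column_def)

lemma matrix_add_rdistrib: "((A :: 'r::comm_ring_1^'n^'m) + B) ** C = A ** C + B ** C"
  by (simp add: matrix_matrix_mult_def vec_eq_iff sum.distrib distrib_right)

text \<open>Carrying the inverse \<open>N\<close> as a parameter replaces division by the
  determinant; the locale can thus be instantiated over polynomial rings by base change from the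
  field.\<close>

locale killing_lie =
  fixes x :: "('r::comm_ring_1, 'n::finite) struct_consts" and N :: "'r^'n^'n"
  assumes lie: "\<And>e. e \<in> lie_equations x \<Longrightarrow> e = 0"
    and inverse_left: "N ** trace_form x = mat 1"
begin

abbreviation bracket where "bracket \<equiv> bprod x"

definition "killing a b = trace (ad_mat x a ** ad_mat x b)"

lemma skew: "bracket a b = - bracket b a"
proof -
  have "tideal.vcong {0} (bracket a b + bracket b a) 0"
    by (rule tideal.skew_mem[OF tideal_zero]) (use lie[OF lie_equations_skew] in blast)
  then have "bracket a b + bracket b a = 0" by (simp add: tideal.vcong_def[OF tideal_zero] vec_eq_iff)
  then show ?thesis by (simp only: eq_neg_iff_add_eq_0)
qed

lemma leibniz: "bracket (bracket a b) c = bracket (bracket a c) b + bracket a (bracket b c)"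
proof -
  have "tideal.vcong {0} (leibniz_defect x a b c) 0"
    by (rule tideal.leibniz_defect_mem[OF tideal_zero])
      (simp add: tideal.vcong_def[OF tideal_zero] lie[OF lie_equations_leibniz])
  then have "leibniz_defect x a b c = 0" by (simp add: tideal.vcong_def[OF tideal_zero] vec_eq_iff)
  then show ?thesis by (simp add: leibniz_defect_def)
qed

lemma jacobi: "bracket a (bracket b c) = bracket (bracket a b) c + bracket b (bracket a c)"
  using leibniz[of a b c] skew[of b "bracket a c"] by simp

lemma ad_bracket: "ad_mat x (bracket a b) = ad_mat x a ** ad_mat x b - ad_mat x b ** ad_mat x a"
  by (rule matrix_eq_mult)
    (simp add: ad_mat_mult matrix_vector_mult_diff_rdistrib jacobi[of a b]
      flip: matrix_vector_mul_assoc)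

lemma killing_sym: "killing a b = killing b a"
  unfolding killing_def by (rule trace_mul_sym)

text \<open>With A, B, C for the adjoint matrices, the sides are tr(ABC) - tr(BAC) and tr(ABC) -
  tr(ACB), which agree by cyclicity of the trace.\<close>

lemma killing_invariant: "killing (bracket a b) c = killing a (bracket b c)"
proof -
  have diff: "trace ((A - B) ** C) = trace (A ** C) - trace (B ** C)"
    "trace (C ** (A - B)) = trace (C ** A) - trace (C ** B)" for A B C :: "'r^'n^'n"
    by (simp_all add: trace_def matrix_matrix_mult_def sum_subtractf algebra_simps)
  show ?thesis
    unfolding killing_def ad_bracket diff matrix_mul_assoc
    using trace_mul_sym[of "ad_mat x b" "ad_mat x a ** ad_mat x c"]
    unfolding matrix_mul_assoc by argo
qed

lemma killing_linear:
  "killing (a + a') b = killing a b + killing a' b"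
  "killing (r *s a) b = r * killing a b"
proof -
  have *: "ad_mat x (a + a') = ad_mat x a + ad_mat x a'"
    by (simp add: ad_mat_def vec_eq_iff bprod_linear)
  have "ad_mat x (r *s a) $ i $ j = r * ad_mat x a $ i $ j" for i j
    by (simp add: ad_mat_def bprod_linear)
  then show "killing (r *s a) b = r * killing a b"
    by (simp add: killing_def trace_def matrix_matrix_mult_def sum_distrib_left mult_ac)
  show "killing (a + a') b = killing a b + killing a' b"
    by (simp add: killing_def trace_def matrix_matrix_mult_def * sum.distrib algebra_simps)
qed

lemma killing_minus: "killing (- a) b = - killing a b"
  using killing_linear(2)[of "- 1" a b] by (simp add: vector_smult_lneg)

lemma killing_sum: "killing (\<Sum>i\<in>A. f i) b = (\<Sum>i\<in>A. killing (f i) b)"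
proof -
  have "killing 0 b = 0" using killing_linear(1)[of 0 0 b] by simp
  then show ?thesis
    by (induction A rule: infinite_finite_induct) (auto simp: killing_linear)
qed

lemma killing_linear_right:
  "killing b (a + a') = killing b a + killing b a'"
  "killing b (r *s a) = r * killing b a"
  "killing b (- a) = - killing b a"
  "killing b (\<Sum>i\<in>A. f i) = (\<Sum>i\<in>A. killing b (f i))"
  unfolding killing_sym[of b] by (rule killing_linear killing_minus killing_sum)+

text \<open>Right multiplication is minus left multiplication, and the two signs cancel in the
  product under the trace.\<close>

lemma trace_form_eq: "trace_form x $ i $ j = killing (basis_vec i) (basis_vec j)"
proof -
  have m: "right_mult x a b = - (ad_mat x a *v b)" for a b
    using skew[of b a] by (simp add: right_mult_def ad_mat_mult)
  have "matrix (right_mult x (basis_vec i) \<circ> right_mult x (basis_vec j)) $ l $ k =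
      (ad_mat x (basis_vec i) ** ad_mat x (basis_vec j)) $ l $ k" for l k
  proof -
    have "matrix (right_mult x (basis_vec i) \<circ> right_mult x (basis_vec j)) $ l $ k =
        ((ad_mat x (basis_vec i) ** ad_mat x (basis_vec j)) *v basis_vec k) $ l"
      by (simp add: matrix_def m ad_mat_mult bprod_linear flip: matrix_vector_mul_assoc)
    then show ?thesis by (simp add: matrix_vector_basis column_def)
  qed
  then show ?thesis by (simp add: trace_form_def killing_def trace_def)
qed

abbreviation "K \<equiv> trace_form x"

lemma transpose_K: "transpose K = K"
  by (simp add: transpose_def vec_eq_iff trace_form_eq killing_sym)

text \<open>The Gram matrix is symmetric, so transposing the left inverse gives a right inverse, and
  a left and a right inverse coincide.\<close>

lemma inverse_right: "K ** N = mat 1"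
proof -
  have *: "K ** transpose N = mat 1"
    using arg_cong[OF inverse_left, of transpose] by (simp add: matrix_transpose_mul transpose_K)
  have "N = N ** (K ** transpose N)" by (simp add: *)
  also have "\<dots> = transpose N" by (simp only: matrix_mul_assoc inverse_left matrix_mul_lid)
  finally have "transpose N = N" by simp
  with * show ?thesis by simp
qed

lemma killing_expand: "killing v (basis_vec j) = (K *v v) $ j"
proof -
  have "killing v (basis_vec j) = killing (\<Sum>i\<in>UNIV. v $ i *s basis_vec i) (basis_vec j)"
    by (simp add: basis_expansion)
  also have "\<dots> = (\<Sum>i\<in>UNIV. v $ i * K $ j $ i)"
    unfolding killing_sum killing_linear trace_form_eq killing_sym[of "basis_vec j"] ..
  finally show ?thesis by (simp add: matrix_vector_mult_def mult.commute)
qed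

lemma killing_nondegenerate:
  assumes "\<And>j. killing v (basis_vec j) = killing w (basis_vec j)" shows "v = w"
proof -
  have "K *v v = K *v w" using assms by (simp add: killing_expand vec_eq_iff)
  then have "N *v (K *v v) = N *v (K *v w)" by simp
  then show ?thesis by (simp add: matrix_vector_mul_assoc inverse_left)
qed

text \<open>Pairing with the rows of \<open>N\<close> reads off coordinates; this is how a sum over
  i becomes a trace in \<open>casimir\<close>.\<close>

lemma killing_dual: "killing v (N $ l) = v $ l"
proof -
  have "killing v (N $ l) = killing v (\<Sum>j\<in>UNIV. N $ l $ j *s basis_vec j)"
    by (simp add: basis_expansion)
  also have "\<dots> = (\<Sum>j\<in>UNIV. N $ l $ j * (K *v v) $ j)"
    by (simp add: killing_linear_right killing_expand)
  also have "\<dots> = (N *v (K *v v)) $ l" by (simp add: matrix_vector_mult_def)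
  finally show ?thesis by (simp add: matrix_vector_mul_assoc inverse_left)
qed

text \<open>After pairing with a basis vector b, invariance moves the brackets until the sum pairs
  the images of the e_i under \<open>ad w\<close> composed with \<open>ad b\<close> with the dual
  basis. That sum is the trace of the composite, which is \<open>killing w b\<close> by
  definition.\<close>

lemma casimir: "(\<Sum>i\<in>UNIV. bracket (basis_vec i) (bracket (N $ i) w)) = w"
proof (rule killing_nondegenerate)
  fix j
  let ?C = "\<Sum>i\<in>UNIV. bracket (basis_vec i) (bracket (N $ i) w)"
  let ?b = "basis_vec j :: 'r^'n"
  have "killing (bracket (basis_vec i) (bracket (N $ i) w)) ?b =
      - killing (bracket ?b (basis_vec i)) (bracket w (N $ i))" for i
  proof -
    have "killing (bracket (basis_vec i) (bracket (N $ i) w)) ?b =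
        killing (bracket (bracket w (N $ i)) (basis_vec i)) ?b"
      by (metis skew bprod_minus(2) minus_minus)
    also have "\<dots> = killing (bracket w (N $ i)) (bracket (basis_vec i) ?b)"
      by (rule killing_invariant)
    also have "\<dots> = - killing (bracket ?b (basis_vec i)) (bracket w (N $ i))"
      by (subst skew) (simp only: killing_linear_right killing_sym[of "bracket w _"])
    finally show ?thesis .
  qed
  then have "killing ?C ?b =
      - (\<Sum>i\<in>UNIV. killing (bracket ?b (basis_vec i)) (bracket w (N $ i)))"
    by (simp add: killing_sum sum_negf)
  also have "\<dots> = (\<Sum>i\<in>UNIV. killing (bracket w (bracket ?b (basis_vec i))) (N $ i))"
    unfolding sum_negf[symmetric]
  proof (rule sum.cong[OF refl])
    fix i
    show "- killing (bracket ?b (basis_vec i)) (bracket w (N $ i)) =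
        killing (bracket w (bracket ?b (basis_vec i))) (N $ i)"
      by (metis killing_invariant skew killing_minus)
  qed
  also have "\<dots> = trace (ad_mat x w ** ad_mat x ?b)"
    by (simp add: killing_dual trace_def ad_mat_mult matrix_vector_basis column_def
        flip: matrix_vector_mul_assoc ad_mat_mult)
      (simp add: matrix_matrix_mult_def matrix_vector_mult_def column_def ad_mat_def)
  finally show "killing ?C ?b = killing w ?b"
    by (simp add: killing_def)
qed

text \<open>Invariance of the form under \<open>ad a\<close> says that M^T K + K M vanishes for M =
  \<open>ad_mat x a\<close>; multiplying by \<open>N\<close> on both sides gives invariance of the
  inverse form.\<close>

lemma casimir_invariant_matrix: "ad_mat x a ** N + N ** transpose (ad_mat x a) = 0"
proof -
  let ?M = "ad_mat x a"
  have col: "bracket a (basis_vec j) = (\<Sum>l\<in>UNIV. ?M $ l $ j *s basis_vec l)" for j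
    by (rule trans[OF basis_expansion[symmetric]]) (simp add: ad_mat_def)
  have "(transpose ?M ** K + K ** ?M) $ i $ j = 0" for i j
  proof -
    have "(transpose ?M ** K) $ i $ j = killing (bracket a (basis_vec i)) (basis_vec j)"
      by (simp add: col killing_sum killing_linear trace_form_eq matrix_matrix_mult_def transpose_def)
    also have "\<dots> = - killing (bracket a (basis_vec j)) (basis_vec i)"
      by (metis skew killing_minus killing_invariant killing_sym)
    also have "killing (bracket a (basis_vec j)) (basis_vec i) = (K ** ?M) $ i $ j"
      unfolding killing_sym[of _ "basis_vec i"]
      by (simp add: col killing_linear_right trace_form_eq matrix_matrix_mult_def mult.commute)
    finally show ?thesis by simp
  qed
  then have 0: "transpose ?M ** K + K ** ?M = 0" by (simp add: vec_eq_iff)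
  have "N ** (transpose ?M ** K + K ** ?M) ** N
      = N ** transpose ?M ** (K ** N) + (N ** K) ** ?M ** N"
    by (simp only: matrix_add_rdistrib matrix_add_ldistrib matrix_mul_assoc)
  then show ?thesis
    unfolding 0 inverse_left inverse_right by (simp add: add.commute)
qed

text \<open>The matrix identity says that \<open>ad a\<close> annihilates the tensor formed from the
  e_i and the rows of \<open>N\<close>; a bilinear \<beta> is a linear function of such
  tensors.\<close>

lemma casimir_invariant:
  assumes "\<And>v. linear_vec (\<lambda>u. \<beta> u v)" "\<And>u. linear_vec (\<beta> u)"
  shows "(\<Sum>i\<in>UNIV. \<beta> (bracket a (basis_vec i)) (N $ i)) =
    - (\<Sum>i\<in>UNIV. \<beta> (basis_vec i) (bracket a (N $ i)))"
proof -
  let ?M = "ad_mat x a" and ?\<beta> = "\<lambda>i j. \<beta> (basis_vec i) (basis_vec j)"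
  have \<beta>: "\<beta> u v = (\<Sum>l\<in>UNIV. \<Sum>j\<in>UNIV. (u $ l * v $ j) *s ?\<beta> l j)" for u v
    by (subst linear_vec_expansion[OF assms(1)], subst linear_vec_expansion[OF assms(2)])
      (simp add: smult_sum_right vector_smult_assoc)
  have comp: "bracket a v $ l = (\<Sum>j\<in>UNIV. ?M $ l $ j * v $ j)" for v l
    by (simp add: matrix_vector_mult_def flip: ad_mat_mult)
  have "(\<Sum>i\<in>UNIV. \<beta> (bracket a (basis_vec i)) (N $ i)) =
      (\<Sum>l\<in>UNIV. \<Sum>j\<in>UNIV. (?M ** N) $ l $ j *s ?\<beta> l j)"
    by (subst \<beta>, subst sum.swap, rule sum.cong[OF refl], subst sum.swap)
      (simp add: matrix_matrix_mult_def smult_sum_left ad_mat_def)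
  also have "\<dots> = - (\<Sum>l\<in>UNIV. \<Sum>j\<in>UNIV. (N ** transpose ?M) $ l $ j *s ?\<beta> l j)"
  proof -
    have "?M ** N = - (N ** transpose ?M)"
      using casimir_invariant_matrix[of a] by (simp add: eq_neg_iff_add_eq_0)
    then show ?thesis by (simp add: sum_negf vec_eq_iff)
  qed
  also have "(\<Sum>l\<in>UNIV. \<Sum>j\<in>UNIV. (N ** transpose ?M) $ l $ j *s ?\<beta> l j) =
      (\<Sum>i\<in>UNIV. \<beta> (basis_vec i) (bracket a (N $ i)))"
    by (rule sum.cong[OF refl], subst (2) linear_vec_expansion[OF assms(2)])
      (simp add: matrix_matrix_mult_def transpose_def comp mult.commute)
  finally show ?thesis .
qed

text \<open>The rows of \<open>N\<close> are the basis dual to the \<open>e\<^sub>i\<close>, so this is the contraction with the Casimir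
  element.\<close>

definition homotopy :: "('r, 'n) struct_consts \<Rightarrow> 'r^'n^'n" where
  "homotopy z = (\<chi> l j. (\<Sum>i\<in>UNIV. bracket (basis_vec i) (bprod z (N $ i) (basis_vec j))) $ l)"

lemma homotopy_mult: "homotopy z *v a = (\<Sum>i\<in>UNIV. bracket (basis_vec i) (bprod z (N $ i) a))"
proof (rule linear_vec_ext[OF linear_vec_mult])
  show "linear_vec (\<lambda>a. \<Sum>i\<in>UNIV. bracket (basis_vec i) (bprod z (N $ i) a))"
    by (simp add: linear_vec_def bprod_linear sum.distrib smult_sum_right)
qed (simp add: matrix_vector_basis homotopy_def column_def vec_eq_iff)

text \<open>In cochain notation this is z = d(h z) + h(d z) up to sign conventions: the first three
  terms are the coboundary of the linear map \<open>homotopy z\<close>, and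
  \<open>leibniz_linear x z\<close> is the coboundary of z. Inside the last sum the term with
  \<open>bprod z a b\<close> is the Casimir element applied to it, and the terms with brackets by a
  or b are rearranged by invariance.\<close>

lemma homotopy_identity:
  "bprod z a b = bracket a (homotopy z *v b) + bracket (homotopy z *v a) b
     - homotopy z *v (bracket a b)
     - (\<Sum>i\<in>UNIV. bracket (basis_vec i) (leibniz_linear x z (N $ i) a b))"
proof -
  let ?e = "basis_vec :: 'n \<Rightarrow> 'r^'n"
  let ?S = "\<lambda>f. \<Sum>i\<in>UNIV. bracket (?e i) (f (N $ i))"
  \<comment> \<open>Jacobi splits the bracket by a into two parts; in the second part invariance of
    the Casimir tensor shifts \<open>ad a\<close> from e_i to the dual vector.\<close>
  have move: "bracket a (homotopy z *v b) =
      ?S (\<lambda>u. bracket a (bprod z u b)) +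
      ?S (\<lambda>u. bprod z (bracket u a) b)" for a b
  proof -
    have "bracket a (homotopy z *v b) =
        ?S (\<lambda>u. bracket a (bprod z u b)) +
        (\<Sum>i\<in>UNIV. bracket (bracket a (?e i)) (bprod z (N $ i) b))"
      by (simp add: homotopy_mult bprod_linear jacobi[of a "?e _"] sum.distrib)
    also have "(\<Sum>i\<in>UNIV. bracket (bracket a (?e i)) (bprod z (N $ i) b)) =
        - ?S (\<lambda>u. bprod z (bracket a u) b)"
      by (rule casimir_invariant) (simp_all add: linear_vec_def bprod_linear)
    also have "\<dots> = ?S (\<lambda>u. bprod z (bracket u a) b)"
      by (subst skew) (simp add: bprod_linear sum_negf)
    finally show ?thesis .
  qed
  have L: "leibniz_linear x z u a b =
      bprod z (bracket u a) b - bracket b (bprod z u a) - bprod z (bracket u b) a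
      + bracket a (bprod z u b) - bprod z u (bracket a b) - bracket u (bprod z a b)" for u
    unfolding leibniz_linear_def
    using skew[of "bprod z u a" b] skew[of "bprod z u b" a] by simp
  have "?S (\<lambda>u. leibniz_linear x z u a b) =
      ?S (\<lambda>u. bprod z (bracket u a) b)
      - ?S (\<lambda>u. bracket b (bprod z u a))
      - ?S (\<lambda>u. bprod z (bracket u b) a)
      + ?S (\<lambda>u. bracket a (bprod z u b))
      - homotopy z *v (bracket a b) - bprod z a b"
    by (simp add: L bprod_add(2) bprod_diff(2) sum.distrib sum_subtractf homotopy_mult casimir)
  also have "\<dots> = bracket a (homotopy z *v b) - bracket b (homotopy z *v a)
      - homotopy z *v (bracket a b) - bprod z a b"
    unfolding move by simp
  finally have "?S (\<lambda>u. leibniz_linear x z u a b) = \<dots>" .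
  with skew[of "homotopy z *v a" b] show ?thesis by simp
qed

end

section \<open>Base change along ring homomorphisms\<close>

definition map_vec :: "('a \<Rightarrow> 'b) \<Rightarrow> 'a^'n \<Rightarrow> 'b^'n" where
  "map_vec h a = (\<chi> i. h (a $ i))"

definition map_mat :: "('a \<Rightarrow> 'b) \<Rightarrow> 'a^'n^'m \<Rightarrow> 'b^'n^'m" where
  "map_mat h A = (\<chi> i j. h (A $ i $ j))"

lemma map_vec_nth [simp]: "map_vec h a $ i = h (a $ i)"
  by (simp add: map_vec_def)

lemma map_mat_nth [simp]: "map_mat h A $ i $ j = h (A $ i $ j)"
  by (simp add: map_mat_def)

context comm_ring_hom
begin

lemma map_vec_basis: "map_vec h (basis_vec i) = basis_vec i"
  by (simp add: vec_eq_iff axis_def hom_one hom_zero)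

lemma map_vec_diff: "map_vec h (a - b) = map_vec h a - map_vec h b"
  by (simp add: vec_eq_iff hom_diff)

lemma map_vec_add: "map_vec h (a + b) = map_vec h a + map_vec h b"
  by (simp add: vec_eq_iff hom_add)

lemma map_mat_mult: "map_mat h (A ** B) = map_mat h A ** map_mat h B"
  by (simp add: vec_eq_iff matrix_matrix_mult_def homs)

lemma map_mat_vec_mult: "map_vec h (A *v b) = map_mat h A *v map_vec h b"
  by (simp add: vec_eq_iff matrix_vector_mult_def homs)

lemma map_mat_one: "map_mat h (mat 1) = mat 1"
  by (simp add: vec_eq_iff mat_def homs)

lemma hom_bprod: "map_vec h (bprod x a b) = bprod (\<lambda>v. h (x v)) (map_vec h a) (map_vec h b)"
  by (simp add: vec_eq_iff bprod_def homs)

lemma hom_leibniz_defect: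
  "map_vec h (leibniz_defect x a b c) =
    leibniz_defect (\<lambda>v. h (x v)) (map_vec h a) (map_vec h b) (map_vec h c)"
  by (simp add: leibniz_defect_def map_vec_diff map_vec_add hom_bprod)

lemma hom_leibniz_linear:
  "map_vec h (leibniz_linear x z a b c) =
    leibniz_linear (\<lambda>v. h (x v)) (\<lambda>v. h (z v)) (map_vec h a) (map_vec h b) (map_vec h c)"
  by (simp add: leibniz_linear_def map_vec_diff map_vec_add hom_bprod)

lemma hom_lie_equations: "lie_equations (\<lambda>v. h (x v)) = h ` lie_equations x"
proof -
  have "leibniz_defect (\<lambda>v. h (x v)) (basis_vec i) (basis_vec j) (basis_vec k) $ l =
      h (leibniz_defect x (basis_vec i) (basis_vec j) (basis_vec k) $ l)" for i j k l
    using arg_cong[OF hom_leibniz_defect[of x "basis_vec i" "basis_vec j" "basis_vec k"],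
      of "\<lambda>v. v $ l"] by (simp add: map_vec_basis)
  note leib = this
  show ?thesis
  proof (intro equalityI subsetI)
    fix e assume "e \<in> lie_equations (\<lambda>v. h (x v))"
    then show "e \<in> h ` lie_equations x"
      by (cases rule: lie_equationsE)
        (metis imageI hom_add leib lie_equations_skew lie_equations_leibniz)+
  next
    fix e assume "e \<in> h ` lie_equations x"
    then obtain e' where e': "e = h e'" "e' \<in> lie_equations x" by blast
    from e'(2) show "e \<in> lie_equations (\<lambda>v. h (x v))"
      unfolding e'(1)
    proof (cases rule: lie_equationsE)
      case (skew i j l)
      then show "h e' \<in> lie_equations (\<lambda>v. h (x v))"
        using lie_equations_skew[of "\<lambda>v. h (x v)" i j l] by (simp add: hom_add)
    next
      case (leibniz i j k l)
      then show "h e' \<in> lie_equations (\<lambda>v. h (x v))"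
        using lie_equations_leibniz[of "\<lambda>v. h (x v)" i j k l] by (simp only: leib)
    qed
  qed
qed

lemma hom_trace_form: "trace_form (\<lambda>v. h (x v)) = map_mat h (trace_form x)"
proof -
  have "bprod (\<lambda>v. h (x v)) (bprod (\<lambda>v. h (x v)) (basis_vec l) (basis_vec j)) (basis_vec i) $ l =
     h (bprod x (bprod x (basis_vec l) (basis_vec j)) (basis_vec i) $ l)" for i j l
    by (simp add: map_vec_basis hom_bprod flip: map_vec_nth[of h])
  then show ?thesis
    by (simp add: vec_eq_iff trace_form_def trace_def matrix_def right_mult_def homs)
qed

lemma hom_gl_act: "h (gl_act g g' x v) = gl_act (map_mat h g) (map_mat h g') (\<lambda>v. h (x v)) v"
proof -
  obtain i j l where v: "v = (i, j, l)" by (cases v)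
  show ?thesis
    by (simp add: v gl_act_def struct_consts_of_def hom_bprod map_mat_vec_mult map_vec_basis
        flip: map_vec_nth[of h])
qed

end

lemma linear_vec_bprod: "linear_vec (\<lambda>a. bprod x a b)" "linear_vec (bprod x a)"
  by (simp_all add: linear_vec_def bprod_linear)

lemma matrix_inv_left:
  assumes "invertible (A :: 'k::semiring_1^'n^'n)" shows "matrix_inv A ** A = mat 1"
    and matrix_inv_right: "A ** matrix_inv A = mat 1"
  using someI_ex[of "\<lambda>B. A ** B = mat 1 \<and> B ** A = mat 1"] assms
  unfolding invertible_def matrix_inv_def by blast+

lemma bprod_struct_consts_of:
  assumes "\<And>b. linear_vec (\<lambda>a. \<mu> a b)" "\<And>a. linear_vec (\<mu> a)"
  shows "bprod (struct_consts_of \<mu>) a b = \<mu> a b"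
proof -
  have "bprod (struct_consts_of \<mu>) (basis_vec i) (basis_vec j) = \<mu> (basis_vec i) (basis_vec j)"
    for i j by (simp add: vec_eq_iff bprod_basis struct_consts_of_def)
  then have "bprod (struct_consts_of \<mu>) (basis_vec i) b = \<mu> (basis_vec i) b" for i
    by (rule linear_vec_ext[OF linear_vec_bprod(2) assms(2)])
  then show ?thesis
    by (rule linear_vec_ext[OF linear_vec_bprod(1) assms(1)])
qed

lemma matrix_vector_linear:
  "(A :: 'r::comm_ring_1^'n^'n::finite) *v (a + b) = A *v a + A *v b"
  "A *v (a - b) = A *v a - A *v b"
  "A *v (r *s a) = r *s (A *v a)"
  "A *v (- a) = - (A *v a)"
  "A *v 0 = 0"
  by (simp_all add: matrix_vector_mult_def vec_eq_iff distrib_left right_diff_distrib sum.distrib sum_subtractf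
      sum_distrib_left sum_negf mult_ac)

lemma bprod_gl_act: "bprod (gl_act g h x) a b = g *v bprod x (h *v a) (h *v b)"
  unfolding gl_act_def
  by (rule bprod_struct_consts_of) (simp_all add: linear_vec_def matrix_vector_linear bprod_linear)

section \<open>Tangent spaces\<close>

text \<open>The universal property of k[GL(V)] relative to an ideal: matrices inverse to each other
  modulo \<open>T\<close> suffice, which admits the truncated inverses that occur over dual numbers
  and in the order-by-order argument.\<close>

lemma gl_ideal_hom_mem:
  fixes \<iota> :: "'k::field \<Rightarrow> 'r::comm_ring_1" and g h :: "'r^'n^'n::finite"
  assumes "comm_ring_hom \<iota>" "tideal T"
    and gh: "\<And>i j. (g ** h - mat 1) $ i $ j \<in> T" "\<And>i j. (h ** g - mat 1) $ i $ j \<in> T"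
    and f: "f \<in> gl_ideal"
  shows "msubst \<iota> (case_sum (\<lambda>(i, j). g $ i $ j) (\<lambda>(i, j). h $ i $ j)) f \<in> T"
proof -
  interpret \<iota>: comm_ring_hom \<iota> by fact
  define \<sigma> where "\<sigma> = case_sum (\<lambda>(i, j). g $ i $ j) (\<lambda>(i, j). h $ i $ j)"
  interpret S: comm_ring_hom "msubst \<iota> \<sigma>" by (rule \<iota>.msubst_hom)
  have G: "map_mat (msubst \<iota> \<sigma>) gl_gen = g" "map_mat (msubst \<iota> \<sigma>) gl_gen_inv = h"
    by (simp_all add: vec_eq_iff gl_gen_def gl_gen_inv_def \<iota>.msubst_mvar \<sigma>_def)
  have "msubst \<iota> \<sigma> ((A ** B - mat 1) $ i $ j) =
      (map_mat (msubst \<iota> \<sigma>) A ** map_mat (msubst \<iota> \<sigma>) B - mat 1) $ i $ j" for A B :: "_^'n^'n" and i j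
    unfolding S.map_mat_mult[symmetric] S.map_mat_one[symmetric] by (simp add: S.hom_diff)
  then have "gl_ideal \<subseteq> {f. msubst \<iota> \<sigma> f \<in> T}"
    unfolding gl_ideal_def
    by (intro Idl_least tideal_vimage assms S.comm_ring_hom_axioms)
      (auto simp only: G gh Un_iff mem_Collect_eq intro!: gh)
  with f show ?thesis by (auto simp: \<sigma>_def)
qed

lemma hom_orbit_comorphism:
  fixes \<iota> :: "'k::field \<Rightarrow> 'r::comm_ring_1" and g h :: "'r^'n^'n::finite"
  assumes "comm_ring_hom \<iota>"
  shows "msubst \<iota> (case_sum (\<lambda>(i, j). g $ i $ j) (\<lambda>(i, j). h $ i $ j)) (orbit_comorphism x f) =
    msubst \<iota> (gl_act g h (\<lambda>v. \<iota> (x v))) f"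
proof -
  interpret \<iota>: comm_ring_hom \<iota> by fact
  define \<sigma> where "\<sigma> = case_sum (\<lambda>(i, j). g $ i $ j) (\<lambda>(i, j). h $ i $ j)"
  interpret S: comm_ring_hom "msubst \<iota> \<sigma>" by (rule \<iota>.msubst_hom)
  have G: "map_mat (msubst \<iota> \<sigma>) gl_gen = g" "map_mat (msubst \<iota> \<sigma>) gl_gen_inv = h"
    by (simp_all add: vec_eq_iff gl_gen_def gl_gen_inv_def \<iota>.msubst_mvar \<sigma>_def)
  show ?thesis
    unfolding orbit_comorphism_def S.hom_msubst \<sigma>_def[symmetric]
    by (simp add: S.hom_gl_act \<iota>.msubst_mconst G)
qed

lemma orbit_comorphism_hom: "comm_ring_hom (orbit_comorphism x)"
  unfolding orbit_comorphism_def by (rule mconst.msubst_hom)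

text \<open>Equations of the orbit closure are tested on points that agree with a translate of x
  modulo \<open>T\<close>. Tangent vectors use \<open>T\<close> = (t^2), formal deformations use the
  steps of a filtration.\<close>

lemma orbit_ideal_hom_mem:
  fixes \<iota> :: "'k::field \<Rightarrow> 'r::comm_ring_1" and g h :: "'r^'n^'n::finite"
  assumes "comm_ring_hom \<iota>" "tideal T"
    and gh: "\<And>i j. (g ** h - mat 1) $ i $ j \<in> T" "\<And>i j. (h ** g - mat 1) $ i $ j \<in> T"
    and \<rho>: "\<And>v. \<rho> v - gl_act g h (\<lambda>v. \<iota> (x v)) v \<in> T"
    and f: "f \<in> orbit_ideal x"
  shows "msubst \<iota> \<rho> f \<in> T"
proof -
  interpret tideal T by fact
  have "msubst \<iota> (gl_act g h (\<lambda>v. \<iota> (x v))) f \<in> T"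
    unfolding hom_orbit_comorphism[OF assms(1), symmetric]
    by (rule gl_ideal_hom_mem[OF assms(1,2) gh]) (use f in \<open>simp add: orbit_ideal_def\<close>)
  then show ?thesis
    using msubst_cong_ideal[OF assms(1) \<rho>] by (rule cong_mem[rotated])
qed

lemma tideal_gl_ideal: "tideal gl_ideal"
  unfolding gl_ideal_def by (rule tideal_Idl)

lemma tideal_lie_ideal: "tideal lie_ideal"
  unfolding lie_ideal_def by (rule tideal_Idl)

interpretation lie: tideal "lie_ideal :: ('n::finite, 'k::field) bracket_poly set"
  by (rule tideal_lie_ideal)

interpretation gl: tideal "gl_ideal :: ('n::finite gl_var, 'k::field) mpoly set"
  by (rule tideal_gl_ideal)

lemma tideal_orbit_ideal: "tideal (orbit_ideal x)"
  unfolding orbit_ideal_def by (rule tideal_vimage[OF orbit_comorphism_hom tideal_gl_ideal])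

text \<open>The defect of the transported bracket is congruent to g applied to the defect of x at
  \<open>h *v a\<close>, \<open>h *v b\<close>, \<open>h *v c\<close>, since the inner products of h
  and g cancel modulo \<open>T\<close>.\<close>

lemma lie_equations_gl_act_mem:
  assumes "tideal T" and gh: "\<And>i j. (h ** g - mat 1) $ i $ j \<in> T"
    and x: "\<And>e. e \<in> lie_equations x \<Longrightarrow> e \<in> T" and e: "e \<in> lie_equations (gl_act g h x)"
  shows "e \<in> T"
proof -
  interpret tideal T by fact
  let ?y = "gl_act g h x" and ?b = basis_vec
  have vc_id: "vcong (h *v (g *v a)) a" for a
    using vcong_mult[of "h ** g" "mat 1" a a] gh vcong_refl[of a] by (simp add: matrix_vector_mul_assoc)
  have leib: "vcong (leibniz_defect x a b c) 0" for a b c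
    by (rule leibniz_defect_mem) (simp add: vcong_def x lie_equations_leibniz)
  have skew: "vcong (bprod x a b + bprod x b a) 0" for a b
    by (intro skew_mem x lie_equations_skew)
  have g0: "vcong (g *v a) 0" if "vcong a 0" for a
    using vcong_mult[OF _ that, of g g] by (simp add: ideal_zero matrix_vector_linear)
  have comp: "vcong (bprod ?y (bprod ?y a b) c) (g *v bprod x (bprod x (h *v a) (h *v b)) (h *v c))"
       "vcong (bprod ?y a (bprod ?y b c)) (g *v bprod x (h *v a) (bprod x (h *v b) (h *v c)))" for a b c
    unfolding bprod_gl_act by (intro vcong_mult vcong_bprod vc_id vcong_refl; simp add: ideal_zero)+
  have "vcong (leibniz_defect ?y a b c) (g *v leibniz_defect x (h *v a) (h *v b) (h *v c))" for a b c
    unfolding leibniz_defect_def matrix_vector_linear by (intro vcong_diff vcong_add comp)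
  then have L: "vcong (leibniz_defect ?y a b c) 0" for a b c
    using g0[OF leib] vcong_trans by blast
  have S: "vcong (bprod ?y a b + bprod ?y b a) 0" for a b
    unfolding bprod_gl_act matrix_vector_linear(1)[symmetric] by (rule g0[OF skew])
  have "?y (i, j, l) + ?y (j, i, l) \<in> T" for i j l
    using S[of "?b i" "?b j"] by (simp add: vcong_def bprod_basis)
  then show ?thesis
    using e L by (auto simp: vcong_def elim!: lie_equationsE)
qed

lemma gl_relations:
  "(gl_gen ** gl_gen_inv - mat 1) $ i $ j \<in> gl_ideal" "(gl_gen_inv ** gl_gen - mat 1) $ i $ j \<in> gl_ideal"
  unfolding gl_ideal_def
  by (rule subsetD[OF Idl_subset], rule UnI1, blast) (rule subsetD[OF Idl_subset], rule UnI2, blast)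

text \<open>The universal translate of x satisfies the Lie equations modulo the group relations;
  geometrically, the orbit closure lies in Lie(V).\<close>

lemma lie_ideal_subset_orbit_ideal:
  fixes x :: "('k::field, 'n::finite) struct_consts"
  assumes "x \<in> lie_points" shows "lie_ideal \<subseteq> orbit_ideal x"
  unfolding lie_ideal_def
proof (rule Idl_least[OF tideal_orbit_ideal subsetI])
  fix e assume e: "e \<in> lie_equations (mvar :: _ \<Rightarrow> ('n, 'k) bracket_poly)"
  interpret O: comm_ring_hom "orbit_comorphism x" by (rule orbit_comorphism_hom)
  have "orbit_comorphism x (mvar v) = gl_act gl_gen gl_gen_inv (\<lambda>v. mconst (x v)) v" for v
    by (simp add: orbit_comorphism_def mconst.msubst_mvar)
  then have "orbit_comorphism x e \<in> lie_equations (gl_act gl_gen gl_gen_inv (\<lambda>v. mconst (x v)))"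
    using O.hom_lie_equations[of mvar] e by simp
  then have "orbit_comorphism x e \<in> gl_ideal"
  proof (rule lie_equations_gl_act_mem[OF tideal_gl_ideal, rotated -1])
    show "(gl_gen_inv ** gl_gen - mat 1) $ i $ j \<in> gl_ideal" for i j by (rule gl_relations)
    show "e \<in> gl_ideal" if "e \<in> lie_equations (\<lambda>v. mconst (x v))" for e
    proof -
      have "e = 0" using that assms unfolding mconst.hom_lie_equations
        by (auto simp: lie_points_def mconst.hom_zero)
      then show ?thesis by (simp add: gl.ideal_zero)
    qed
  qed
  then show "e \<in> orbit_ideal x" by (simp add: orbit_ideal_def)
qed

text \<open>The defect is quadratic in the structure constants, so its expansion stops at
  t^2.\<close>

lemma leibniz_defect_perturb:
  "leibniz_defect (\<lambda>v. x v + t * y v) a b c =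
     leibniz_defect x a b c + t *s leibniz_linear x y a b c + (t * t) *s leibniz_defect y a b c"
  unfolding leibniz_defect_def leibniz_linear_def bprod_consts bprod_linear
    vec_eq_iff vector_add_component vector_minus_component vector_smult_component
  by (simp add: algebra_simps)

section \<open>Tangent vectors over the dual numbers\<close>

lemma const_poly_hom: "comm_ring_hom (\<lambda>c :: 'a::comm_ring_1. [:c:])"
  by unfold_locales auto

interpretation cpoly: comm_ring_hom "\<lambda>c :: 'a::comm_ring_1. [:c:]"
  by (rule const_poly_hom)

lemma dvd_square_iff_coeff:
  "[:0, 0, 1:] dvd p \<longleftrightarrow> coeff p 0 = 0 \<and> coeff p (Suc 0) = (0 :: 'a::comm_ring_1)"
proof
  assume "[:0, 0, 1:] dvd p" then show "coeff p 0 = 0 \<and> coeff p (Suc 0) = 0"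
    by (auto elim!: dvdE)
next
  assume *: "coeff p 0 = 0 \<and> coeff p (Suc 0) = 0"
  obtain a q where p: "p = pCons a q" by (cases p)
  obtain b r where q: "q = pCons b r" by (cases q)
  have "p = [:0, 0, 1:] * r" using * by (simp add: p q)
  then show "[:0, 0, 1:] dvd p" by (rule dvdI)
qed

text \<open>The coefficient of t in the Leibniz equation for x + t y is the cocycle condition on
  y.\<close>

lemma tangent_Lie_cocycle:
  fixes x :: "('k::field, 'n::finite) struct_consts"
  assumes x: "x \<in> lie_points" and y: "y \<in> tangent_Lie x"
  shows "leibniz_linear x y a b c = 0"
proof -
  let ?b = "basis_vec :: 'n \<Rightarrow> 'k^'n"
  have basis: "leibniz_linear x y (?b i) (?b j) (?b k) $ l = 0" for i j k l
  proof -
    let ?f = "leibniz_defect mvar (basis_vec i) (basis_vec j) (basis_vec k) $ l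
      :: ('n, 'k) bracket_poly"
    let ?\<rho> = "\<lambda>v. [:x v, y v:]"
    interpret S: comm_ring_hom "msubst (\<lambda>c. [:c:]) ?\<rho>" by (rule cpoly.msubst_hom)
    have "?f \<in> lie_ideal" unfolding lie_ideal_def by (rule subsetD[OF Idl_subset]) (rule lie_equations_leibniz)
    then have "[:0, 0, 1:] dvd msubst (\<lambda>c. [:c:]) ?\<rho> ?f"
      using y by (auto simp: tangent_Lie_def tangent_space_def)
    moreover have "msubst (\<lambda>c. [:c:]) ?\<rho> ?f =
        leibniz_defect ?\<rho> (basis_vec i) (basis_vec j) (basis_vec k) $ l"
      using arg_cong[OF S.hom_leibniz_defect[of mvar "basis_vec i" "basis_vec j" "basis_vec k"],
          of "\<lambda>v. v $ l"]
      by (simp add: S.map_vec_basis cpoly.msubst_mvar)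
    ultimately have dvd: "[:0, 0, 1:] dvd leibniz_defect ?\<rho> (basis_vec i) (basis_vec j) (basis_vec k) $ l"
      by simp
    have L: "leibniz_linear (\<lambda>v. [:x v:]) (\<lambda>v. [:y v:]) (basis_vec i) (basis_vec j) (basis_vec k) $ l
        = [: leibniz_linear x y (?b i) (?b j) (?b k) $ l :]"
      using arg_cong[OF cpoly.hom_leibniz_linear[of x y "?b i" "?b j" "?b k"], of "\<lambda>v. v $ l"]
      by (simp add: cpoly.map_vec_basis)
    have D: "leibniz_defect (\<lambda>v. [:x v:]) (basis_vec i) (basis_vec j) (basis_vec k) $ l
        = [: leibniz_defect x (?b i) (?b j) (?b k) $ l :]"
      using arg_cong[OF cpoly.hom_leibniz_defect[of x "?b i" "?b j" "?b k"], of "\<lambda>v. v $ l"]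
      by (simp add: cpoly.map_vec_basis)
    define q where "q = leibniz_defect (\<lambda>v. [:y v:]) (basis_vec i) (basis_vec j) (basis_vec k) $ l"
    have "leibniz_defect ?\<rho> (basis_vec i) (basis_vec j) (basis_vec k) $ l =
        leibniz_defect (\<lambda>v. [:x v:] + [:0, 1:] * [:y v:]) (basis_vec i) (basis_vec j) (basis_vec k) $ l"
      by simp
    also have "\<dots> = [: leibniz_defect x (?b i) (?b j) (?b k) $ l :] +
        [:0, 1:] * [: leibniz_linear x y (?b i) (?b j) (?b k) $ l :] + [:0, 1:] * [:0, 1:] * q"
      unfolding leibniz_defect_perturb by (simp only: L D q_def vector_add_component vector_smult_component)
    finally show ?thesis
      using dvd unfolding dvd_square_iff_coeff by simp
  qed
  note lin = linear_vec_leibniz_linear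
  have 0: "linear_vec (\<lambda>_. 0)" by (simp add: linear_vec_def)
  show ?thesis
    by (rule linear_vec_ext[OF lin(1) 0], rule linear_vec_ext[OF lin(2) 0],
        rule linear_vec_ext[OF lin(3) 0]) (simp add: vec_eq_iff basis)
qed

lemma matrix_diff_distrib:
  fixes A :: "'r::comm_ring_1^'n^'m"
  shows "(A - B) ** C = A ** C - B ** C" "A ** (D - E) = A ** D - A ** E"
  by (simp_all add: matrix_matrix_mult_def vec_eq_iff sum_subtractf left_diff_distrib right_diff_distrib)

text \<open>The derivative of g -> g . x at the identity in the direction -\<phi>; the sign is the
  one in which \<open>homotopy_identity\<close> produces coboundaries.\<close>

definition orbit_direction ::
    "('r::comm_ring_1, 'n::finite) struct_consts \<Rightarrow> 'r^'n^'n \<Rightarrow> ('r, 'n) struct_consts" where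
  "orbit_direction x \<phi> =
     struct_consts_of (\<lambda>a b. bprod x a (\<phi> *v b) + bprod x (\<phi> *v a) b - \<phi> *v bprod x a b)"

lemma matrix_vector_linear_left:
  "((A :: 'r::comm_ring_1^'n^'n::finite) + B) *v a = A *v a + B *v a"
  "(A - B) *v a = A *v a - B *v a"
  by (simp_all add: matrix_vector_mult_def vec_eq_iff algebra_simps sum.distrib sum_subtractf)

lemma orbit_direction_tangent:
  fixes x :: "('k::field, 'n::finite) struct_consts"
  shows "orbit_direction x \<phi> \<in> tangent_orbit x"
  unfolding tangent_orbit_def tangent_space_def mem_Collect_eq
proof (rule ballI)
  fix f assume f: "f \<in> orbit_ideal x"
  let ?C = "\<lambda>c :: 'k. [:c:]" and ?t = "[:0, 1:] :: 'k poly"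
  let ?T = "{p :: 'k poly. [:0, 0, 1:] dvd p}"
  let ?P = "map_mat ?C \<phi>"
  define P where "P = map_mat (\<lambda>c. ?t * [:c:]) \<phi>"
  have T: "tideal ?T" by unfold_locales auto
  have t2: "?t * (?t * q) \<in> ?T" for q by (simp add: dvd_square_iff_coeff)
  have PP: "(P ** P) $ i $ j \<in> ?T" for i j
    by (auto simp: P_def matrix_matrix_mult_def dvd_square_iff_coeff coeff_sum coeff_mult intro!: dvd_sum)
  have "msubst ?C (\<lambda>v. [:x v, orbit_direction x \<phi> v:]) f \<in> ?T"
  proof (rule orbit_ideal_hom_mem[OF const_poly_hom T _ _ _ f])
    \<comment> \<open>The dual-number point of the group is 1 - t \<phi>, with inverse 1 + t \<phi>
      because the square of t \<phi> vanishes modulo t^2.\<close>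
    have "(mat 1 - P) ** (mat 1 + P) - mat 1 = - (P ** P)"
      "(mat 1 + P) ** (mat 1 - P) - mat 1 = - (P ** P)"
      by (simp_all add: matrix_add_ldistrib matrix_add_rdistrib matrix_mul_lid matrix_mul_rid
          matrix_diff_distrib)
    then show "((mat 1 - P) ** (mat 1 + P) - mat 1) $ i $ j \<in> ?T"
      "((mat 1 + P) ** (mat 1 - P) - mat 1) $ i $ j \<in> ?T" for i j
      using PP[of i j] by simp_all
    fix v :: "'n \<times> 'n \<times> 'n"
    obtain i j l where v: "v = (i, j, l)" by (cases v)
    let ?x = "\<lambda>v. [:x v:]" and ?b = "basis_vec"
    have P: "P *v a = ?t *s (?P *v a)" for a
      by (simp add: P_def matrix_vector_mult_def vec_eq_iff sum_distrib_left mult_ac)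
    \<comment> \<open>In the expansion of the transported bracket, \<open>d\<close> is the
      coefficient of t and \<open>r\<close> collects the orders t^2 and t^3.\<close>
    define r where "r = bprod ?x (?P *v ?b i) (?P *v ?b j) - ?P *v bprod ?x (?b i) (?P *v ?b j)
          - ?P *v bprod ?x (?P *v ?b i) (?b j) - ?t *s (?P *v bprod ?x (?P *v ?b i) (?P *v ?b j))"
    define d where "d = bprod ?x (?b i) (?P *v ?b j) + bprod ?x (?P *v ?b i) (?b j) - ?P *v bprod ?x (?b i) (?b j)"
    have "gl_act (mat 1 - P) (mat 1 + P) ?x v =
        ((mat 1 - P) *v bprod ?x ((mat 1 + P) *v ?b i) ((mat 1 + P) *v ?b j)) $ l"
      by (simp add: v gl_act_def struct_consts_of_def)
    also have "\<dots> = (bprod ?x (?b i) (?b j) + ?t *s d + ?t *s (?t *s r)) $ l"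
      unfolding matrix_vector_linear_left matrix_vector_mul_lid P r_def d_def
      by (simp add: bprod_linear matrix_vector_linear)
    finally have act: "gl_act (mat 1 - P) (mat 1 + P) ?x v =
      bprod ?x (?b i) (?b j) $ l + ?t * d $ l + ?t * (?t * r $ l)" by simp
    have "bprod ?x (?b i) (?b j) $ l = [:x v:]" by (simp add: v bprod_basis)
    moreover have "d $ l = [:orbit_direction x \<phi> v:]"
    proof -
      have "d = map_vec ?C (bprod x (?b i) (\<phi> *v ?b j) + bprod x (\<phi> *v ?b i) (?b j) - \<phi> *v bprod x (?b i) (?b j))"
        by (simp add: d_def cpoly.map_vec_add cpoly.map_vec_diff cpoly.hom_bprod cpoly.map_mat_vec_mult
            cpoly.map_vec_basis)
      then show ?thesis by (simp add: v orbit_direction_def struct_consts_of_def)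
    qed
    ultimately have "[:x v, orbit_direction x \<phi> v:] - gl_act (mat 1 - P) (mat 1 + P) ?x v = - (?t * (?t * r $ l))"
      unfolding act by simp
    then show "[:x v, orbit_direction x \<phi> v:] - gl_act (mat 1 - P) (mat 1 + P) ?x v \<in> ?T"
      by (simp add: dvd_square_iff_coeff)
  qed
  then show "[:0, 0, 1:] dvd msubst ?C (\<lambda>v. [:x v, orbit_direction x \<phi> v:]) f" by simp
qed

lemma killing_lie_U_Lie:
  fixes x :: "('k::field, 'n::finite) struct_consts" and \<iota> :: "'k \<Rightarrow> 'r::comm_ring_1"
  assumes x: "x \<in> U_Lie" and "comm_ring_hom \<iota>"
  shows "killing_lie (\<lambda>v. \<iota> (x v)) (map_mat \<iota> (matrix_inv (trace_form x)))"
proof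
  interpret \<iota>: comm_ring_hom \<iota> by fact
  show "e = 0" if "e \<in> lie_equations (\<lambda>v. \<iota> (x v))" for e
    using that x unfolding \<iota>.hom_lie_equations by (auto simp: U_Lie_def lie_points_def \<iota>.hom_zero)
  have "invertible (trace_form x)" using x by (simp add: U_Lie_def invertible_det_nz)
  then have "matrix_inv (trace_form x) ** trace_form x = mat 1"
    by (rule matrix_inv_left)
  then show "map_mat \<iota> (matrix_inv (trace_form x)) ** trace_form (\<lambda>v. \<iota> (x v)) = mat 1"
    unfolding \<iota>.hom_trace_form \<iota>.map_mat_mult[symmetric] by (simp add: \<iota>.map_mat_one)
qed

lemma tangent_Lie_subset_directions:
  assumes x: "x \<in> U_Lie" and y: "y \<in> tangent_Lie x"
  shows "y \<in> range (orbit_direction x)"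
proof -
  interpret killing_lie x "matrix_inv (trace_form x)"
    using killing_lie_U_Lie[OF x comm_ring_hom_id] by (simp add: map_mat_def)
  have "leibniz_linear x y a b c = 0" for a b c
    by (rule tangent_Lie_cocycle[OF _ y]) (use x in \<open>simp add: U_Lie_def\<close>)
  then have "bprod y a b = bprod x a (homotopy y *v b) + bprod x (homotopy y *v a) b
     - homotopy y *v bprod x a b" for a b
    using homotopy_identity[of y a b] by (simp add: bprod_linear)
  then have "y (i, j, l) = orbit_direction x (homotopy y) (i, j, l)" for i j l
    by (simp add: orbit_direction_def struct_consts_of_def flip: bprod_basis[of y])
  then have "y = orbit_direction x (homotopy y)" by auto
  then show ?thesis by blast
qed

text \<open>Three inclusions close a cycle: tangent vectors of the orbit are tangent to Lie(V),
  these are orbit directions by the homotopy, and orbit directions are tangent to the orbit.\<close>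

lemma tangent_eq:
  assumes "x \<in> U_Lie"
  shows "tangent_Lie x = range (orbit_direction x)" "tangent_orbit x = range (orbit_direction x)"
proof -
  have "tangent_orbit x \<subseteq> tangent_Lie x"
    using lie_ideal_subset_orbit_ideal[of x] assms
    by (auto simp: tangent_orbit_def tangent_Lie_def tangent_space_def U_Lie_def)
  moreover have "tangent_Lie x \<subseteq> range (orbit_direction x)"
    using tangent_Lie_subset_directions[OF assms] by blast
  moreover have "range (orbit_direction x) \<subseteq> tangent_orbit x"
    using orbit_direction_tangent by blast
  ultimately show "tangent_Lie x = range (orbit_direction x)" "tangent_orbit x = range (orbit_direction x)"
    by auto
qed

text \<open>Orbit directions are closed under sums and differences, so each of them represents the
  zero coset.\<close>

lemma tangent_stack_trivial:
  assumes "x \<in> U_Lie"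
  shows "tangent_stack x = {vcoset (\<lambda>_. 0) (tangent_orbit x)}"
proof -
  let ?W = "range (orbit_direction x)"
  have add: "orbit_direction x \<phi> v + orbit_direction x \<psi> v = orbit_direction x (\<phi> + \<psi>) v"
    and diff: "orbit_direction x \<phi> v - orbit_direction x \<psi> v = orbit_direction x (\<phi> - \<psi>) v" for \<phi> \<psi> v
    by (auto simp: orbit_direction_def struct_consts_of_def matrix_vector_linear_left bprod_linear
        split: prod.splits)
  have "vcoset y ?W = vcoset (\<lambda>_. 0) ?W" if y: "y \<in> ?W" for y
  proof -
    obtain \<phi> where \<phi>: "y = orbit_direction x \<phi>" using y by blast
    have "w \<in> vcoset y ?W \<longleftrightarrow> w \<in> ?W" for w
    proof
      assume "w \<in> vcoset y ?W"
      then show "w \<in> ?W" by (auto simp: vcoset_def \<phi> add intro!: image_eqI[of _ _ "\<phi> + _"])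
    next
      assume "w \<in> ?W"
      then obtain \<psi> where "w = orbit_direction x \<psi>" by blast
      then have "w = (\<lambda>v. y v + orbit_direction x (\<psi> - \<phi>) v)"
        by (simp add: \<phi> fun_eq_iff flip: diff)
      then show "w \<in> vcoset y ?W" unfolding vcoset_def by blast
    qed
    then show ?thesis by (auto simp: vcoset_def)
  qed
  moreover have "?W \<noteq> {}" by blast
  ultimately show ?thesis
    unfolding tangent_stack_def quotient_space_def tangent_eq[OF assms] by blast
qed

section \<open>Deformations\<close>

text \<open>An abstraction of powers of an ideal. In the application \<open>F k\<close> is the
  preimage, in the polynomial ring, of the k-th power of the maximal ideal of x in the coordinate
  ring of Lie(V).\<close>

locale ideal_filtration =
  fixes F :: "nat \<Rightarrow> 'r::comm_ring_1 set"
  assumes filtration_ideal: "tideal (F k)"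
    and filtration_zero: "F 0 = UNIV"
    and filtration_Suc: "F (Suc k) \<subseteq> F k"
    and filtration_mult: "a \<in> F i \<Longrightarrow> b \<in> F j \<Longrightarrow> a * b \<in> F (i + j)"
begin

sublocale F: tideal "F k" for k
  by (rule filtration_ideal)

lemma filtration_antimono: "i \<le> j \<Longrightarrow> F j \<subseteq> F i"
  by (rule lift_Suc_antimono_le[of F]) (rule filtration_Suc)

definition vec_in :: "nat \<Rightarrow> 'r^'n \<Rightarrow> bool" where
  "vec_in k a \<longleftrightarrow> (\<forall>l. a $ l \<in> F k)"

lemma vec_in_zero: "vec_in k 0"
  by (simp add: vec_in_def F.ideal_zero)

lemma vec_in_add: "vec_in k a \<Longrightarrow> vec_in k b \<Longrightarrow> vec_in k (a + b)"
  by (simp add: vec_in_def F.ideal_add)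

lemma vec_in_diff: "vec_in k a \<Longrightarrow> vec_in k b \<Longrightarrow> vec_in k (a - b)"
  by (simp add: vec_in_def F.ideal_diff)

lemma vec_in_uminus: "vec_in k a \<Longrightarrow> vec_in k (- a)"
  by (simp add: vec_in_def F.ideal_uminus)

lemma vec_in_sum: "(\<And>i. i \<in> A \<Longrightarrow> vec_in k (f i)) \<Longrightarrow> vec_in k (\<Sum>i\<in>A. f i)"
  by (simp add: vec_in_def F.ideal_sum)

lemma vec_in_any: "vec_in 0 a"
  by (simp add: vec_in_def filtration_zero)

lemma vec_in_mono: "vec_in j a \<Longrightarrow> i \<le> j \<Longrightarrow> vec_in i a"
  using filtration_antimono unfolding vec_in_def by blast

lemma vec_in_bprod:
  assumes "\<And>v. z v \<in> F i" "vec_in j a" "vec_in m b"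
  shows "vec_in (i + j + m) (bprod z a b)"
  unfolding vec_in_def
proof
  fix l
  have "a $ p * b $ q * z (p, q, l) \<in> F (j + m + i)" for p q
    using assms by (intro filtration_mult) (auto simp: vec_in_def)
  then show "bprod z a b $ l \<in> F (i + j + m)"
    by (simp add: bprod_def F.ideal_sum add_ac)
qed

lemma vec_in_mult:
  assumes "\<And>p q. (A :: 'r^'n^'n::finite) $ p $ q \<in> F i" "vec_in j a"
  shows "vec_in (i + j) (A *v a)"
  using assms unfolding vec_in_def matrix_vector_mult_def
  by (auto intro!: F.ideal_sum filtration_mult)

text \<open>Neumann series, one term at a time.\<close>

lemma inverse_modulo:
  fixes g :: "'r^'n^'n::finite"
  assumes g: "\<And>i j. (g - mat 1) $ i $ j \<in> F 1"
  shows "\<exists>h. (\<forall>i j. (g ** h - mat 1) $ i $ j \<in> F k) \<and> (\<forall>i j. (h ** g - mat 1) $ i $ j \<in> F k)"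
proof (induction k)
  case 0
  then show ?case by (simp add: filtration_zero)
next
  case (Suc k)
  then obtain h where h: "\<And>i j. (g ** h - mat 1) $ i $ j \<in> F k" "\<And>i j. (h ** g - mat 1) $ i $ j \<in> F k"
    by blast
  let ?N = "mat 1 - g"
  have N: "?N $ i $ j \<in> F 1" for i j
    using F.ideal_uminus[OF g[of i j]] by simp
  have prod: "(?N ** A) $ i $ j \<in> F (Suc k)" if "\<And>i j. A $ i $ j \<in> F k" for A :: "'r^'n^'n" and i j
    unfolding matrix_matrix_mult_def
    using filtration_mult[OF N that] by (auto intro!: F.ideal_sum)
  let ?h = "mat 1 + ?N ** h"
  have "g ** ?h - mat 1 = ?N ** (g ** h - mat 1)" "?h ** g - mat 1 = ?N ** (h ** g - mat 1)"
    by (simp_all add: matrix_diff_distrib matrix_add_ldistrib matrix_add_rdistrib matrix_mul_assoc)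
  then show ?case using prod[OF h(1)] prod[OF h(2)] by metis
qed

end

text \<open>In the application \<open>Y\<close> is the universal bracket, given by the variables,
  and x is the constant bracket. \<open>Y\<close> satisfies the Leibniz identity to every order
  because the Lie ideal is contained in each \<open>F k\<close>.\<close>

locale killing_deformation = killing_lie x N + ideal_filtration F
  for x :: "('r::comm_ring_1, 'n::finite) struct_consts" and N and F :: "nat \<Rightarrow> 'r set" +
  fixes Y :: "('r, 'n) struct_consts"
  assumes near: "\<And>v. Y v - x v \<in> F 1"
    and leibniz_mem: "\<And>k a b c. vec_in k (leibniz_defect Y a b c)"
begin

lemma bprod_near:
  assumes "vec_in 1 (a - a')" "vec_in k b"
  shows "vec_in (Suc k) (bprod Y a b - bracket a' b)" "vec_in (Suc k) (bprod Y b a - bracket b a')"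
proof -
  let ?z = "\<lambda>v. Y v - x v"
  have eq: "bprod Y u v - bracket u v = bprod ?z u v" for u v
    by (simp add: vec_eq_iff bprod_def sum_subtractf right_diff_distrib)
  have "bprod Y a b - bracket a' b = bprod ?z a b + bracket (a - a') b"
    "bprod Y b a - bracket b a' = bprod ?z b a + bracket b (a - a')"
    by (simp_all flip: eq add: bprod_linear)
  moreover have "vec_in (1 + 0 + k) (bprod ?z a b)" "vec_in (1 + k + 0) (bprod ?z b a)"
    "vec_in (0 + 1 + k) (bracket (a - a') b)" "vec_in (0 + k + 1) (bracket b (a - a'))"
    by (rule vec_in_bprod assms near vec_in_any | simp add: filtration_zero)+
  ultimately show "vec_in (Suc k) (bprod Y a b - bracket a' b)" "vec_in (Suc k) (bprod Y b a - bracket b a')"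
    by (auto intro: vec_in_add)
qed

text \<open>Obstruction theory, one order at a time: if g intertwines x with \<open>Y\<close> up to
  order k, the error is a cocycle up to order k + 1, and subtracting its homotopy from g removes it
  to that order. Inverting g is left to \<open>inverse_modulo\<close>.\<close>

lemma trivial_deformation:
  assumes "1 \<le> k"
  shows "\<exists>g. (\<forall>i j. (g - mat 1) $ i $ j \<in> F 1) \<and>
    (\<forall>a b. vec_in k (bprod Y (g *v a) (g *v b) - g *v bracket a b))"
  using assms
proof (induction k rule: dec_induct)
  case base
  have "vec_in 1 (bprod Y a b - bracket a b)" for a b
    using bprod_near(1)[of a a 0 b] by (simp add: vec_in_zero vec_in_any)
  then show ?case
    by (intro exI[of _ "mat 1"]) (simp add: F.ideal_zero)
next
  case (step k)
  then obtain g where g1: "\<And>i j. (g - mat 1) $ i $ j \<in> F 1"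
    and g: "\<And>a b. vec_in k (bprod Y (g *v a) (g *v b) - g *v bracket a b)" by blast
  have near_g: "vec_in 1 (g *v a - a)" for a
  proof -
    have "g *v a - a = (g - mat 1) *v a" by (simp add: matrix_vector_linear_left)
    then show ?thesis using vec_in_mult[OF g1 vec_in_any] by simp
  qed
  \<comment> \<open>The failure of g to intertwine the two brackets, a bilinear product of order
    k.\<close>
  define z where "z = struct_consts_of (\<lambda>a b. bprod Y (g *v a) (g *v b) - g *v bracket a b)"
  have z: "bprod z a b = bprod Y (g *v a) (g *v b) - g *v bracket a b" for a b
    unfolding z_def
    by (rule bprod_struct_consts_of)
      (simp_all add: linear_vec_def matrix_vector_linear bprod_linear vec_eq_iff algebra_simps)
  have zk: "vec_in k (bprod z a b)" for a b unfolding z by (rule g)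
  have Yg: "bprod Y (g *v a) (g *v b) = bprod z a b + g *v bracket a b" for a b
    by (simp add: z)
  have near_Y: "vec_in (Suc k) (bprod Y (g *v a) w - bracket a w)"
    "vec_in (Suc k) (bprod Y w (g *v a) - bracket w a)" if "vec_in k w" for a w
    using bprod_near[OF near_g that] by auto
  have cocycle: "vec_in (Suc k) (leibniz_linear x z a b c)" for a b c
  proof -
    have "g *v leibniz_defect x a b c = 0"
      using leibniz[of a b c] by (simp add: leibniz_defect_def matrix_vector_linear)
    \<comment> \<open>In the defect of \<open>Y\<close> at the vectors \<open>g *v a\<close>,
      \<open>g *v b\<close>, \<open>g *v c\<close> the part without z is g applied to the defect of
      x, which is zero. The terms linear in z contain \<open>Y\<close> and g; replacing these by x
      and the identity changes them by order k + 1.\<close>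
    then have "leibniz_linear x z a b c = leibniz_defect Y (g *v a) (g *v b) (g *v c)
      - (bprod Y (bprod z a b) (g *v c) - bracket (bprod z a b) c)
      + (bprod Y (bprod z a c) (g *v b) - bracket (bprod z a c) b)
      + (bprod Y (g *v a) (bprod z b c) - bracket a (bprod z b c))"
      unfolding leibniz_defect_def leibniz_linear_def matrix_vector_linear Yg bprod_linear
      by (simp add: algebra_simps)
    then show ?thesis
      by (simp only:) (intro vec_in_add vec_in_diff leibniz_mem near_Y zk)
  qed
  define \<phi> where "\<phi> = homotopy z"
  have \<phi>: "vec_in k (\<phi> *v a)" for a
    unfolding \<phi>_def homotopy_mult
    using vec_in_bprod[of x 0 0 "basis_vec _" k "bprod z (N $ _) a"]
    by (intro vec_in_sum) (simp add: filtration_zero vec_in_any zk)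
  have "vec_in (Suc k) (bprod Y ((g - \<phi>) *v a) ((g - \<phi>) *v b) - (g - \<phi>) *v bracket a b)" for a b
  proof -
    let ?E = "bprod Y ((g - \<phi>) *v a) ((g - \<phi>) *v b) - (g - \<phi>) *v bracket a b"
    have "?E =
        bprod z a b - (bracket a (\<phi> *v b) + bracket (\<phi> *v a) b - \<phi> *v bracket a b)
        - (bprod Y (g *v a) (\<phi> *v b) - bracket a (\<phi> *v b))
        - (bprod Y (\<phi> *v a) (g *v b) - bracket (\<phi> *v a) b)
        + bprod Y (\<phi> *v a) (\<phi> *v b)"
      unfolding matrix_vector_linear_left bprod_linear Yg by (simp add: algebra_simps)
    also have "bprod z a b - (bracket a (\<phi> *v b) + bracket (\<phi> *v a) b - \<phi> *v bracket a b) =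
        - (\<Sum>i\<in>UNIV. bracket (basis_vec i) (leibniz_linear x z (N $ i) a b))"
      by (subst homotopy_identity) (simp add: \<phi>_def)
    finally have eq: "?E =
        - (\<Sum>i\<in>UNIV. bracket (basis_vec i) (leibniz_linear x z (N $ i) a b))
        - (bprod Y (g *v a) (\<phi> *v b) - bracket a (\<phi> *v b))
        - (bprod Y (\<phi> *v a) (g *v b) - bracket (\<phi> *v a) b)
        + bprod Y (\<phi> *v a) (\<phi> *v b)" .
    \<comment> \<open>This term is quadratic in \<phi>, hence of order 2k, and 2k is at least k + 1
      because the induction starts at 1.\<close>
    have "vec_in (0 + k + k) (bprod Y (\<phi> *v a) (\<phi> *v b))"
      by (rule vec_in_bprod) (auto simp: filtration_zero \<phi>)
    then have 1: "vec_in (Suc k) (bprod Y (\<phi> *v a) (\<phi> *v b))"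
      by (rule vec_in_mono) (use step.hyps in simp)
    have "vec_in (0 + 0 + Suc k) (bracket (basis_vec i) (leibniz_linear x z (N $ i) a b))" for i
      by (rule vec_in_bprod) (auto simp: filtration_zero vec_in_any cocycle)
    then show ?thesis
      unfolding eq by (intro vec_in_add vec_in_diff vec_in_uminus vec_in_sum near_Y \<phi> 1) simp
  qed
  moreover have "(g - \<phi> - mat 1) $ i $ j \<in> F 1" for i j
  proof -
    have "\<phi> $ i $ j \<in> F k"
      using \<phi>[of "basis_vec j"] by (simp add: vec_in_def matrix_vector_basis column_def)
    then have "\<phi> $ i $ j \<in> F 1" using filtration_antimono[OF step.hyps(1)] by blast
    then show ?thesis
      using F.ideal_diff[OF g1[of i j]] by (simp add: algebra_simps)
  qed
  ultimately show ?case by blast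
qed

text \<open>Up to order k, \<open>Y\<close> is the translate of x by the intertwiner g, with a
  Neumann inverse h of the same accuracy; hence it satisfies the equations of the orbit closure to
  that order.\<close>

lemma orbit_ideal_mem:
  fixes \<iota> :: "'k::field \<Rightarrow> 'r"
  assumes "comm_ring_hom \<iota>" "x = (\<lambda>v. \<iota> (x0 v))" and f: "f \<in> orbit_ideal x0"
  shows "msubst \<iota> Y f \<in> F k"
proof (cases "k = 0")
  case False
  obtain g where g1: "\<And>i j. (g - mat 1) $ i $ j \<in> F 1"
    and g: "\<And>a b. vec_in k (bprod Y (g *v a) (g *v b) - g *v bracket a b)"
    using trivial_deformation[of k] False by auto
  obtain h where h: "\<And>i j. (g ** h - mat 1) $ i $ j \<in> F k" "\<And>i j. (h ** g - mat 1) $ i $ j \<in> F k"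
    using inverse_modulo[OF g1] by metis
  have cong: "Y v - gl_act g h x v \<in> F k" for v
  proof -
    obtain i j l where v: "v = (i, j, l)" by (cases v)
    let ?a = "h *v basis_vec i" and ?b = "h *v basis_vec j"
    have gh: "F.vcong k (g *v (h *v a)) a" for a
      using F.vcong_mult[where k = k and A = "g ** h" and B = "mat 1" and b = a, OF _ F.vcong_refl] h
      by (simp add: matrix_vector_mul_assoc)
    have "F.vcong k (bprod Y (g *v ?a) (g *v ?b)) (bprod Y (basis_vec i) (basis_vec j))"
      by (intro F.vcong_bprod gh) (simp add: F.ideal_zero)
    moreover have "F.vcong k (bprod Y (g *v ?a) (g *v ?b)) (g *v bracket ?a ?b)"
      using g[of ?a ?b] by (simp add: F.vcong_def vec_in_def)
    ultimately have "F.vcong k (bprod Y (basis_vec i) (basis_vec j)) (g *v bracket ?a ?b)"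
      using F.vcong_sym F.vcong_trans by blast
    then show ?thesis
      by (simp add: v F.vcong_def bprod_basis gl_act_def struct_consts_of_def)
  qed
  show ?thesis
    by (rule orbit_ideal_hom_mem[OF assms(1) filtration_ideal h _ f]) (use cong assms(2) in simp)
qed (simp add: filtration_zero)

end

section \<open>Finitely generated algebras\<close>

text \<open>Subrings are sets inside one ambient type, so that elements can be adjoined one by one
  within a fixed polynomial ring or field.\<close>

locale is_subring =
  fixes A :: "'a::comm_ring_1 set"
  assumes sub_one: "1 \<in> A"
    and sub_diff: "a \<in> A \<Longrightarrow> b \<in> A \<Longrightarrow> a - b \<in> A"
    and sub_mult: "a \<in> A \<Longrightarrow> b \<in> A \<Longrightarrow> a * b \<in> A"
begin

lemma sub_zero: "0 \<in> A"
  using sub_diff[OF sub_one sub_one] by simp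

lemma sub_uminus: "a \<in> A \<Longrightarrow> - a \<in> A"
  using sub_diff[OF sub_zero, of a] by simp

lemma sub_add: "a \<in> A \<Longrightarrow> b \<in> A \<Longrightarrow> a + b \<in> A"
  using sub_diff[of a "- b"] sub_uminus[of b] by simp

lemma sub_sum: "(\<And>i. i \<in> S \<Longrightarrow> f i \<in> A) \<Longrightarrow> (\<Sum>i\<in>S. f i) \<in> A"
  by (induction S rule: infinite_finite_induct) (auto intro: sub_zero sub_add)

lemma sub_power: "a \<in> A \<Longrightarrow> a ^ k \<in> A"
  by (induction k) (auto intro: sub_one sub_mult)

end

lemma subring_UNIV: "is_subring UNIV"
  by unfold_locales auto

lemma subring_image:
  assumes "comm_ring_hom h" "is_subring A" shows "is_subring (h ` A)"
proof -
  interpret comm_ring_hom h by fact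
  interpret is_subring A by fact
  show ?thesis
  proof
    show "1 \<in> h ` A" using sub_one hom_one by (metis imageI)
    show "a - b \<in> h ` A" "a * b \<in> h ` A" if "a \<in> h ` A" "b \<in> h ` A" for a b
      using that by (auto simp flip: hom_diff hom_mult intro!: imageI sub_diff sub_mult)
  qed
qed

definition polys_over :: "'a::comm_ring_1 set \<Rightarrow> 'a poly set" where
  "polys_over A = {p. \<forall>i. coeff p i \<in> A}"

lemma polys_overD: "p \<in> polys_over A \<Longrightarrow> coeff p i \<in> A"
  by (simp add: polys_over_def)

lemma subring_polys_over:
  assumes "is_subring A" shows "is_subring (polys_over A)"
proof -
  interpret is_subring A by fact
  show ?thesis
    by unfold_locales
      (auto simp: polys_over_def sub_zero sub_one coeff_mult sub_diff intro!: sub_sum sub_mult)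
qed

lemma monom_polys_over: "is_subring A \<Longrightarrow> c \<in> A \<Longrightarrow> monom c k \<in> polys_over A"
  by (auto simp: polys_over_def is_subring.sub_zero)

definition adjoin :: "'a::comm_ring_1 set \<Rightarrow> 'a \<Rightarrow> 'a set" where
  "adjoin A t = (\<lambda>p. poly p t) ` polys_over A"

lemma poly_eval_hom: "comm_ring_hom (\<lambda>p. poly p (t :: 'a::comm_ring_1))"
  by unfold_locales auto

lemma subring_adjoin: "is_subring A \<Longrightarrow> is_subring (adjoin A t)"
  unfolding adjoin_def by (intro subring_image poly_eval_hom subring_polys_over)

lemma adjoin_superset: assumes "is_subring A" shows "A \<subseteq> adjoin A t"
proof
  fix a assume "a \<in> A"
  then have "poly (monom a 0) t \<in> adjoin A t"
    unfolding adjoin_def by (intro imageI monom_polys_over assms)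
  then show "a \<in> adjoin A t" by (simp add: poly_monom)
qed

lemma adjoin_mem: assumes "is_subring A" shows "t \<in> adjoin A t"
proof -
  have "poly (monom 1 1) t \<in> adjoin A t"
    unfolding adjoin_def by (intro imageI monom_polys_over assms is_subring.sub_one)
  then show ?thesis by (simp add: poly_monom)
qed

lemma adjoin_least:
  assumes "is_subring C" "A \<subseteq> C" "t \<in> C" shows "adjoin A t \<subseteq> C"
proof
  interpret is_subring C by fact
  fix a assume "a \<in> adjoin A t"
  then show "a \<in> C"
    using assms by (auto simp: adjoin_def poly_altdef polys_over_def intro!: sub_sum sub_mult sub_power)
qed

fun adjoin_list :: "'a::comm_ring_1 set \<Rightarrow> 'a list \<Rightarrow> 'a set" where
  "adjoin_list A [] = A"
| "adjoin_list A (t # ts) = adjoin_list (adjoin A t) ts"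

lemma subring_adjoin_list: "is_subring A \<Longrightarrow> is_subring (adjoin_list A ts)"
  by (induction ts arbitrary: A) (auto intro: subring_adjoin)

lemma adjoin_list_superset: "is_subring A \<Longrightarrow> A \<union> set ts \<subseteq> adjoin_list A ts"
proof (induction ts arbitrary: A)
  case (Cons t ts)
  then show ?case
    using Cons.IH[OF subring_adjoin[OF Cons.prems, of t]] adjoin_superset[OF Cons.prems, of t]
      adjoin_mem[OF Cons.prems, of t] by auto
qed auto

lemma adjoin_list_least:
  "is_subring C \<Longrightarrow> A \<union> set ts \<subseteq> C \<Longrightarrow> adjoin_list A ts \<subseteq> C"
proof (induction ts arbitrary: A)
  case (Cons t ts)
  then show ?case using adjoin_least[of C A t] by auto
qed auto

subsection \<open>Noetherian rings\<close>

definition seq_span :: "'a::comm_ring_1 set \<Rightarrow> (nat \<Rightarrow> 'a) \<Rightarrow> nat \<Rightarrow> 'a set" where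
  "seq_span A f n = {\<Sum>i<n. c i * f i | c. \<forall>i. c i \<in> A}"

lemma seq_spanI: "(\<And>i. c i \<in> A) \<Longrightarrow> a = (\<Sum>i<n. c i * f i) \<Longrightarrow> a \<in> seq_span A f n"
  unfolding seq_span_def by auto

lemma seq_spanE:
  assumes "a \<in> seq_span A f n"
  obtains c where "\<And>i. c i \<in> A" "a = (\<Sum>i<n. c i * f i)"
  using assms unfolding seq_span_def by auto

definition ideal_of :: "'a::comm_ring_1 set \<Rightarrow> 'a set \<Rightarrow> bool" where
  "ideal_of A I \<longleftrightarrow> I \<subseteq> A \<and> 0 \<in> I \<and> (\<forall>a\<in>I. \<forall>b\<in>I. a + b \<in> I) \<and> (\<forall>r\<in>A. \<forall>a\<in>I. r * a \<in> I)"

definition noetherian :: "'a::comm_ring_1 set \<Rightarrow> bool" where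
  "noetherian A \<longleftrightarrow> (\<forall>I. ideal_of A I \<longrightarrow> (\<exists>f n. (\<forall>i<n. f i \<in> I) \<and> I \<subseteq> seq_span A f n))"

lemma ideal_of_sum: "ideal_of A I \<Longrightarrow> (\<And>i. i \<in> S \<Longrightarrow> f i \<in> I) \<Longrightarrow> (\<Sum>i\<in>S. f i) \<in> I"
  by (induction S rule: infinite_finite_induct) (auto simp: ideal_of_def)

lemma seq_span_least: "ideal_of A I \<Longrightarrow> (\<And>i. i < n \<Longrightarrow> f i \<in> I) \<Longrightarrow> seq_span A f n \<subseteq> I"
  unfolding seq_span_def by (auto intro!: ideal_of_sum[of A] simp: ideal_of_def)

context is_subring
begin

lemma seq_span_mono:
  assumes "n \<le> m" shows "seq_span A f n \<subseteq> seq_span A f m"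
proof
  fix a assume "a \<in> seq_span A f n"
  then obtain c where c: "\<And>i. c i \<in> A" and a: "a = (\<Sum>i<n. c i * f i)"
    by (auto simp: seq_span_def)
  show "a \<in> seq_span A f m"
    by (rule seq_spanI[of "\<lambda>i. if i < n then c i else 0"])
      (use assms in \<open>auto simp: a c sub_zero intro!: sum.mono_neutral_cong_left split: if_splits\<close>)
qed

lemma seq_span_mem:
  assumes "i < n" shows "f i \<in> seq_span A f n"
  by (rule seq_spanI[of "\<lambda>j. if j = i then 1 else 0"])
    (use assms in \<open>auto simp: sub_zero sub_one if_distrib[of "\<lambda>u. u * _"] cong: if_cong\<close>)

lemma seq_span_zero: "0 \<in> seq_span A f n"
  unfolding seq_span_def using sub_zero by (auto intro!: exI[of _ "\<lambda>_. 0"])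

lemma seq_span_add:
  assumes "a \<in> seq_span A f n" "b \<in> seq_span A f n" shows "a + b \<in> seq_span A f n"
proof -
  obtain c where c: "\<And>i. c i \<in> A" "a = (\<Sum>i<n. c i * f i)" using assms(1) by (rule seq_spanE) blast
  obtain d where d: "\<And>i. d i \<in> A" "b = (\<Sum>i<n. d i * f i)" using assms(2) by (rule seq_spanE) blast
  show ?thesis
    by (rule seq_spanI[of "\<lambda>i. c i + d i"]) (simp_all add: c d distrib_right sum.distrib sub_add)
qed

lemma seq_span_mult:
  assumes "a \<in> seq_span A f n" "r \<in> A" shows "r * a \<in> seq_span A f n"
proof -
  obtain c where c: "\<And>i. c i \<in> A" "a = (\<Sum>i<n. c i * f i)"
    using assms(1) by (rule seq_spanE) blast
  show ?thesis
    by (rule seq_spanI[of "\<lambda>i. r * c i"]) (simp_all add: assms c sum_distrib_left mult.assoc sub_mult)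
qed

text \<open>The ascending chain condition in the form used below: the union of the spans is a
  finitely generated ideal, its generators already lie in one span, and the next member of the
  sequence follows.\<close>

lemma noetherian_seq:
  assumes "noetherian A" and f: "\<And>i. f i \<in> A"
  obtains n where "f n \<in> seq_span A f n"
proof -
  define I where "I = (\<Union>n. seq_span A f n)"
  have A: "ideal_of A A" using sub_zero sub_add sub_mult by (auto simp: ideal_of_def)
  have "ideal_of A I"
    unfolding ideal_of_def
  proof (intro conjI ballI)
    show "I \<subseteq> A" unfolding I_def using seq_span_least[OF A] f by blast
    show "0 \<in> I" unfolding I_def using seq_span_zero by blast
    show "r * a \<in> I" if "r \<in> A" "a \<in> I" for r a
      using that seq_span_mult unfolding I_def by blast
    fix a b assume "a \<in> I" "b \<in> I"
    then obtain n m where "a \<in> seq_span A f n" "b \<in> seq_span A f m" unfolding I_def by blast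
    then have "a \<in> seq_span A f (max n m)" "b \<in> seq_span A f (max n m)"
      using seq_span_mono[of n "max n m"] seq_span_mono[of m "max n m"] by auto
    then show "a + b \<in> I" unfolding I_def using seq_span_add by blast
  qed
  then obtain g n where g: "\<And>i. i < n \<Longrightarrow> g i \<in> I" and I: "I \<subseteq> seq_span A g n"
    using assms(1) unfolding noetherian_def by blast
  have "\<exists>m. \<forall>i<n. g i \<in> seq_span A f m"
  proof -
    obtain m where m: "\<And>i. i < n \<Longrightarrow> g i \<in> seq_span A f (m i)" using g unfolding I_def by auto metis
    have "m i \<le> Max (m ` {..<n})" if "i < n" for i using that by auto
    then show ?thesis using m seq_span_mono by blast
  qed
  then obtain m where m: "\<And>i. i < n \<Longrightarrow> g i \<in> seq_span A f m" by blast
  have "ideal_of A (seq_span A f m)"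
    unfolding ideal_of_def using seq_span_zero seq_span_add seq_span_mult seq_span_least[OF A] f by blast
  then have "seq_span A g n \<subseteq> seq_span A f m" using seq_span_least m by blast
  moreover have "f m \<in> I" unfolding I_def using seq_span_mem[of m "Suc m"] by blast
  ultimately show ?thesis using that I by blast
qed

text \<open>Generators are chosen of least possible degree; their leading coefficients generate an ideal
  of \<open>A\<close>.\<close>

theorem hilbert_basis:
  assumes "noetherian A" shows "noetherian (polys_over A)"
  unfolding noetherian_def
proof (intro allI impI, rule ccontr)
  fix I assume I: "ideal_of (polys_over A) I"
    and no: "\<not> (\<exists>f n. (\<forall>i<n. f i \<in> I) \<and> I \<subseteq> seq_span (polys_over A) f n)"
  interpret P: is_subring "polys_over A"
    by (rule subring_polys_over) (rule is_subring_axioms)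
  let ?S = "seq_span (polys_over A)" and ?d = degree
  have "\<exists>f :: nat \<Rightarrow> 'a poly. \<forall>n. f n \<in> I \<and> f n \<notin> ?S f n \<and> (\<forall>q\<in>I. q \<notin> ?S f n \<longrightarrow> ?d (f n) \<le> ?d q)"
  proof (rule dependent_wf_choice[of less_than
      "\<lambda>f n r. r \<in> I \<and> r \<notin> ?S f n \<and> (\<forall>q\<in>I. q \<notin> ?S f n \<longrightarrow> ?d r \<le> ?d q)"])
    fix f g :: "nat \<Rightarrow> 'a poly" and n r assume "\<And>z. (z, n) \<in> less_than \<Longrightarrow> f z = g z"
    then have "?S f n = ?S g n" by (simp add: seq_span_def)
    then show "(r \<in> I \<and> r \<notin> ?S f n \<and> (\<forall>q\<in>I. q \<notin> ?S f n \<longrightarrow> ?d r \<le> ?d q)) =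
      (r \<in> I \<and> r \<notin> ?S g n \<and> (\<forall>q\<in>I. q \<notin> ?S g n \<longrightarrow> ?d r \<le> ?d q))" by simp
  next
    fix n and f :: "nat \<Rightarrow> 'a poly"
    assume "\<And>y. (y, n) \<in> less_than \<Longrightarrow> f y \<in> I \<and> f y \<notin> ?S f y \<and> (\<forall>q\<in>I. q \<notin> ?S f y \<longrightarrow> ?d (f y) \<le> ?d q)"
    then have "\<exists>q. q \<in> I \<and> q \<notin> ?S f n" using no by (meson less_than_iff subsetI)
    then show "\<exists>r. r \<in> I \<and> r \<notin> ?S f n \<and> (\<forall>q\<in>I. q \<notin> ?S f n \<longrightarrow> ?d r \<le> ?d q)"
      using ex_has_least_nat[of "\<lambda>q. q \<in> I \<and> q \<notin> ?S f n" _ ?d] by blast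
  qed simp
  then obtain f where f: "\<And>n. f n \<in> I" "\<And>n. f n \<notin> ?S f n"
    and min: "\<And>n q. q \<in> I \<Longrightarrow> q \<notin> ?S f n \<Longrightarrow> ?d (f n) \<le> ?d q" by blast
  have fP: "f n \<in> polys_over A" for n using f(1) I unfolding ideal_of_def by blast
  define a where "a n = coeff (f n) (?d (f n))" for n
  have "a n \<in> A" for n unfolding a_def by (rule polys_overD[OF fP])
  then obtain n where "a n \<in> seq_span A a n" by (rule noetherian_seq[OF assms])
  then obtain c where c: "\<And>i. c i \<in> A" and an: "a n = (\<Sum>i<n. c i * a i)"
    by (auto simp: seq_span_def)
  have deg: "?d (f i) \<le> ?d (f n)" if "i < n" for i
    by (rule min[OF f(1)]) (use f(2)[of n] P.seq_span_mono[of i n f] that in auto)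
  \<comment> \<open>The relation among leading coefficients, lifted by monomials that shift every
    \<open>f i\<close> to the degree of \<open>f n\<close>, produces an element of the span with the
    same leading term. The difference has smaller degree and contradicts minimality.\<close>
  let ?m = "\<lambda>i. monom (c i) (?d (f n) - ?d (f i))"
  define s where "s = (\<Sum>i<n. ?m i * f i)"
  have m: "?m i \<in> polys_over A" for i using c is_subring_axioms by (rule monom_polys_over[rotated])
  have s: "s \<in> ?S f n" by (rule seq_spanI[of ?m]) (simp_all add: m s_def)
  have "- 1 \<in> polys_over A" by (intro P.sub_uminus P.sub_one)
  then have "- 1 * s \<in> I"
    using I s seq_span_least[OF I, of n f] f(1) unfolding ideal_of_def by blast
  then have qI: "f n - s \<in> I"
    using I f(1)[of n] unfolding ideal_of_def by (metis add_uminus_conv_diff mult_minus1)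
  have "coeff (?m i * f i) (?d (f n)) = c i * a i" if "i < n" for i
    using deg[OF that] by (simp add: coeff_monom_mult a_def)
  then have "coeff (f n - s) (?d (f n)) = 0"
    by (simp add: s_def coeff_sum an flip: a_def)
  moreover have "?d (f n - s) \<le> ?d (f n)"
  proof (rule degree_diff_le)
    show "?d s \<le> ?d (f n)" unfolding s_def
    proof (rule degree_sum_le)
      fix i assume "i \<in> {..<n}"
      have "?d (?m i * f i) \<le> ?d (?m i) + ?d (f i)" by (rule degree_mult_le)
      also have "\<dots> \<le> ?d (f n)" using deg[of i] degree_monom_le[of "c i" "?d (f n) - ?d (f i)"] \<open>i \<in> {..<n}\<close> by simp
      finally show "?d (?m i * f i) \<le> ?d (f n)" .
    qed simp
  qed simp
  ultimately have "f n - s = 0 \<or> ?d (f n - s) < ?d (f n)"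
    by (metis leading_coeff_0_iff le_neq_implies_less)
  then have "f n - s \<in> ?S f n"
    using min[OF qI, of n] P.seq_span_zero by force
  then show False using P.seq_span_add[OF _ s, of "f n - s"] f(2) by simp
qed

lemma noetherian_image:
  assumes "comm_ring_hom h" "noetherian A" shows "noetherian (h ` A)"
  unfolding noetherian_def
proof (intro allI impI)
  interpret h: comm_ring_hom h by fact
  fix I assume I: "ideal_of (h ` A) I"
  let ?I = "{a \<in> A. h a \<in> I}"
  have "ideal_of A ?I"
    using I unfolding ideal_of_def by (auto simp: h.homs sub_zero sub_add sub_mult)
  then obtain f n where f: "\<And>i. i < n \<Longrightarrow> f i \<in> ?I" and span: "?I \<subseteq> seq_span A f n"
    using assms(2) unfolding noetherian_def by blast
  have "I \<subseteq> seq_span (h ` A) (\<lambda>i. h (f i)) n"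
  proof
    fix b assume b: "b \<in> I"
    then obtain a where a: "a \<in> ?I" "b = h a" using I unfolding ideal_of_def by blast
    then obtain c where "\<And>i. c i \<in> A" "a = (\<Sum>i<n. c i * f i)" using span by (auto simp: seq_span_def)
    then have "b = (\<Sum>i<n. h (c i) * h (f i))" "\<forall>i. h (c i) \<in> h ` A" by (auto simp: a h.homs)
    then show "b \<in> seq_span (h ` A) (\<lambda>i. h (f i)) n"
      unfolding seq_span_def mem_Collect_eq by (intro exI[of _ "\<lambda>i. h (c i)"]) simp
  qed
  then show "\<exists>f n. (\<forall>i<n. f i \<in> I) \<and> I \<subseteq> seq_span (h ` A) f n"
    using f by (intro exI[of _ "\<lambda>i. h (f i)"] exI[of _ n]) auto
qed

end

lemma noetherian_adjoin_list:
  "is_subring A \<Longrightarrow> noetherian A \<Longrightarrow> noetherian (adjoin_list A ts)"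
proof (induction ts arbitrary: A)
  case (Cons t ts)
  have "noetherian (adjoin A t)"
    unfolding adjoin_def
    by (intro is_subring.noetherian_image[OF subring_polys_over] poly_eval_hom
        is_subring.hilbert_basis Cons.prems)
  then show ?case using Cons.IH[OF subring_adjoin[OF Cons.prems(1)]] by simp
qed simp

lemma noetherian_field: "noetherian (UNIV :: 'k::field set)"
  unfolding noetherian_def
proof (intro allI impI)
  fix I :: "'k set" assume I: "ideal_of UNIV I"
  show "\<exists>f n. (\<forall>i<n. f i \<in> I) \<and> I \<subseteq> seq_span UNIV f n"
  proof (cases "I \<subseteq> {0}")
    case True
    then show ?thesis by (intro exI[of _ "\<lambda>_. 0"] exI[of _ 0]) (auto simp: seq_span_def)
  next
    case False
    then obtain a where a: "a \<in> I" "a \<noteq> 0" by blast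
    have "b \<in> seq_span UNIV (\<lambda>_. a) 1" for b
      unfolding seq_span_def using a(2) by (auto intro!: exI[of _ "\<lambda>_. b / a"])
    then show ?thesis using a by (intro exI[of _ "\<lambda>_. a"] exI[of _ 1]) auto
  qed
qed

lemma mpoly_adjoin_list:
  assumes "set vs = (UNIV :: 'v set)"
  shows "adjoin_list (range (mconst :: 'k::comm_ring_1 \<Rightarrow> ('v, 'k) mpoly)) (map mvar vs) = UNIV"
proof -
  let ?A = "range (mconst :: 'k \<Rightarrow> ('v, 'k) mpoly)"
  have A: "is_subring ?A" by (intro subring_image mconst_hom subring_UNIV)
  interpret is_subring "adjoin_list ?A (map mvar vs)" by (rule subring_adjoin_list[OF A])
  have "f \<in> adjoin_list ?A (map mvar vs)" for f
    by (induction f rule: mpoly_induct)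
      (use adjoin_list_superset[OF A, of "map mvar vs"] assms in \<open>auto intro: sub_add sub_mult\<close>)
  then show ?thesis by blast
qed

lemma noetherian_mpoly: "noetherian (UNIV :: ('v::finite, 'k::field) mpoly set)"
proof -
  obtain vs :: "'v list" where vs: "set vs = UNIV" using finite_list[OF finite] by blast
  show ?thesis
    unfolding mpoly_adjoin_list[OF vs, symmetric]
    by (intro noetherian_adjoin_list subring_image mconst_hom subring_UNIV
        is_subring.noetherian_image[OF subring_UNIV] noetherian_field)
qed

subsection \<open>Krull's intersection theorem\<close>

text \<open>The k-th power of the ideal generated by the family t. The recursion splits off one
  generator, which is the induction needed to place monomials in the Rees algebra.\<close>

fun gen_power :: "('v::finite \<Rightarrow> 'a::comm_ring_1) \<Rightarrow> nat \<Rightarrow> 'a set" where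
  "gen_power t 0 = UNIV"
| "gen_power t (Suc k) = {\<Sum>v\<in>UNIV. t v * c v | c. \<forall>v. c v \<in> gen_power t k}"

lemma gen_power_SucI:
  "(\<And>v. c v \<in> gen_power t k) \<Longrightarrow> a = (\<Sum>v\<in>UNIV. t v * c v) \<Longrightarrow> a \<in> gen_power t (Suc k)"
  by auto

lemma gen_power_SucE:
  assumes "a \<in> gen_power t (Suc k)"
  obtains c where "\<And>v. c v \<in> gen_power t k" "a = (\<Sum>v\<in>UNIV. t v * c v)"
  using assms by auto

lemma tideal_gen_power: "tideal (gen_power t k)"
proof (induction k)
  case 0
  show ?case by unfold_locales auto
next
  case (Suc k)
  interpret tideal "gen_power t k" by fact
  show ?case
  proof
    show "0 \<in> gen_power t (Suc k)" by (rule gen_power_SucI[of "\<lambda>_. 0"]) (simp_all add: ideal_zero)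
  next
    fix a b assume "a \<in> gen_power t (Suc k)" "b \<in> gen_power t (Suc k)"
    obtain c where c: "\<And>v. c v \<in> gen_power t k" "a = (\<Sum>v\<in>UNIV. t v * c v)"
      using \<open>a \<in> _\<close> by (rule gen_power_SucE) blast
    obtain d where d: "\<And>v. d v \<in> gen_power t k" "b = (\<Sum>v\<in>UNIV. t v * d v)"
      using \<open>b \<in> _\<close> by (rule gen_power_SucE) blast
    show "a + b \<in> gen_power t (Suc k)"
      by (rule gen_power_SucI[of "\<lambda>v. c v + d v"]) (simp_all add: c d distrib_left sum.distrib ideal_add)
  next
    fix a r assume "a \<in> gen_power t (Suc k)"
    then obtain c where c: "\<And>v. c v \<in> gen_power t k" "a = (\<Sum>v\<in>UNIV. t v * c v)"
      by (rule gen_power_SucE) blast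
    show "r * a \<in> gen_power t (Suc k)"
      by (rule gen_power_SucI[of "\<lambda>v. r * c v"]) (simp_all add: c sum_distrib_left ideal_mult mult_ac)
  qed
qed

lemma gen_power_Suc: "gen_power t (Suc k) \<subseteq> gen_power t k"
proof (induction k)
  case (Suc k)
  show ?case
  proof
    fix a assume "a \<in> gen_power t (Suc (Suc k))"
    then obtain c where "\<And>v. c v \<in> gen_power t (Suc k)" "a = (\<Sum>v\<in>UNIV. t v * c v)"
      by (rule gen_power_SucE) blast
    then show "a \<in> gen_power t (Suc k)" using Suc by (intro gen_power_SucI[of c]) auto
  qed
qed simp

lemma gen_power_mult: "a \<in> gen_power t i \<Longrightarrow> b \<in> gen_power t j \<Longrightarrow> a * b \<in> gen_power t (i + j)"
proof (induction i arbitrary: a)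
  case 0
  then show ?case using tideal.ideal_mult[OF tideal_gen_power] by auto
next
  case (Suc i)
  obtain c where c: "\<And>v. c v \<in> gen_power t i" "a = (\<Sum>v\<in>UNIV. t v * c v)"
    using gen_power_SucE[OF Suc.prems(1)] by blast
  show ?case unfolding add_Suc
    by (rule gen_power_SucI[of "\<lambda>v. c v * b"])
      (simp_all add: Suc.IH[OF c(1) Suc.prems(2)] c(2) sum_distrib_right mult.assoc)
qed

lemma gen_power_antimono: "i \<le> j \<Longrightarrow> gen_power t j \<subseteq> gen_power t i"
  by (rule lift_Suc_antimono_le[of "gen_power t"]) (rule gen_power_Suc)

lemma gen_power_one: "t v \<in> gen_power t 1"
  unfolding One_nat_def by (rule gen_power_SucI[of "\<lambda>w. if w = v then 1 else 0"])
    (auto simp: if_distrib[of "\<lambda>u. _ * u"] cong: if_cong)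

text \<open>All \<open>a k\<close> represent the same class f modulo J. A linear relation expressing
  \<open>a n\<close> by earlier members, with coefficients in the ideal, therefore becomes an
  equation for f alone, and the Noetherian property of the Rees algebra supplies such a
  relation.\<close>

theorem krull_intersection:
  fixes t :: "'v::finite \<Rightarrow> 'a::comm_ring_1"
  assumes noeth: "noetherian (UNIV :: 'a set)" and J: "tideal J"
    and f: "\<And>k. \<exists>a\<in>gen_power t k. f - a \<in> J"
  shows "\<exists>\<mu>\<in>gen_power t 1. (1 - \<mu>) * f \<in> J"
proof -
  interpret J: tideal J by fact
  interpret cp: comm_ring_hom "\<lambda>c :: 'a. [:c:]" by (rule const_poly_hom)
  obtain vs :: "'v list" where vs: "set vs = UNIV" using finite_list[OF finite] by blast
  \<comment> \<open>The Rees algebra \<open>R\<close> is Noetherian, and \<open>f\<close> has representatives \<open>a k\<close> with \<open>a k T\<^sup>k \<in> R\<close>.\<close>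
  define A where "A = range (\<lambda>c :: 'a. [:c:])"
  define R where "R = adjoin_list A (map (\<lambda>v. monom (t v) 1) vs)"
  have A: "is_subring A" unfolding A_def by (intro subring_image const_poly_hom subring_UNIV)
  interpret R: is_subring R unfolding R_def by (rule subring_adjoin_list[OF A])
  have "noetherian R"
    unfolding R_def A_def
    by (intro noetherian_adjoin_list subring_image const_poly_hom subring_UNIV
        is_subring.noetherian_image[OF subring_UNIV] noeth)
  \<comment> \<open>The coefficient in degree i lies in the i-th power of the ideal; applied to the
    \<open>r i\<close> below, this bounds the \<mu> i.\<close>
  let ?C = "{p :: 'a poly. \<forall>i. coeff p i \<in> gen_power t i}"
  have "R \<subseteq> ?C"
    unfolding R_def
  proof (rule adjoin_list_least)
    show "is_subring ?C"
    proof
      have "coeff 1 i \<in> gen_power t i" for i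
        by (cases i) (auto simp del: gen_power.simps(2) intro: tideal.ideal_zero[OF tideal_gen_power])
      then show "1 \<in> ?C" by blast
      show "a - b \<in> ?C" if "a \<in> ?C" "b \<in> ?C" for a b
        using that by (auto intro: tideal.ideal_diff[OF tideal_gen_power])
      show "a * b \<in> ?C" if "a \<in> ?C" "b \<in> ?C" for a b
      proof (safe, unfold coeff_mult)
        fix i
        have "coeff a j * coeff b (i - j) \<in> gen_power t i" if "j \<le> i" for j
          using gen_power_mult[of "coeff a j" t j "coeff b (i - j)" "i - j"]
            that \<open>a \<in> ?C\<close> \<open>b \<in> ?C\<close> by simp
        then show "(\<Sum>j\<le>i. coeff a j * coeff b (i - j)) \<in> gen_power t i"
          by (intro tideal.ideal_sum[OF tideal_gen_power]) simp
      qed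
    qed
    have "coeff [:c:] i \<in> gen_power t i" for c i
      by (cases i) (auto simp del: gen_power.simps(2) intro: tideal.ideal_zero[OF tideal_gen_power])
    moreover have "coeff (monom (t v) 1) i \<in> gen_power t i" for v i
      using gen_power_one[of t v] by (auto intro: tideal.ideal_zero[OF tideal_gen_power])
    ultimately show "A \<union> set (map (\<lambda>v. monom (t v) 1) vs) \<subseteq> ?C"
      by (auto simp: A_def)
  qed
  have gen: "[:c:] \<in> R" "monom (t v) 1 \<in> R" for c v
    using adjoin_list_superset[OF A, of "map (\<lambda>v. monom (t v) 1) vs"] vs
    by (auto simp: R_def A_def)
  have monom: "monom a k \<in> R" if "a \<in> gen_power t k" for a k
    using that
  proof (induction k arbitrary: a)
    case 0
    then show ?case using gen(1)[of a] by (simp add: monom_0)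
  next
    case (Suc k)
    obtain c where c: "\<And>v. c v \<in> gen_power t k" "a = (\<Sum>v\<in>UNIV. t v * c v)"
      using gen_power_SucE[OF Suc.prems] by blast
    have "monom a (Suc k) = (\<Sum>v\<in>UNIV. monom (t v) 1 * monom (c v) k)"
      by (simp add: c(2) mult_monom monom_sum)
    then show ?case using Suc.IH[OF c(1)] gen(2) by (simp only:) (intro R.sub_sum R.sub_mult)
  qed
  obtain a where a: "\<And>k. a k \<in> gen_power t k" "\<And>k. f - a k \<in> J" using f by metis
  define F where "F k = monom (a k) k" for k
  have "F k \<in> R" for k unfolding F_def by (rule monom[OF a(1)])
  then obtain n where "F n \<in> seq_span R F n" by (rule R.noetherian_seq[OF \<open>noetherian R\<close>])
  then obtain r where r: "\<And>i. r i \<in> R" and Fn: "F n = (\<Sum>i<n. r i * F i)" by (auto simp: seq_span_def)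
  \<comment> \<open>In degree n the factor \<open>F i\<close> leaves the coefficient of degree n - i
    of \<open>r i\<close>; as i < n, this lies in a positive power.\<close>
  define \<mu> where "\<mu> i = coeff (r i) (n - i)" for i
  have "coeff (r i * F i) n = \<mu> i * a i" if "i < n" for i
    using that by (simp add: F_def \<mu>_def mult.commute[of "r i"] coeff_monom_mult)
  then have an: "a n = (\<Sum>i<n. \<mu> i * a i)"
    using arg_cong[OF Fn, of "\<lambda>p. coeff p n"] by (simp add: coeff_sum F_def)
  have "\<mu> i \<in> gen_power t 1" if "i < n" for i
  proof -
    have "\<mu> i \<in> gen_power t (n - i)" using r \<open>R \<subseteq> ?C\<close> unfolding \<mu>_def by blast
    moreover have "1 \<le> n - i" using that by simp
    ultimately show ?thesis using gen_power_antimono by blast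
  qed
  then have "(\<Sum>i<n. \<mu> i) \<in> gen_power t 1"
    by (intro tideal.ideal_sum[OF tideal_gen_power]) simp
  moreover have "(1 - (\<Sum>i<n. \<mu> i)) * f \<in> J"
  proof -
    have "(1 - (\<Sum>i<n. \<mu> i)) * f = (f - a n) - (\<Sum>i<n. \<mu> i * (f - a i))"
      by (simp add: left_diff_distrib right_diff_distrib sum_subtractf sum_distrib_right an)
    moreover have "(\<Sum>i<n. \<mu> i * (f - a i)) \<in> J" by (intro J.ideal_sum J.ideal_mult a(2))
    ultimately show ?thesis using J.ideal_diff[OF a(2)] by metis
  qed
  ultimately show ?thesis by blast
qed

lemma ideal_filtration_gen_power:
  assumes J: "tideal J"
  shows "ideal_filtration (\<lambda>k. {f. \<exists>a\<in>gen_power t k. f - a \<in> J})"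
proof (rule ideal_filtration.intro)
  interpret J: tideal J by fact
  let ?F = "\<lambda>k. {f. \<exists>a\<in>gen_power t k. f - a \<in> J}"
  show "tideal (?F k)" for k
  proof
    interpret P: tideal "gen_power t k" by (rule tideal_gen_power)
    show "0 \<in> ?F k"
      using P.ideal_zero J.ideal_zero by (auto intro!: bexI[of _ 0])
    fix f g assume "f \<in> ?F k"
    then obtain a where a: "a \<in> gen_power t k" "f - a \<in> J" by blast
    have "r * f - r * a \<in> J" for r using J.ideal_mult[OF a(2), of r] by (simp add: right_diff_distrib)
    then show "r * f \<in> ?F k" for r
      using P.ideal_mult[OF a(1)] by blast
    assume "g \<in> ?F k"
    then obtain b where b: "b \<in> gen_power t k" "g - b \<in> J" by blast
    have "(f + g) - (a + b) \<in> J" using J.ideal_add[OF a(2) b(2)] by (simp add: algebra_simps)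
    then show "f + g \<in> ?F k" using P.ideal_add[OF a(1) b(1)] by blast
  qed
  have "\<exists>a\<in>gen_power t 0. f - a \<in> J" for f by (rule bexI[of _ f]) (simp_all add: J.ideal_zero)
  then show "?F 0 = UNIV" by blast
  show "?F (Suc k) \<subseteq> ?F k" for k
    using gen_power_Suc by blast
  fix f g i j assume "f \<in> ?F i" "g \<in> ?F j"
  then obtain a b where "a \<in> gen_power t i" "f - a \<in> J" "b \<in> gen_power t j" "g - b \<in> J" by blast
  then show "f * g \<in> ?F (i + j)"
    using gen_power_mult J.cong_mult by blast
qed

section \<open>Extension of prime ideals\<close>

definition prime_of :: "'a::comm_ring_1 set \<Rightarrow> 'a set \<Rightarrow> bool" where
  "prime_of A P \<longleftrightarrow> ideal_of A P \<and> 1 \<notin> P \<and> (\<forall>a\<in>A. \<forall>b\<in>A. a * b \<in> P \<longrightarrow> a \<in> P \<or> b \<in> P)"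

lemma prime_of_power:
  assumes "prime_of A P" "is_subring A" "a \<in> A" "a \<notin> P" shows "a ^ k \<notin> P"
  using assms is_subring.sub_power[OF assms(2,3)] by (induction k) (auto simp: prime_of_def)

lemma ideal_ofD:
  assumes "ideal_of A I"
  shows "a \<in> I \<Longrightarrow> a \<in> A" "0 \<in> I" "a \<in> I \<Longrightarrow> b \<in> I \<Longrightarrow> a + b \<in> I" "r \<in> A \<Longrightarrow> a \<in> I \<Longrightarrow> r * a \<in> I"
  using assms by (auto simp: ideal_of_def)

lemma ideal_of_diff:
  assumes "ideal_of A I" "is_subring A" "a \<in> I" "b \<in> I" shows "a - b \<in> I"
proof -
  have "- 1 \<in> A" using assms(2) by (simp add: is_subring.sub_one is_subring.sub_uminus)
  then have "- 1 * b \<in> I" using assms by (metis ideal_ofD(4))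
  then show ?thesis using ideal_ofD(3)[OF assms(1,3), of "- b"] by simp
qed

text \<open>An ideal maximal among those disjoint from \<open>S\<close> is prime: enlarging it by an
  outside element makes it meet \<open>S\<close>, and if a product of two outside elements lay in
  it, so would the product of the two elements of \<open>S\<close> found in this way.\<close>

lemma prime_of_avoiding:
  assumes B: "is_subring B" and I: "ideal_of B I" and "S \<subseteq> B" "1 \<in> S"
    and S: "\<And>a b. a \<in> S \<Longrightarrow> b \<in> S \<Longrightarrow> a * b \<in> S" and IS: "I \<inter> S = {}"
  shows "\<exists>Q. prime_of B Q \<and> I \<subseteq> Q \<and> Q \<inter> S = {}"
proof -
  interpret is_subring B by fact
  define \<I> where "\<I> = {J. ideal_of B J \<and> I \<subseteq> J \<and> J \<inter> S = {}}"
  have "\<exists>Q\<in>\<I>. \<forall>J\<in>\<I>. Q \<subseteq> J \<longrightarrow> J = Q"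
  proof (rule subset_Zorn_nonempty)
    show "\<I> \<noteq> {}" using I IS unfolding \<I>_def by blast
    fix C assume ne: "C \<noteq> {}" and C: "subset.chain \<I> C"
    have ideal: "ideal_of B J" if "J \<in> C" for J
      using C that unfolding subset.chain_def \<I>_def by blast
    have "ideal_of B (\<Union>C)"
      unfolding ideal_of_def
    proof (intro conjI ballI)
      show "\<Union>C \<subseteq> B" using ideal ideal_ofD(1) by blast
      show "0 \<in> \<Union>C" using ideal ne ideal_ofD(2) by blast
      show "r * a \<in> \<Union>C" if "r \<in> B" "a \<in> \<Union>C" for r a
        using that(2) ideal_ofD(4)[OF ideal that(1)] by blast
      fix a b assume "a \<in> \<Union>C" "b \<in> \<Union>C"
      then obtain J K where JK: "J \<in> C" "K \<in> C" "a \<in> J" "b \<in> K" by blast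
      then have "J \<subseteq> K \<or> K \<subseteq> J" using C unfolding subset.chain_def by blast
      then show "a + b \<in> \<Union>C" using JK ideal ideal_ofD(3) by blast
    qed
    then show "\<Union>C \<in> \<I>" using C ne unfolding subset.chain_def \<I>_def by blast
  qed
  then obtain Q where "Q \<in> \<I>" and max': "\<And>J. J \<in> \<I> \<Longrightarrow> Q \<subseteq> J \<Longrightarrow> J = Q" by blast
  then have Q: "ideal_of B Q" "I \<subseteq> Q" "Q \<inter> S = {}" by (simp_all add: \<I>_def)
  have max: "J = Q" if "ideal_of B J" "I \<subseteq> J" "J \<inter> S = {}" "Q \<subseteq> J" for J
    using that by (intro max') (simp_all add: \<I>_def)
  have meet: "\<exists>q\<in>Q. \<exists>r\<in>B. q + r * a \<in> S" if a: "a \<in> B" "a \<notin> Q" for a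
  proof (rule ccontr)
    assume no: "\<not> ?thesis"
    let ?J = "{q + r * a | q r. q \<in> Q \<and> r \<in> B}"
    have "ideal_of B ?J"
      unfolding ideal_of_def
    proof (intro conjI ballI)
      show "?J \<subseteq> B" using a ideal_ofD(1)[OF Q(1)] by (auto intro!: sub_add sub_mult)
      have "0 = 0 + 0 * a" by simp
      then show "0 \<in> ?J" using ideal_ofD(2)[OF Q(1)] sub_zero by blast
      fix u assume "u \<in> ?J"
      then obtain q r where u: "u = q + r * a" "q \<in> Q" "r \<in> B" by blast
      have "s * u = s * q + (s * r) * a" for s by (simp add: u distrib_left mult.assoc)
      then show "s * u \<in> ?J" if "s \<in> B" for s
        using ideal_ofD(4)[OF Q(1) that u(2)] sub_mult[OF that u(3)] by blast
      fix v assume "v \<in> ?J"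
      then obtain q' r' where v: "v = q' + r' * a" "q' \<in> Q" "r' \<in> B" by blast
      have "u + v = (q + q') + (r + r') * a" by (simp add: u v distrib_right)
      then show "u + v \<in> ?J" using ideal_ofD(3)[OF Q(1) u(2) v(2)] sub_add[OF u(3) v(3)] by blast
    qed
    moreover have sub: "Q \<subseteq> ?J"
    proof
      fix q assume "q \<in> Q"
      moreover have "q = q + 0 * a" by simp
      ultimately show "q \<in> ?J" using sub_zero by blast
    qed
    ultimately have "?J = Q" using no Q(2) by (intro max) blast+
    moreover have "a = 0 + 1 * a" by simp
    then have "a \<in> ?J" using ideal_ofD(2)[OF Q(1)] sub_one by blast
    ultimately show False using a by blast
  qed
  have "prime_of B Q"
    unfolding prime_of_def
  proof (intro conjI ballI impI Q(1))
    show "1 \<notin> Q" using Q(3) \<open>1 \<in> S\<close> by blast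
    fix a b assume ab: "a \<in> B" "b \<in> B" "a * b \<in> Q"
    show "a \<in> Q \<or> b \<in> Q"
    proof (rule ccontr)
      assume "\<not> ?thesis"
      then obtain q r q' r' where *: "q \<in> Q" "r \<in> B" "q + r * a \<in> S" "q' \<in> Q" "r' \<in> B" "q' + r' * b \<in> S"
        using meet ab by metis
      have "(q + r * a) * (q' + r' * b) = (q' + r' * b) * q + (r * a) * q' + (r * r') * (a * b)"
        by (simp add: algebra_simps)
      also have "\<dots> \<in> Q"
        by (intro ideal_ofD(3)[OF Q(1)] ideal_ofD(4)[OF Q(1) _ *(1)] ideal_ofD(4)[OF Q(1) _ *(4)]
            ideal_ofD(4)[OF Q(1) _ ab(3)] sub_mult * ab subsetD[OF \<open>S \<subseteq> B\<close> *(6)])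
      finally show False using S[OF *(3,6)] Q(3) by blast
    qed
  qed
  with Q show ?thesis by blast
qed

section \<open>Pseudo-division, and primes in an extension by one element\<close>

lemma polys_over_mono: "A \<subseteq> B \<Longrightarrow> polys_over A \<subseteq> polys_over B"
  unfolding polys_over_def by blast

lemma polys_over_ideal:
  assumes A: "is_subring A" and P: "ideal_of A P"
  shows "ideal_of (polys_over A) (polys_over P)"
  unfolding ideal_of_def
proof (intro conjI ballI)
  show "polys_over P \<subseteq> polys_over A" using P polys_over_mono by (auto simp: ideal_of_def)
  show "p + q \<in> polys_over P" if "p \<in> polys_over P" "q \<in> polys_over P" for p q
    using that P by (auto simp: polys_over_def ideal_of_def)
  show "0 \<in> polys_over P" using P by (auto simp: polys_over_def ideal_of_def)
  show "r * p \<in> polys_over P" if "r \<in> polys_over A" "p \<in> polys_over P" for r p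
    using that by (auto simp: polys_over_def coeff_mult intro!: ideal_of_sum[OF P] ideal_ofD(4)[OF P])
qed

lemma smult_polys_over: "ideal_of A P \<Longrightarrow> c \<in> A \<Longrightarrow> p \<in> polys_over P \<Longrightarrow> smult c p \<in> polys_over P"
  by (simp add: polys_over_def ideal_of_def)

text \<open>A need not contain inverses, so powers of the leading coefficient of p are multiplied
  in. Every quotient and remainder is built A-linearly from the coefficients of r and therefore
  stays over \<open>P\<close>.\<close>

lemma pseudo_remainder:
  fixes p :: "'a::idom poly"
  assumes A: "is_subring A" and P: "ideal_of A P" and p: "p \<in> polys_over A" "p \<noteq> 0"
    and r: "r \<in> polys_over P"
  shows "\<exists>N u s. u \<in> polys_over P \<and> s \<in> polys_over P \<and>
    smult (lead_coeff p ^ N) r = p * u + s \<and> (s = 0 \<or> degree s < degree p)"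
  using r
\<comment> \<open>The measure separates the zero polynomial from nonzero constants, which have the
  same degree.\<close>
proof (induction "if r = 0 then 0 else Suc (degree r)" arbitrary: r rule: less_induct)
  case less
  interpret is_subring A by fact
  let ?d = degree and ?l = lead_coeff
  note PP = polys_over_ideal[OF A P]
  show ?case
  proof (cases "r = 0 \<or> ?d r < ?d p")
    case True
    then show ?thesis
      using less.prems ideal_ofD(2)[OF PP] by (intro exI[of _ 0] exI[of _ r]) simp
  next
    case False
    define m where "m = monom (?l r) (?d r - ?d p)"
    define r1 where "r1 = smult (?l p) r - m * p"
    have lA: "?l p \<in> A" by (rule polys_overD[OF p(1)])
    have m: "m \<in> polys_over P"
      using polys_overD[OF less.prems] ideal_ofD(2)[OF P] by (auto simp: m_def polys_over_def)
    have r1: "r1 \<in> polys_over P"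
      unfolding r1_def mult.commute[of m]
      by (intro ideal_of_diff[OF PP subring_polys_over[OF A]] smult_polys_over[OF P lA] less.prems
          ideal_ofD(4)[OF PP p(1) m])
    have "?d r1 \<le> ?d r"
      unfolding r1_def
    proof (rule degree_diff_le)
      have "?d (m * p) \<le> ?d m + ?d p" by (rule degree_mult_le)
      also have "\<dots> \<le> ?d r" using False degree_monom_le[of "?l r" "?d r - ?d p"] unfolding m_def by arith
      finally show "?d (m * p) \<le> ?d r" .
    qed (rule degree_smult_le)
    moreover have "coeff r1 (?d r) = 0"
      using False by (simp add: r1_def m_def coeff_monom_mult)
    ultimately have "r1 = 0 \<or> ?d r1 < ?d r" by (metis leading_coeff_0_iff le_neq_implies_less)
    then have "(if r1 = 0 then 0 else Suc (?d r1)) < (if r = 0 then 0 else Suc (?d r))"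
      using False by auto
    from less.hyps[OF this r1] obtain N u s where IH: "u \<in> polys_over P" "s \<in> polys_over P"
      "smult (?l p ^ N) r1 = p * u + s" "s = 0 \<or> ?d s < ?d p" by blast
    let ?u = "u + smult (?l p ^ N) m"
    have "smult (?l p ^ Suc N) r = smult (?l p ^ N) (r1 + m * p)"
      by (simp add: r1_def mult.commute)
    also have "\<dots> = p * ?u + s"
      by (simp add: smult_add_right IH(3) distrib_left mult.commute)
    finally have "smult (?l p ^ Suc N) r = p * ?u + s" .
    moreover have "?u \<in> polys_over P"
      by (intro ideal_ofD(3)[OF PP] IH smult_polys_over[OF P] sub_power lA m)
    ultimately show ?thesis using IH(2,4) by blast
  qed
qed

text \<open>Among the polynomials whose value at t is a nonzero multiple of b, take one of least
  degree, u. Reducing modulo p shows that u has smaller degree than p. If u is not constant,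
  pseudo-division of p by u leaves no remainder by the two minimalities, and the cofactor of u would
  be a polynomial vanishing at t of smaller degree than p.\<close>

lemma algebraic_multiple_in_base:
  fixes t :: "'a::idom"
  assumes A: "is_subring A" and b: "b \<in> adjoin A t" "b \<noteq> 0"
    and p: "p \<in> polys_over A" "p \<noteq> 0" "poly p t = 0"
    and min: "\<And>q. q \<in> polys_over A \<Longrightarrow> poly q t = 0 \<Longrightarrow> q \<noteq> 0 \<Longrightarrow> degree p \<le> degree q"
  shows "\<exists>b'\<in>adjoin A t. b * b' \<in> A \<and> b * b' \<noteq> 0"
proof -
  interpret is_subring A by fact
  interpret B: is_subring "adjoin A t" by (rule subring_adjoin[OF A])
  let ?d = degree and ?l = lead_coeff
  have AA: "ideal_of A A" using sub_zero sub_add sub_mult by (auto simp: ideal_of_def)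
  have ev: "poly q t \<in> adjoin A t" if "q \<in> polys_over A" for q using that by (auto simp: adjoin_def)
  define M where "M u \<longleftrightarrow> u \<in> polys_over A \<and> poly u t \<noteq> 0 \<and> (\<exists>b'\<in>adjoin A t. poly u t = b * b')" for u
  have "\<exists>q. M q" using b B.sub_one by (force simp: adjoin_def M_def)
  then obtain u where u: "M u" and u_min: "\<And>v. M v \<Longrightarrow> ?d u \<le> ?d v"
    using ex_has_least_nat[of M _ ?d] by blast
  obtain b' where b': "b' \<in> adjoin A t" "poly u t = b * b'" using u unfolding M_def by blast
  have uA: "u \<in> polys_over A" "poly u t \<noteq> 0" "u \<noteq> 0" using u by (auto simp: M_def)
  show ?thesis
  proof (cases "?d u = 0")
    case True
    then have "poly u t = coeff u 0" by (metis degree_0_id poly_const_conv)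
    then show ?thesis using b' uA polys_overD[OF uA(1), of 0] by metis
  next
    case False
    obtain N w s where 1: "w \<in> polys_over A" "s \<in> polys_over A"
      "smult (?l p ^ N) u = p * w + s" "s = 0 \<or> ?d s < ?d p"
      using pseudo_remainder[OF A AA p(1,2) uA(1)] by blast
    have "poly s t = ?l p ^ N * poly u t"
      using arg_cong[OF 1(3), of "\<lambda>q. poly q t"] p(3) by simp
    moreover have lpA: "?l p ^ N \<in> A" by (intro sub_power polys_overD[OF p(1)])
    then have "?l p ^ N \<in> adjoin A t" using adjoin_superset[OF A] by blast
    then have "?l p ^ N * b' \<in> adjoin A t" using b' B.sub_mult by blast
    ultimately have "M s" unfolding M_def using 1(2) uA(2) p(2) b'(2)
      by (auto intro!: bexI[of _ "?l p ^ N * b'"])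
    then have "?d u < ?d p" using u_min[of s] 1(4) unfolding M_def by force
    obtain N w s where 2: "w \<in> polys_over A" "s \<in> polys_over A"
      "smult (?l u ^ N) p = u * w + s" "s = 0 \<or> ?d s < ?d u"
      using pseudo_remainder[OF A AA uA(1,3) p(1)] by blast
    have ps: "poly s t = b * - (b' * poly w t)"
      using arg_cong[OF 2(3), of "\<lambda>q. poly q t"] p(3) b'(2) by (simp add: eq_neg_iff_add_eq_0 algebra_simps)
    have "- (b' * poly w t) \<in> adjoin A t" by (intro B.sub_uminus B.sub_mult b' ev 2)
    then have "poly s t = 0" using u_min[of s] 2(2,4) ps unfolding M_def by force
    then have "s = 0" using min[OF 2(2)] 2(4) \<open>?d u < ?d p\<close> by force
    then have uw: "smult (?l u ^ N) p = u * w" using 2(3) by simp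
    then have "w \<noteq> 0" using p(2) uA(3) by auto
    have "poly u t * poly w t = 0" using arg_cong[OF uw, of "\<lambda>q. poly q t"] p(3) by simp
    then have "?d p \<le> ?d w" using min[OF 2(1)] uA(2) \<open>w \<noteq> 0\<close> by simp
    moreover have "?d p = ?d u + ?d w"
      using arg_cong[OF uw, of ?d] uA(3) \<open>w \<noteq> 0\<close> by (simp add: degree_mult_eq)
    ultimately show ?thesis using False by simp
  qed
qed

text \<open>If \<open>t\<close> is transcendental over \<open>A\<close>, take for \<open>a\<close> the leading coefficient of \<open>b\<close>; otherwise the leading
  coefficient of a minimal polynomial of \<open>t\<close> times a multiple of \<open>b\<close> in \<open>A\<close>.\<close>

lemma prime_of_extend_one:
  fixes t :: "'a::idom"
  assumes A: "is_subring A" and b: "b \<in> adjoin A t" "b \<noteq> 0"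
  shows "\<exists>a\<in>A. a \<noteq> 0 \<and> (\<forall>P. prime_of A P \<longrightarrow> a \<notin> P \<longrightarrow>
    (\<exists>Q. prime_of (adjoin A t) Q \<and> Q \<inter> A = P \<and> b \<notin> Q))"
proof -
  interpret is_subring A by fact
  interpret B: is_subring "adjoin A t" by (rule subring_adjoin[OF A])
  let ?d = degree and ?l = lead_coeff
  \<comment> \<open>A prime over \<open>P\<close> avoiding b is a prime that contains the extension
    of \<open>P\<close> and misses the multiplicative set of all \<open>s * b ^ j\<close> with s
    outside \<open>P\<close>; it exists as soon as the two are disjoint.\<close>
  have extend: "\<exists>Q. prime_of (adjoin A t) Q \<and> Q \<inter> A = P \<and> b \<notin> Q"
    if P: "prime_of A P"
      and no: "\<And>s j r. s \<in> A \<Longrightarrow> s \<notin> P \<Longrightarrow> r \<in> polys_over P \<Longrightarrow> s * b ^ j \<noteq> poly r t" for P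
  proof -
    have Pid: "ideal_of A P" using P by (simp add: prime_of_def)
    note PP = polys_over_ideal[OF A Pid]
    let ?I = "(\<lambda>r. poly r t) ` polys_over P" and ?S = "{s * b ^ j | s j. s \<in> A \<and> s \<notin> P}"
    have I: "ideal_of (adjoin A t) ?I"
      unfolding ideal_of_def
    proof (intro conjI ballI)
      show "?I \<subseteq> adjoin A t" unfolding adjoin_def using ideal_ofD(1)[OF PP] by blast
      show "0 \<in> ?I" using ideal_ofD(2)[OF PP] by (metis imageI poly_0)
      show "u + v \<in> ?I" if "u \<in> ?I" "v \<in> ?I" for u v
        using that ideal_ofD(3)[OF PP] by (auto simp flip: poly_add)
      show "u * v \<in> ?I" if "u \<in> adjoin A t" "v \<in> ?I" for u v
        using that ideal_ofD(4)[OF PP] by (auto simp: adjoin_def simp flip: poly_mult)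
    qed
    have one: "1 \<in> A" "1 \<notin> P" using sub_one P by (auto simp: prime_of_def)
    have "\<exists>Q. prime_of (adjoin A t) Q \<and> ?I \<subseteq> Q \<and> Q \<inter> ?S = {}"
    proof (rule prime_of_avoiding[OF subring_adjoin[OF A] I])
      show "?S \<subseteq> adjoin A t"
        using adjoin_superset[OF A] b by (auto intro!: B.sub_mult B.sub_power)
      have "1 = 1 * b ^ 0" by simp
      then show "1 \<in> ?S" using one by blast
      fix u v assume "u \<in> ?S" "v \<in> ?S"
      then obtain s j s' j' where *: "u = s * b ^ j" "v = s' * b ^ j'" "s \<in> A" "s \<notin> P" "s' \<in> A" "s' \<notin> P"
        by blast
      have "u * v = (s * s') * b ^ (j + j')" by (simp add: * power_add mult_ac)
      moreover have "s * s' \<in> A" "s * s' \<notin> P" using * sub_mult P by (auto simp: prime_of_def)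
      ultimately show "u * v \<in> ?S" by blast
    next
      show "?I \<inter> ?S = {}" using no by fastforce
    qed
    then obtain Q where Q: "prime_of (adjoin A t) Q" "?I \<subseteq> Q" "Q \<inter> ?S = {}" by blast
    have "P \<subseteq> Q \<inter> A"
    proof
      fix a assume a: "a \<in> P"
      then have "[:a:] \<in> polys_over P"
        using ideal_ofD(2)[OF Pid] by (auto simp: polys_over_def coeff_pCons split: nat.split)
      then have "poly [:a:] t \<in> ?I" by (rule imageI)
      then show "a \<in> Q \<inter> A" using Q(2) ideal_ofD(1)[OF Pid a] by auto
    qed
    moreover have "Q \<inter> A \<subseteq> P"
    proof
      fix a assume a: "a \<in> Q \<inter> A"
      have "a = a * b ^ 0" by simp
      then show "a \<in> P" using a Q(3) by blast
    qed
    moreover have "b = 1 * b ^ 1" by simp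
    then have "b \<notin> Q" using Q(3) one by blast
    ultimately show ?thesis using Q(1) by blast
  qed
  show ?thesis
  proof (cases "\<exists>p\<in>polys_over A. p \<noteq> 0 \<and> poly p t = 0")
    case False
    obtain q where q: "q \<in> polys_over A" "b = poly q t" using b by (auto simp: adjoin_def)
    have "q \<noteq> 0" using b(2) q(2) by auto
    show ?thesis
    proof (intro bexI[of _ "?l q"] conjI allI impI)
      show "?l q \<in> A" by (rule polys_overD[OF q(1)])
      show "?l q \<noteq> 0" using \<open>q \<noteq> 0\<close> by simp
      fix P assume P: "prime_of A P" and lq: "?l q \<notin> P"
      show "\<exists>Q. prime_of (adjoin A t) Q \<and> Q \<inter> A = P \<and> b \<notin> Q"
      proof (rule extend[OF P])
        fix s j r assume s: "s \<in> A" "s \<notin> P" and r: "r \<in> polys_over P"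
        show "s * b ^ j \<noteq> poly r t"
        proof
          assume eq: "s * b ^ j = poly r t"
          interpret PA: is_subring "polys_over A" by (rule subring_polys_over[OF A])
          have AA: "ideal_of A A" using sub_zero sub_add sub_mult by (auto simp: ideal_of_def)
          have rA: "r \<in> polys_over A"
            using r polys_over_mono P by (auto simp: prime_of_def ideal_of_def)
          \<comment> \<open>Transcendence turns the equation of values into one of polynomials; the
            coefficient at the degree of \<open>q ^ j\<close> then puts
            \<open>s * lead_coeff q ^ j\<close> into \<open>P\<close>.\<close>
          have "smult s (q ^ j) - r \<in> polys_over A"
            by (intro PA.sub_diff rA smult_polys_over[OF AA s(1)] PA.sub_power q(1))
          moreover have "poly (smult s (q ^ j) - r) t = 0" using eq q(2) by simp
          ultimately have "smult s (q ^ j) = r" using False by force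
          then have "s * ?l q ^ j = coeff r (?d (q ^ j))"
            by (metis coeff_smult lead_coeff_power)
          then have "s * ?l q ^ j \<in> P" using polys_overD[OF r] by simp
          then show False
            using prime_of_power[OF P A polys_overD[OF q(1)] lq] P s sub_power polys_overD[OF q(1)]
            unfolding prime_of_def by blast
        qed
      qed
    qed
  next
    case True
    then have ex: "\<exists>p. p \<in> polys_over A \<and> p \<noteq> 0 \<and> poly p t = 0" by blast
    obtain p where p: "p \<in> polys_over A" "p \<noteq> 0" "poly p t = 0"
      and min: "\<And>q. q \<in> polys_over A \<Longrightarrow> poly q t = 0 \<Longrightarrow> q \<noteq> 0 \<Longrightarrow> ?d p \<le> ?d q"
      using ex_has_least_nat[of "\<lambda>p. p \<in> polys_over A \<and> p \<noteq> 0 \<and> poly p t = 0" _ ?d] ex by blast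
    obtain b' where b': "b' \<in> adjoin A t" "b * b' \<in> A" "b * b' \<noteq> 0"
      using algebraic_multiple_in_base[OF A b p min] by blast
    have lp: "?l p \<in> A" by (rule polys_overD[OF p(1)])
    show ?thesis
    proof (intro bexI[of _ "?l p * (b * b')"] conjI allI impI)
      show "?l p * (b * b') \<in> A" by (intro sub_mult lp b')
      show "?l p * (b * b') \<noteq> 0" using p(2) b'(3) by simp
      fix P assume P: "prime_of A P" and a: "?l p * (b * b') \<notin> P"
      have Pid: "ideal_of A P" using P by (simp add: prime_of_def)
      note PP = polys_over_ideal[OF A Pid]
      have notP: "?l p \<notin> P" "b * b' \<notin> P"
        using a ideal_ofD(4)[OF Pid lp, of "b * b'"] ideal_ofD(4)[OF Pid b'(2), of "?l p"]
        unfolding mult.commute[of "b * b'"] by blast+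
      show "\<exists>Q. prime_of (adjoin A t) Q \<and> Q \<inter> A = P \<and> b \<notin> Q"
      proof (rule extend[OF P])
        fix s j r assume s: "s \<in> A" "s \<notin> P" and r: "r \<in> polys_over P"
        show "s * b ^ j \<noteq> poly r t"
        proof
          assume eq: "s * b ^ j = poly r t"
          obtain w where w: "w \<in> polys_over A" "b' = poly w t" using b'(1) by (auto simp: adjoin_def)
          interpret PA: is_subring "polys_over A" by (rule subring_polys_over[OF A])
          have "w ^ j * r \<in> polys_over P" by (intro ideal_ofD(4)[OF PP] PA.sub_power w r)
          then obtain N u r' where r': "u \<in> polys_over P" "r' \<in> polys_over P"
            "smult (?l p ^ N) (w ^ j * r) = p * u + r'" "r' = 0 \<or> ?d r' < ?d p"
            using pseudo_remainder[OF A Pid p(1,2)] by blast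
          \<comment> \<open>Multiplying by \<open>b' ^ j\<close> and by the power from
            pseudo-division brings the left side into A and replaces the right side by the value of
            a remainder of degree below p. By minimality of p the remainder is the constant
            \<open>?c\<close>, so \<open>?c\<close> lies in \<open>P\<close>.\<close>
          let ?c = "?l p ^ N * (s * (b * b') ^ j)"
          have c: "?c \<in> A" by (intro sub_mult sub_power lp s b')
          have "?c = ?l p ^ N * (b' ^ j * poly r t)"
            by (simp add: power_mult_distrib mult_ac flip: eq)
          also have "\<dots> = poly r' t"
            using arg_cong[OF r'(3), of "\<lambda>q. poly q t"] p(3) by (simp add: w(2))
          finally have ev: "poly (r' - [:?c:]) t = 0" by simp
          have "r' \<in> polys_over A" using r'(2) ideal_ofD(1)[OF PP] by blast
          moreover have "[:?c:] \<in> polys_over A"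
            using c sub_zero by (auto simp: polys_over_def coeff_pCons split: nat.split)
          ultimately have rc: "r' - [:?c:] \<in> polys_over A" by (rule PA.sub_diff)
          have "?d p \<noteq> 0"
          proof
            assume "?d p = 0"
            then have "p = [:coeff p 0:]" by (simp add: degree_0_id)
            then show False using p(2,3) by (metis pCons_eq_0_iff poly_const_conv)
          qed
          then have "?d (r' - [:?c:]) < ?d p"
            using r'(4) degree_diff_le_max[of r' "[:?c:]"] by auto
          then have "r' = [:?c:]" using min[OF rc ev] by force
          then have "?c \<in> P" using polys_overD[OF r'(2), of 0] by simp
          moreover have "?l p ^ N \<notin> P" "(b * b') ^ j \<notin> P"
            using prime_of_power[OF P A lp notP(1)] prime_of_power[OF P A b'(2) notP(2)] by auto
          moreover have "?l p ^ N \<in> A" "(b * b') ^ j \<in> A" by (intro sub_power lp b')+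
          ultimately show False using P s sub_mult unfolding prime_of_def by meson
        qed
      qed
    qed
  qed
qed

text \<open>For the later generators the induction hypothesis yields an element of the intermediate
  ring that must be avoided; the one-generator case is then applied with this element in the role of
  b.\<close>

theorem prime_of_extend:
  fixes A :: "'a::idom set"
  assumes "is_subring A" "b \<in> adjoin_list A ts" "b \<noteq> 0"
  shows "\<exists>a\<in>A. a \<noteq> 0 \<and> (\<forall>P. prime_of A P \<longrightarrow> a \<notin> P \<longrightarrow>
    (\<exists>Q. prime_of (adjoin_list A ts) Q \<and> Q \<inter> A = P \<and> b \<notin> Q))"
  using assms
proof (induction ts arbitrary: A)
  case Nil
  have "P \<inter> A = P" if "prime_of A P" for P using that by (auto simp: prime_of_def ideal_of_def)
  then show ?case using Nil.prems by (intro bexI[of _ b]) auto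
next
  case (Cons t ts)
  let ?B = "adjoin A t"
  have "b \<in> adjoin_list ?B ts" using Cons.prems by simp
  from Cons.IH[OF subring_adjoin[OF Cons.prems(1)] this Cons.prems(3)] obtain b1 where b1: "b1 \<in> ?B" "b1 \<noteq> 0"
    and ext: "\<And>P. prime_of ?B P \<Longrightarrow> b1 \<notin> P \<Longrightarrow> \<exists>Q. prime_of (adjoin_list ?B ts) Q \<and> Q \<inter> ?B = P \<and> b \<notin> Q"
    by blast
  obtain a where a: "a \<in> A" "a \<noteq> 0"
    and ext1: "\<And>P. prime_of A P \<Longrightarrow> a \<notin> P \<Longrightarrow> \<exists>Q. prime_of ?B Q \<and> Q \<inter> A = P \<and> b1 \<notin> Q"
    using prime_of_extend_one[OF Cons.prems(1) b1] by blast
  have "\<exists>Q. prime_of (adjoin_list A (t # ts)) Q \<and> Q \<inter> A = P \<and> b \<notin> Q" if "prime_of A P" "a \<notin> P" for P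
  proof -
    obtain Q1 where Q1: "prime_of ?B Q1" "Q1 \<inter> A = P" "b1 \<notin> Q1" using ext1 \<open>prime_of A P\<close> \<open>a \<notin> P\<close> by blast
    obtain Q where "prime_of (adjoin_list ?B ts) Q" "Q \<inter> ?B = Q1" "b \<notin> Q" using ext Q1 by blast
    then show ?thesis using Q1(2) adjoin_superset[OF Cons.prems(1), of t] by auto
  qed
  with a show ?case by blast
qed

section \<open>The orbit\<close>

subsection \<open>The orbit closure near the point\<close>

lemma meval_gen_power:
  assumes "\<And>v. meval x (t v) = 0" "a \<in> gen_power t 1" shows "meval x a = 0"
proof -
  interpret ev: comm_ring_hom "meval x" by (rule ident.msubst_hom)
  obtain c where "a = (\<Sum>v\<in>UNIV. t v * c v)" using assms(2) by auto
  then show ?thesis using assms(1) by (simp add: ev.homs)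
qed

lemma leibniz_defect_lie_ideal:
  "leibniz_defect mvar (basis_vec i) (basis_vec j) (basis_vec k) $ l \<in> lie_ideal"
  unfolding lie_ideal_def by (rule subsetD[OF Idl_subset]) (rule lie_equations_leibniz)

text \<open>On the basic open set of s, a neighbourhood of x, the orbit closure and Lie(V) coincide
  as schemes.\<close>

lemma orbit_ideal_localized:
  fixes x :: "('k::field, 'n::finite) struct_consts"
  assumes x: "x \<in> U_Lie"
  shows "\<exists>s. meval x s \<noteq> 0 \<and> (\<forall>f\<in>orbit_ideal x. s * f \<in> lie_ideal)"
proof -
  interpret ev: comm_ring_hom "meval x" by (rule ident.msubst_hom)
  interpret O: tideal "orbit_ideal x" by (rule tideal_orbit_ideal)
  let ?t = "\<lambda>v. mvar v - mconst (x v) :: ('n, 'k) bracket_poly"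
  define F where "F k = {f. \<exists>a\<in>gen_power ?t k. f - a \<in> lie_ideal}" for k
  interpret kl: killing_lie "\<lambda>v. mconst (x v)" "map_mat mconst (matrix_inv (trace_form x))"
    by (rule killing_lie_U_Lie[OF x mconst_hom])
  interpret fl: ideal_filtration F
    unfolding F_def by (rule ideal_filtration_gen_power[OF tideal_lie_ideal])
  have lie_F: "f \<in> F k" if "f \<in> lie_ideal" for f k
    using that tideal.ideal_zero[OF tideal_gen_power] unfolding F_def by (auto intro!: bexI[of _ 0])
  interpret kd: killing_deformation "\<lambda>v. mconst (x v)" "map_mat mconst (matrix_inv (trace_form x))" F mvar
  proof (rule killing_deformation.intro[OF kl.killing_lie_axioms fl.ideal_filtration_axioms], rule killing_deformation_axioms.intro)
    show "mvar v - mconst (x v) \<in> F 1" for v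
      using gen_power_one[of ?t v] lie.ideal_zero unfolding F_def by (auto intro!: bexI[of _ "?t v"])
    show "fl.vec_in k (leibniz_defect mvar a b c)" for k a b c
    proof -
      have "lie.vcong (leibniz_defect mvar a b c) 0"
      proof (rule lie.leibniz_defect_mem)
        show "lie.vcong (leibniz_defect mvar (basis_vec i) (basis_vec j) (basis_vec k)) 0" for i j k
          by (simp add: lie.vcong_def leibniz_defect_lie_ideal)
      qed
      then show ?thesis unfolding fl.vec_in_def lie.vcong_def by (auto intro: lie_F)
    qed
  qed
  have "f \<in> F k" if "f \<in> orbit_ideal x" for f k
    using kd.orbit_ideal_mem[OF mconst_hom refl that, of k] by (simp add: msubst_mconst_mvar)
  then have loc: "\<exists>\<mu>\<in>gen_power ?t 1. (1 - \<mu>) * f \<in> lie_ideal" if "f \<in> orbit_ideal x" for f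
    using krull_intersection[OF noetherian_mpoly tideal_lie_ideal, of ?t f] that unfolding F_def by blast
  have "ideal_of UNIV (orbit_ideal x)"
    by (simp add: ideal_of_def O.ideal_zero O.ideal_add O.ideal_mult)
  then obtain f n where f: "\<And>i. i < n \<Longrightarrow> f i \<in> orbit_ideal x" and span: "orbit_ideal x \<subseteq> seq_span UNIV f n"
    using noetherian_mpoly unfolding noetherian_def by blast
  have "\<forall>i\<in>{..<n}. \<exists>\<mu>. \<mu> \<in> gen_power ?t 1 \<and> (1 - \<mu>) * f i \<in> lie_ideal"
    using loc[OF f] by blast
  from bchoice[OF this] obtain \<mu> where \<mu>: "\<And>i. i < n \<Longrightarrow> \<mu> i \<in> gen_power ?t 1"
    "\<And>i. i < n \<Longrightarrow> (1 - \<mu> i) * f i \<in> lie_ideal" by blast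
  \<comment> \<open>Krull gives one multiplier for each element; since the orbit ideal is finitely
    generated, the product over generators serves for all. Each factor takes the value 1 at
    x.\<close>
  define s where "s = (\<Prod>i<n. 1 - \<mu> i)"
  have "meval x (\<mu> i) = 0" if "i < n" for i
    by (rule meval_gen_power[OF _ \<mu>(1)[OF that]]) (simp add: ev.homs ident.msubst_mvar ident.msubst_mconst)
  then have "meval x s \<noteq> 0" by (simp add: s_def ev.homs)
  moreover have sf: "s * f i \<in> lie_ideal" if "i < n" for i
  proof -
    have "s = (\<Prod>j\<in>{..<n} - {i}. 1 - \<mu> j) * (1 - \<mu> i)"
      unfolding s_def using that by (subst prod.remove[of _ i]) (auto simp: mult.commute)
    then show ?thesis using lie.ideal_mult[OF \<mu>(2)[OF that]] by (simp add: mult.assoc)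
  qed
  have "s * g \<in> lie_ideal" if g: "g \<in> orbit_ideal x" for g
  proof -
    obtain c where "g = (\<Sum>i<n. c i * f i)" using span g by (auto simp: seq_span_def)
    then have "s * g = (\<Sum>i<n. c i * (s * f i))" by (simp add: sum_distrib_left mult_ac)
    then show ?thesis by (auto intro: lie.ideal_sum lie.ideal_mult[OF sf])
  qed
  ultimately show ?thesis by blast
qed

subsection \<open>The generic matrix\<close>

lemma monomial_eval_pointwise_mult:
  "monomial_eval (\<lambda>v. \<rho> v * \<sigma> v) m = monomial_eval \<rho> m * monomial_eval \<sigma> m"
  by (simp add: monomial_eval_def power_mult_distrib prod.distrib)

text \<open>Dedekind's argument on the independence of characters, applied to monomials.\<close>

lemma monomials_independent:
  fixes c :: "('v \<Rightarrow>\<^sub>0 nat) \<Rightarrow> 'k::field_char_0"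
  assumes "finite S" "\<And>\<rho>. (\<Sum>m\<in>S. c m * monomial_eval \<rho> m) = 0" "m \<in> S"
  shows "c m = 0"
  using assms
proof (induction S arbitrary: c m rule: finite_induct)
  case (insert m0 S)
  have S: "c m = 0" if "m \<in> S" for m
  proof -
    have "m \<noteq> m0" using that insert.hyps by blast
    then obtain v where v: "lookup m v \<noteq> lookup m0 v"
      by (metis poly_mapping_eqI)
    \<comment> \<open>Doubling a variable that distinguishes m from m0 gives the two monomials
      different values, as distinct powers of 2 are distinct in characteristic 0.\<close>
    define \<sigma> where "\<sigma> w = (if w = v then 2 else 1 :: 'k)" for w
    have \<sigma>: "monomial_eval \<sigma> u = 2 ^ lookup u v" for u
    proof -
      have "monomial_eval \<sigma> u = (\<Prod>w\<in>insert v (keys u). \<sigma> w ^ lookup u w)"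
        by (rule monomial_eval_superset) auto
      also have "\<dots> = (\<Prod>w\<in>insert v (keys u). if w = v then 2 ^ lookup u v else 1)"
        by (rule prod.cong) (auto simp: \<sigma>_def)
      finally show ?thesis by (simp add: prod.delta')
    qed
    \<comment> \<open>Rescaling the point by \<sigma> and subtracting a multiple of the original
      relation cancels the term of m0.\<close>
    let ?c = "\<lambda>u. c u * (monomial_eval \<sigma> u - monomial_eval \<sigma> m0)"
    have "(\<Sum>u\<in>S. ?c u * monomial_eval \<rho> u) = 0" for \<rho>
    proof -
      have "(\<Sum>u\<in>insert m0 S. ?c u * monomial_eval \<rho> u) =
          (\<Sum>u\<in>insert m0 S. c u * monomial_eval (\<lambda>w. \<sigma> w * \<rho> w) u)
          - monomial_eval \<sigma> m0 * (\<Sum>u\<in>insert m0 S. c u * monomial_eval \<rho> u)"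
        unfolding monomial_eval_pointwise_mult sum_distrib_left sum_subtractf[symmetric]
        by (rule sum.cong) (auto simp: algebra_simps)
      also have "\<dots> = 0" unfolding insert.prems(1) by simp
      finally show ?thesis using insert.hyps by simp
    qed
    then have "?c m = 0" by (rule insert.IH[OF _ that])
    moreover have "(2 :: 'k) ^ a \<noteq> 2 ^ b" if "a \<noteq> b" for a b
      using that by (metis of_nat_eq_iff of_nat_numeral of_nat_power one_less_numeral_iff
          power_inject_exp semiring_norm(76))
    ultimately show ?thesis using v by (simp add: \<sigma>)
  qed
  have "c m0 * monomial_eval (\<lambda>_. 1) m0 = 0"
    using insert.prems(1)[of "\<lambda>_. 1"] insert.hyps S by simp
  then have "c m0 = 0" by (simp add: monomial_eval_def)
  then show ?case using insert.prems(2) S by blast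
qed simp

lemma mpoly_nonvanishing:
  fixes q :: "('v, 'k::field_char_0) mpoly"
  assumes "q \<noteq> 0" shows "\<exists>\<rho>. meval \<rho> q \<noteq> 0"
proof (rule ccontr)
  assume "\<not> ?thesis"
  then have "(\<Sum>m\<in>keys q. lookup q m * monomial_eval \<rho> m) = 0" for \<rho>
    by (simp add: msubst_eq)
  from monomials_independent[OF _ this] have "lookup q m = 0" for m
    by (auto simp: in_keys_iff)
  then show False using assms by (simp add: poly_mapping_eq_iff fun_eq_iff)
qed

text \<open>The variables are renamed to numbers because the library shows that polynomial rings
  are integral domains only for linearly ordered variables.\<close>

definition var_index :: "'v::finite \<Rightarrow> nat" where
  "var_index = (SOME f. inj f)"

lemma inj_var_index: "inj (var_index :: 'v::finite \<Rightarrow> nat)"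
proof -
  have "\<exists>f :: 'v \<Rightarrow> nat. inj f" using finite_imp_inj_to_nat_seg[OF finite] by blast
  then show ?thesis unfolding var_index_def by (rule someI_ex)
qed

text \<open>An embedding of the polynomial ring into a field. The field supplies Cramer's rule and
  the ambient domain for the extension of primes.\<close>

definition generic :: "('v::finite, 'k::field_char_0) mpoly \<Rightarrow> (nat, 'k) mpoly fract" where
  "generic q = to_fract (msubst mconst (\<lambda>v. mvar (var_index v)) q)"

lemma generic_hom: "comm_ring_hom generic"
  unfolding generic_def
  by (rule comm_ring_hom_comp[OF mconst.msubst_hom]) (unfold_locales, auto)

interpretation generic: comm_ring_hom generic
  by (rule generic_hom)

lemma generic_eq_0:
  fixes q :: "('v::finite, 'k::field_char_0) mpoly"
  shows "generic q = 0 \<longleftrightarrow> q = 0"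
proof
  assume "generic q = 0"
  then have 0: "msubst mconst (\<lambda>v. mvar (var_index v)) q = (0 :: (nat, 'k) mpoly)"
    by (simp add: generic_def)
  show "q = 0"
  proof (rule ccontr)
    assume "q \<noteq> 0"
    then obtain \<rho> where \<rho>: "meval \<rho> q \<noteq> 0" using mpoly_nonvanishing by blast
    interpret ev: comm_ring_hom "meval (\<lambda>i. \<rho> (inv_into UNIV var_index i))" by (rule ident.msubst_hom)
    have "meval (\<lambda>i. \<rho> (inv_into UNIV var_index i)) (msubst mconst (\<lambda>v. mvar (var_index v)) q) = meval \<rho> q"
      unfolding ev.hom_msubst
      by (simp add: ident.msubst_mconst ident.msubst_mvar inv_into_f_f[OF inj_var_index])
    with \<rho> show False by (simp add: 0 ev.hom_zero)
  qed
qed (simp add: generic.hom_zero)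

section \<open>Determinant and adjugate of the generic matrix\<close>

lemma (in comm_ring_hom) hom_det: "h (det A) = det (map_mat h A)"
  by (simp add: det_def homs hom_of_int)

lemma (in tideal) cong_prod: "(\<And>i. i \<in> S \<Longrightarrow> f i - g i \<in> I) \<Longrightarrow> (\<Prod>i\<in>S. f i) - (\<Prod>i\<in>S. g i) \<in> I"
  by (induction S rule: infinite_finite_induct) (auto simp: ideal_zero intro!: cong_mult)

lemma (in tideal) cong_det:
  assumes "\<And>i j. A $ i $ j - B $ i $ j \<in> I" shows "det A - det B \<in> I"
  unfolding det_def by (rule cong_sum, rule cong_mult, simp add: ideal_zero, rule cong_prod, rule assms)

definition var_mat :: "('n \<times> 'n, 'k::comm_ring_1) mpoly ^ 'n ^ 'n::finite" where
  "var_mat = (\<chi> i j. mvar (i, j))"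

text \<open>Entry (k, j) is the numerator of Cramer's rule: column k is replaced by the j-th unit
  vector.\<close>

definition var_adjugate :: "('n \<times> 'n, 'k::comm_ring_1) mpoly ^ 'n ^ 'n::finite" where
  "var_adjugate = (\<chi> k j. det (\<chi> i l. if l = k then (if i = j then 1 else 0) else var_mat $ i $ l))"

lemma meval_det_var_mat: "meval \<rho> (det var_mat) = det (\<chi> i j. \<rho> (i, j))"
proof -
  interpret ev: comm_ring_hom "meval \<rho>" by (rule ident.msubst_hom)
  have "map_mat (meval \<rho>) var_mat = (\<chi> i j. \<rho> (i, j))"
    by (simp add: vec_eq_iff var_mat_def ident.msubst_mvar)
  then show ?thesis by (simp add: ev.hom_det)
qed

lemma det_var_mat_nonzero: "det (var_mat :: ('n \<times> 'n, 'k::field_char_0) mpoly ^ 'n ^ 'n::finite) \<noteq> 0"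
proof
  let ?\<rho> = "\<lambda>(i, j). if i = j then 1 else 0 :: 'k"
  assume "det (var_mat :: ('n \<times> 'n, 'k) mpoly ^ 'n ^ 'n) = 0"
  then have "det ((\<chi> i j. ?\<rho> (i, j)) :: 'k^'n^'n) = 0"
    unfolding meval_det_var_mat[of ?\<rho>, symmetric] by (simp add: ident.msubst_zero)
  moreover have "((\<chi> i j. ?\<rho> (i, j)) :: 'k^'n^'n) = mat 1" by (simp add: vec_eq_iff mat_def)
  ultimately show False by (metis det_I zero_neq_one)
qed

definition generic_mat :: "(nat, 'k::field_char_0) mpoly fract ^ 'n ^ 'n::finite" where
  "generic_mat = map_mat generic var_mat"

lemma det_generic_mat:
  "det (generic_mat :: (nat, 'k::field_char_0) mpoly fract ^ 'n ^ 'n::finite) =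
    generic (det (var_mat :: ('n \<times> 'n, 'k) mpoly ^ 'n ^ 'n))"
  by (simp add: generic_mat_def generic.hom_det)

lemma invertible_generic_mat:
  "invertible (generic_mat :: (nat, 'k::field_char_0) mpoly fract ^ 'n ^ 'n::finite)"
  unfolding invertible_det_nz det_generic_mat by (simp add: generic_eq_0 det_var_mat_nonzero)

text \<open>Cramer's rule over the fraction field yields the adjugate identity for polynomials.\<close>

lemma var_mat_adjugate:
  "((var_mat :: ('n \<times> 'n, 'k::field_char_0) mpoly ^ 'n ^ 'n::finite) ** var_adjugate) $ i $ j =
    (if i = j then det var_mat else 0)"
proof -
  let ?V = "var_mat :: ('n \<times> 'n, 'k) mpoly ^ 'n ^ 'n"
  let ?G = "generic_mat :: (nat, 'k) mpoly fract ^ 'n ^ 'n"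
  let ?C = "map_mat generic (var_adjugate :: ('n \<times> 'n, 'k) mpoly ^ 'n ^ 'n)"
  have det: "det ?G \<noteq> 0" using invertible_generic_mat invertible_det_nz by blast
  define y where "y = (\<chi> k. det (\<chi> i l. if l = k then basis_vec j $ i else ?G $ i $ l) / det ?G)"
  have y: "?G *v y = basis_vec j" using cramer[OF det, of y "basis_vec j"] by (simp add: y_def)
  have C: "?C $ k $ j = det ?G * y $ k" for k
  proof -
    have "map_mat generic (\<chi> i l. if l = k then (if i = j then 1 else 0) else var_mat $ i $ l) =
        (\<chi> i l. if l = k then basis_vec j $ i else ?G $ i $ l)"
      by (simp add: vec_eq_iff axis_def generic_mat_def generic.homs)
    then show ?thesis using det by (simp add: y_def var_adjugate_def generic.hom_det)
  qed
  have "(?G ** ?C) $ i $ j = det ?G * (?G *v y) $ i"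
    unfolding matrix_matrix_mult_def vec_lambda_beta C
    by (simp add: matrix_vector_mult_def sum_distrib_left mult_ac)
  with y have "(?G ** ?C) $ i $ j = det ?G * (basis_vec j) $ i" by simp
  then have "generic ((var_mat ** var_adjugate) $ i $ j) = generic (if i = j then det ?V else 0)"
    by (simp add: generic_mat_def generic.hom_det axis_def generic.hom_zero
        flip: generic.map_mat_mult)
  then have "generic ((var_mat ** var_adjugate) $ i $ j - (if i = j then det ?V else 0)) = 0"
    by (simp add: generic.hom_diff)
  then show ?thesis unfolding generic_eq_0 right_minus_eq .
qed

section \<open>The coordinate ring of GL(V) as a localisation, and its generic point\<close>

definition incl :: "('n::finite \<times> 'n, 'k::field) mpoly \<Rightarrow> ('n gl_var, 'k) mpoly" where
  "incl = msubst mconst (\<lambda>v. mvar (Inl v))"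

interpretation incl: comm_ring_hom incl
  unfolding incl_def by (rule mconst.msubst_hom)

lemma map_mat_incl: "map_mat incl var_mat = gl_gen"
  by (simp add: vec_eq_iff var_mat_def gl_gen_def incl_def mconst.msubst_mvar)

text \<open>Modulo the relations the inverse matrix is the adjugate divided by the determinant, so a
  power of the determinant eliminates the variables of the inverse.\<close>

lemma clear_denominators:
  fixes p :: "('n::finite gl_var, 'k::field_char_0) mpoly"
  shows "\<exists>M q. det gl_gen ^ M * p - incl q \<in> gl_ideal"
proof -
  let ?\<Delta> = "det var_mat :: ('n \<times> 'n, 'k) mpoly"
  let ?D = "det gl_gen :: ('n gl_var, 'k) mpoly"
  have D: "?D = incl ?\<Delta>" by (simp add: incl.hom_det map_mat_incl)
  show ?thesis
  proof (induction p rule: mpoly_induct)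
    case (const c)
    have "?D ^ 0 * mconst c - incl (mconst c) \<in> gl_ideal"
      by (simp add: incl_def mconst.msubst_mconst gl.ideal_zero)
    then show ?case by blast
  next
    case (var v)
    show ?case
    proof (cases v)
      case (Inl w)
      have "?D ^ 0 * mvar v - incl (mvar w) \<in> gl_ideal"
        by (simp add: incl_def mconst.msubst_mvar Inl gl.ideal_zero)
      then show ?thesis by blast
    next
      case (Inr w)
      obtain i j where w: "w = (i, j)" by (cases w)
      let ?H = "gl_gen_inv :: ('n gl_var, 'k) mpoly ^ 'n ^ 'n" and ?C = "map_mat incl (var_adjugate :: ('n \<times> 'n, 'k) mpoly ^ 'n ^ 'n)"
      have GC: "(gl_gen ** ?C) $ l $ j = (if l = j then ?D else 0)" for l
        unfolding map_mat_incl[symmetric] incl.map_mat_mult[symmetric] map_mat_nth var_mat_adjugate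
        by (simp add: incl.hom_det incl.hom_zero)
      have "(?H ** (gl_gen ** ?C)) $ i $ j = ?H $ i $ j * ?D"
        by (subst matrix_matrix_mult_def) (simp add: GC if_distrib[of "\<lambda>u. _ * u"] cong: if_cong)
      \<comment> \<open>The relation h g = 1 multiplied by the adjugate on the right reads:
        determinant times h equals the adjugate.\<close>
      then have "((?H ** gl_gen - mat 1) ** ?C) $ i $ j = ?D ^ 1 * mvar v - incl (var_adjugate $ i $ j)"
        unfolding matrix_diff_distrib matrix_mul_assoc[symmetric]
        by (simp add: gl_gen_inv_def Inr w mult.commute)
      moreover have "((?H ** gl_gen - mat 1) ** ?C) $ i $ j \<in> gl_ideal"
        by (subst matrix_matrix_mult_def) (auto intro!: gl.ideal_sum gl.ideal_mult' gl_relations(2) simp del: vector_minus_component)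
      ultimately have "?D ^ 1 * mvar v - incl (var_adjugate $ i $ j) \<in> gl_ideal" by simp
      then show ?thesis by blast
    qed
  next
    case (add f g)
    then obtain M q N r where "?D ^ M * f - incl q \<in> gl_ideal" "?D ^ N * g - incl r \<in> gl_ideal"
      by blast
    from gl.ideal_add[OF gl.ideal_mult[OF this(1), of "?D ^ N"] gl.ideal_mult[OF this(2), of "?D ^ M"]]
    have "?D ^ (M + N) * (f + g) - incl (?\<Delta> ^ N * q + ?\<Delta> ^ M * r) \<in> gl_ideal"
      by (simp add: D incl.homs algebra_simps power_add)
    then show ?case by blast
  next
    case (mult f g)
    then obtain M q N r where "?D ^ M * f - incl q \<in> gl_ideal" "?D ^ N * g - incl r \<in> gl_ideal"
      by blast
    from gl.cong_mult[OF this] have "?D ^ (M + N) * (f * g) - incl (q * r) \<in> gl_ideal"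
      by (simp add: incl.homs power_add mult_ac)
    then show ?case by blast
  qed
qed

text \<open>The determinant of \<open>gl_gen\<close> is a unit modulo the relations, its inverse
  being the determinant of \<open>gl_gen_inv\<close>.\<close>

lemma det_gl_gen_cancel:
  fixes p :: "('n::finite gl_var, 'k::field) mpoly"
  assumes "det gl_gen ^ M * p \<in> gl_ideal" shows "p \<in> gl_ideal"
proof -
  have "det (gl_gen_inv ** gl_gen) - det (mat 1 :: ('n gl_var, 'k) mpoly ^ 'n ^ 'n) \<in> gl_ideal"
    by (rule gl.cong_det) (use gl_relations(2) in simp)
  then have inv: "det gl_gen_inv * det gl_gen - (1 :: ('n gl_var, 'k) mpoly) \<in> gl_ideal"
    by (simp add: det_mul det_I)
  have "q \<in> gl_ideal" if "det gl_gen * q \<in> gl_ideal" for q :: "('n gl_var, 'k) mpoly"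
  proof -
    have "q = det gl_gen_inv * (det gl_gen * q) - q * (det gl_gen_inv * det gl_gen - 1)"
      by (simp add: algebra_simps)
    then show ?thesis using gl.ideal_diff[OF gl.ideal_mult[OF that, of "det gl_gen_inv"] gl.ideal_mult[OF inv, of q]] by simp
  qed
  then show ?thesis using assms by (induction M) (auto simp: mult.assoc)
qed

definition gl_eval :: "'k::field ^ 'n ^ 'n \<Rightarrow> ('n::finite gl_var, 'k) mpoly \<Rightarrow> 'k" where
  "gl_eval g = meval (case_sum (\<lambda>(i, j). g $ i $ j) (\<lambda>(i, j). matrix_inv g $ i $ j))"

text \<open>Evaluation at the generic point of GL(V). Its kernel is exactly \<open>gl_ideal\<close>,
  by \<open>gl_generic_ideal\<close> and \<open>gl_generic_kernel\<close>, so k[GL(V)] is treated as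
  a subring of a field.\<close>

definition gl_generic :: "('n::finite gl_var, 'k::field_char_0) mpoly \<Rightarrow> (nat, 'k) mpoly fract" where
  "gl_generic = msubst (\<lambda>c. generic (mconst c :: ('n \<times> 'n, 'k) mpoly))
     (case_sum (\<lambda>(i, j). generic_mat $ i $ j) (\<lambda>(i, j). matrix_inv generic_mat $ i $ j))"

lemma const_generic_hom: "comm_ring_hom (\<lambda>c. generic (mconst c))"
  by (rule comm_ring_hom_comp[OF mconst_hom generic_hom])

interpretation gl_generic: comm_ring_hom gl_generic
  unfolding gl_generic_def by (rule comm_ring_hom.msubst_hom[OF const_generic_hom])

lemma gl_generic_ideal: "p \<in> gl_ideal \<Longrightarrow> gl_generic p = 0"
  using gl_ideal_hom_mem[OF const_generic_hom tideal_zero, of generic_mat "matrix_inv generic_mat" p]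
  by (simp add: gl_generic_def matrix_inv_left matrix_inv_right invertible_generic_mat)

lemma gl_generic_incl: "gl_generic (incl q) = generic (q :: ('n::finite \<times> 'n, 'k::field_char_0) mpoly)"
proof (rule mpoly_hom_eqI[OF comm_ring_hom_comp[OF incl.comm_ring_hom_axioms gl_generic.comm_ring_hom_axioms] generic_hom])
  interpret c: comm_ring_hom "\<lambda>c. generic (mconst c :: ('n \<times> 'n, 'k) mpoly)" by (rule const_generic_hom)
  show "gl_generic (incl (mconst c :: ('n \<times> 'n, 'k) mpoly)) = generic (mconst c :: ('n \<times> 'n, 'k) mpoly)" for c :: 'k
    unfolding incl_def mconst.msubst_mconst gl_generic_def by (rule c.msubst_mconst)
  show "gl_generic (incl (mvar v :: ('n \<times> 'n, 'k) mpoly)) = generic (mvar v :: ('n \<times> 'n, 'k) mpoly)" for v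
    by (cases v) (simp add: incl_def mconst.msubst_mvar gl_generic_def c.msubst_mvar generic_mat_def var_mat_def)
qed

lemma gl_eval_hom: "comm_ring_hom (gl_eval g)"
  unfolding gl_eval_def by (rule ident.msubst_hom)

lemma gl_generic_kernel:
  assumes "gl_generic p = 0" shows "p \<in> gl_ideal"
proof -
  obtain M q where Mq: "det gl_gen ^ M * p - incl q \<in> gl_ideal" using clear_denominators by blast
  have "generic q = 0"
    using gl_generic_ideal[OF Mq] assms by (simp add: gl_generic.homs gl_generic_incl)
  then have "det gl_gen ^ M * p \<in> gl_ideal" using Mq by (simp add: generic_eq_0 incl.hom_zero)
  then show ?thesis by (rule det_gl_gen_cancel)
qed

text \<open>This is the density of the rational points of GL(V), reduced by clearing denominators to
  the nonvanishing of polynomials.\<close>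

lemma gl_generic_nonvanishing:
  fixes p :: "('n::finite gl_var, 'k::field_char_0) mpoly"
  assumes "gl_generic p \<noteq> 0"
  shows "\<exists>g. invertible g \<and> gl_eval g p \<noteq> 0"
proof -
  obtain M q where Mq: "det gl_gen ^ M * p - incl q \<in> gl_ideal" using clear_denominators by blast
  let ?D = "det (generic_mat :: (nat, 'k) mpoly fract ^ 'n ^ 'n)"
  have "gl_generic (det (gl_gen :: ('n gl_var, 'k) mpoly ^ 'n ^ 'n)) = ?D"
    by (simp add: map_mat_incl[symmetric] incl.hom_det[symmetric] gl_generic_incl det_generic_mat)
  then have "generic q = ?D ^ M * gl_generic p"
    using gl_generic_ideal[OF Mq] by (simp add: gl_generic.homs gl_generic_incl)
  \<comment> \<open>The extra factor makes the determinant nonzero at the point found, so that the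
    point is an invertible matrix.\<close>
  then have "generic (q * det var_mat) = ?D ^ M * gl_generic p * ?D"
    by (simp add: generic.hom_mult det_generic_mat)
  moreover have "?D \<noteq> 0" using invertible_generic_mat invertible_det_nz by blast
  ultimately have "generic (q * det var_mat) \<noteq> 0" using assms by simp
  then have "q * det var_mat \<noteq> 0" by (metis generic.hom_zero)
  then obtain \<rho> where \<rho>: "meval \<rho> (q * det var_mat) \<noteq> 0" using mpoly_nonvanishing by blast
  define g where "g = (\<chi> i j. \<rho> (i, j))"
  have "meval \<rho> q \<noteq> 0" "det g \<noteq> 0"
    using \<rho> by (auto simp: ident.msubst_mult meval_det_var_mat g_def)
  then have inv: "invertible g" by (simp add: invertible_det_nz)
  interpret e: comm_ring_hom "gl_eval g" by (rule gl_eval_hom)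
  have "gl_eval g (det gl_gen ^ M * p - incl q) \<in> {0}"
    unfolding gl_eval_def
    by (rule gl_ideal_hom_mem[OF comm_ring_hom_id tideal_zero _ _ Mq])
      (simp_all add: matrix_inv_left matrix_inv_right inv)
  moreover have "gl_eval g (incl q) = meval \<rho> q"
    by (rule mpoly_hom_eqI[OF comm_ring_hom_comp[OF incl.comm_ring_hom_axioms e.comm_ring_hom_axioms] ident.msubst_hom])
      (auto simp: incl_def mconst.msubst_mconst mconst.msubst_mvar gl_eval_def ident.msubst_mconst
        ident.msubst_mvar g_def split: prod.splits)
  ultimately have "gl_eval g p \<noteq> 0" using \<open>meval \<rho> q \<noteq> 0\<close> by (auto simp: e.homs)
  then show ?thesis using inv by blast
qed

subsection \<open>Openness in the orbit closure\<close>

lemma gl_act_comp: "gl_act g h (gl_act g' h' x) = gl_act (g ** g') (h' ** h) x"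
proof -
  have "gl_act g h (gl_act g' h' x) (i, j, l) = gl_act (g ** g') (h' ** h) x (i, j, l)" for i j l
    unfolding bprod_basis[of "gl_act g h (gl_act g' h' x)", symmetric] bprod_basis[of "gl_act (g ** g') (h' ** h) x", symmetric]
      bprod_gl_act
    by (simp add: matrix_vector_mul_assoc)
  then show ?thesis by auto
qed

lemma gl_act_one: "gl_act (mat 1) (mat 1) x = x"
  by (auto simp: fun_eq_iff gl_act_def struct_consts_of_def bprod_basis)

text \<open>Pullback of functions along y -> g . y, with h in the place of the inverse of g. Thus
  \<open>translate g\<close> is \<open>translation\<close> for the inverse of g followed by g
  itself.\<close>

definition translation :: "'k^'n^'n \<Rightarrow> 'k^'n^'n \<Rightarrow> ('n, 'k) bracket_poly \<Rightarrow> ('n::finite \<times> 'n \<times> 'n, 'k::field) mpoly" where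
  "translation g h = msubst mconst (gl_act (map_mat mconst g) (map_mat mconst h) mvar)"

lemma translation_hom: "comm_ring_hom (translation g h)"
  unfolding translation_def by (rule mconst.msubst_hom)

lemma meval_translation:
  fixes x :: "('k::field, 'n::finite) struct_consts"
  shows "meval x (translation g h f) = meval (gl_act g h x) f"
proof -
  interpret ev: comm_ring_hom "meval x" by (rule ident.msubst_hom)
  have "map_mat (meval x) (map_mat mconst A) = A" for A :: "'k^'n^'n"
    by (simp add: vec_eq_iff ident.msubst_mconst)
  then show ?thesis
    unfolding translation_def ev.hom_msubst
    by (simp add: ev.hom_gl_act ident.msubst_mconst ident.msubst_mvar)
qed

lemma translation_inverse:
  fixes g h :: "'k::field^'n^'n::finite"
  assumes "g ** h = mat 1" "h ** g = mat 1"
  shows "translation g h (translation h g f) = f"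
proof -
  interpret t: comm_ring_hom "translation g h" by (rule translation_hom)
  have m: "map_mat (translation g h) (map_mat mconst A) = map_mat mconst A" for A :: "'k^'n^'n"
    by (simp add: vec_eq_iff translation_def mconst.msubst_mconst)
  have "translation g h (translation h g f) =
      msubst mconst (gl_act (map_mat mconst h) (map_mat mconst g) (gl_act (map_mat mconst g) (map_mat mconst h) mvar)) f"
    unfolding translation_def[of h g] t.hom_msubst t.hom_gl_act m
    by (simp add: translation_def mconst.msubst_mconst mconst.msubst_mvar)
  then show ?thesis
    by (simp add: gl_act_comp assms mconst.map_mat_one gl_act_one msubst_mconst_mvar
        flip: mconst.map_mat_mult)
qed

text \<open>Translation on the orbit is left multiplication on the group.\<close>

definition gl_translation ::
    "'k^'n^'n \<Rightarrow> 'k^'n^'n \<Rightarrow> ('n::finite gl_var, 'k::field) mpoly \<Rightarrow> ('n gl_var, 'k) mpoly" where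
  "gl_translation g h = msubst mconst (case_sum (\<lambda>(i, j). (map_mat mconst g ** gl_gen) $ i $ j)
     (\<lambda>(i, j). (gl_gen_inv ** map_mat mconst h) $ i $ j))"

lemma gl_translation_hom: "comm_ring_hom (gl_translation g h)"
  unfolding gl_translation_def by (rule mconst.msubst_hom)

lemma orbit_comorphism_translation:
  fixes x :: "('k::field, 'n::finite) struct_consts"
  shows "orbit_comorphism x (translation g h f) = gl_translation g h (orbit_comorphism x f)"
proof -
  interpret o: comm_ring_hom "orbit_comorphism x" by (rule orbit_comorphism_hom)
  have c: "orbit_comorphism x (mconst c) = mconst c" for c
    by (simp add: orbit_comorphism_def mconst.msubst_mconst)
  have "map_mat (orbit_comorphism x) (map_mat mconst A) = map_mat mconst A" for A :: "'k^'n^'n"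
    by (simp add: vec_eq_iff c)
  then have "orbit_comorphism x (translation g h f) =
      msubst mconst (gl_act (map_mat mconst g) (map_mat mconst h) (gl_act gl_gen gl_gen_inv (\<lambda>v. mconst (x v)))) f"
    unfolding translation_def o.hom_msubst o.hom_gl_act
    by (simp add: c) (simp add: orbit_comorphism_def mconst.msubst_mvar)
  also have "\<dots> = gl_translation g h (orbit_comorphism x f)"
    unfolding gl_translation_def hom_orbit_comorphism[OF mconst_hom] gl_act_comp ..
  finally show ?thesis .
qed

lemma gl_translation_ideal:
  fixes g h :: "'k::field^'n^'n::finite"
  assumes gh: "g ** h = mat 1" "h ** g = mat 1" and p: "p \<in> gl_ideal"
  shows "gl_translation g h p \<in> gl_ideal"
  unfolding gl_translation_def
proof (rule gl_ideal_hom_mem[OF mconst_hom tideal_gl_ideal _ _ p])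
  let ?g = "map_mat mconst g" and ?h = "map_mat mconst h"
  have m: "?g ** ?h = mat 1" "?h ** ?g = mat 1"
    by (simp_all add: gh mconst.map_mat_one flip: mconst.map_mat_mult)
  have sandwich: "(A ** E ** B) $ i $ j \<in> gl_ideal" if "\<And>i j. E $ i $ j \<in> gl_ideal" for A B E :: "('n gl_var, 'k) mpoly ^ 'n ^ 'n" and i j
  proof -
    have "(A ** E) $ i $ j \<in> gl_ideal" for i j
      unfolding matrix_matrix_mult_def vec_lambda_beta by (intro gl.ideal_sum gl.ideal_mult that)
    then show ?thesis
      by (subst matrix_matrix_mult_def, unfold vec_lambda_beta) (intro gl.ideal_sum gl.ideal_mult')
  qed
  have "?g ** gl_gen ** (gl_gen_inv ** ?h) - mat 1 = ?g ** (gl_gen ** gl_gen_inv - mat 1) ** ?h"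
    by (simp add: matrix_diff_distrib matrix_mul_assoc m)
  then show "(?g ** gl_gen ** (gl_gen_inv ** ?h) - mat 1) $ i $ j \<in> gl_ideal" for i j
    using sandwich[OF gl_relations(1), of ?g ?h i j] by simp
  have "gl_gen_inv ** ?h ** (?g ** gl_gen) = gl_gen_inv ** (?h ** ?g) ** gl_gen"
    by (simp only: matrix_mul_assoc)
  then show "(gl_gen_inv ** ?h ** (?g ** gl_gen) - mat 1) $ i $ j \<in> gl_ideal" for i j
    using gl_relations(2)[of i j] by (simp add: m)
qed

text \<open>Extension of primes applies away from some nonzero function on the orbit closure, which
  may vanish at x. A rational translation moves the good open set to x; primes are translated,
  lifted, and their lifts translated back.\<close>

lemma orbit_lifting:
  fixes x :: "('k::field_char_0, 'n::finite) struct_consts"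
  shows "\<exists>f1. meval x f1 \<noteq> 0 \<and> (\<forall>P. prime_of UNIV P \<longrightarrow> orbit_ideal x \<subseteq> P \<longrightarrow> f1 \<notin> P \<longrightarrow>
    (\<exists>Q. prime_of UNIV Q \<and> gl_ideal \<subseteq> Q \<and> P = {f. orbit_comorphism x f \<in> Q}))"
proof -
  define \<alpha> where "\<alpha> f = gl_generic (orbit_comorphism x f)" for f
  have \<alpha>_hom: "comm_ring_hom \<alpha>" unfolding \<alpha>_def
    by (rule comm_ring_hom_comp[OF orbit_comorphism_hom gl_generic.comm_ring_hom_axioms])
  interpret \<alpha>: comm_ring_hom \<alpha> by (rule \<alpha>_hom)
  have kernel: "f \<in> orbit_ideal x" if "\<alpha> f = 0" for f
    using that gl_generic_kernel by (simp add: \<alpha>_def orbit_ideal_def)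
  define A where "A = range \<alpha>"
  have A: "is_subring A" unfolding A_def by (intro subring_image \<alpha>_hom subring_UNIV)
  obtain vs :: "'n gl_var list" where vs: "set vs = UNIV" using finite_list[OF finite] by blast
  define B where "B = adjoin_list A (map (\<lambda>v. gl_generic (mvar v :: ('n gl_var, 'k) mpoly)) vs)"
  interpret B: is_subring B unfolding B_def by (rule subring_adjoin_list[OF A])
  have gens: "A \<subseteq> B" "gl_generic (mvar v :: ('n gl_var, 'k) mpoly) \<in> B" for v
    using adjoin_list_superset[OF A, of "map (\<lambda>v. gl_generic (mvar v)) vs"] vs by (auto simp: B_def)
  have in_B: "gl_generic p \<in> B" for p :: "('n gl_var, 'k) mpoly"
  proof (induction p rule: mpoly_induct)
    case (const c)
    have "gl_generic (mconst c :: ('n gl_var, 'k) mpoly) = \<alpha> (mconst c)"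
      by (simp add: \<alpha>_def orbit_comorphism_def mconst.msubst_mconst)
    then show ?case using gens(1) by (auto simp: A_def)
  qed (auto simp: gl_generic.homs intro: gens B.sub_add B.sub_mult)
  \<comment> \<open>Taken with b = 1, which every prime avoids, so that the conclusion is just the
    existence of a prime over P.\<close>
  obtain a where a: "a \<in> A" "a \<noteq> 0"
    and ext: "\<And>P. prime_of A P \<Longrightarrow> a \<notin> P \<Longrightarrow> \<exists>Q. prime_of B Q \<and> Q \<inter> A = P"
    using prime_of_extend[OF A B.sub_one[unfolded B_def]] unfolding B_def by (metis zero_neq_one)
  obtain f0 where f0: "a = \<alpha> f0" using a(1) by (auto simp: A_def)
  \<comment> \<open>The function \<open>f0\<close> is nonzero at some rational translate g . x, so
    its pullback along g is nonzero at x.\<close>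
  obtain g where g: "invertible g" "gl_eval g (orbit_comorphism x f0) \<noteq> 0"
    using gl_generic_nonvanishing a(2) unfolding f0 \<alpha>_def by blast
  define h where "h = matrix_inv g"
  have gh: "g ** h = mat 1" "h ** g = mat 1" using g(1) by (simp_all add: h_def matrix_inv_left matrix_inv_right)
  let ?\<tau> = "translation g h" and ?\<tau>' = "translation h g"
  interpret \<tau>: comm_ring_hom ?\<tau> by (rule translation_hom)
  have "meval x (?\<tau> f0) \<noteq> 0"
    using g(2) unfolding meval_translation gl_eval_def hom_orbit_comorphism[OF comm_ring_hom_id] h_def .
  moreover have "\<exists>Q. prime_of UNIV Q \<and> gl_ideal \<subseteq> Q \<and> P = {f. orbit_comorphism x f \<in> Q}"
    if P: "prime_of UNIV P" "orbit_ideal x \<subseteq> P" "?\<tau> f0 \<notin> P" for P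
  proof -
    have Pid: "ideal_of UNIV P" using P(1) by (simp add: prime_of_def)
    let ?P = "\<alpha> ` {f. ?\<tau> f \<in> P}"
    \<comment> \<open>The translated prime is determined by its image under \<alpha>: the kernel of
      \<alpha> lies in the orbit ideal, which is stable under translation and contained in
      P.\<close>
    have mem: "\<alpha> f \<in> ?P \<longleftrightarrow> ?\<tau> f \<in> P" for f
    proof
      assume "\<alpha> f \<in> ?P"
      then obtain f' where f': "\<alpha> f = \<alpha> f'" "?\<tau> f' \<in> P" by blast
      then have "f - f' \<in> orbit_ideal x" by (intro kernel) (simp add: \<alpha>.hom_diff)
      then have "gl_translation g h (orbit_comorphism x (f - f')) \<in> gl_ideal"
        by (intro gl_translation_ideal gh) (simp add: orbit_ideal_def)
      then have "?\<tau> (f - f') \<in> P"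
        using P(2) by (auto simp: orbit_ideal_def orbit_comorphism_translation)
      from ideal_ofD(3)[OF Pid this f'(2)] show "?\<tau> f \<in> P" by (simp add: \<tau>.hom_diff)
    qed blast
    have "prime_of A ?P"
      unfolding prime_of_def ideal_of_def A_def
    proof (intro conjI ballI impI)
      have "\<alpha> 0 \<in> ?P" unfolding mem using ideal_ofD(2)[OF Pid] by (simp add: \<tau>.hom_zero)
      then show "0 \<in> ?P" by (simp add: \<alpha>.hom_zero)
      have "\<alpha> 1 \<notin> ?P" unfolding mem using P(1) by (simp add: \<tau>.hom_one prime_of_def)
      then show "1 \<notin> ?P" by (simp add: \<alpha>.hom_one)
      show "u + v \<in> ?P" if "u \<in> ?P" "v \<in> ?P" for u v
        using that ideal_ofD(3)[OF Pid] by (auto simp: \<tau>.homs simp flip: \<alpha>.hom_add)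
      show "u * v \<in> ?P" if "u \<in> range \<alpha>" "v \<in> ?P" for u v
        using that ideal_ofD(4)[OF Pid] by (auto simp: \<tau>.homs simp flip: \<alpha>.hom_mult)
      fix u v assume "u \<in> range \<alpha>" "v \<in> range \<alpha>" and uv: "u * v \<in> ?P"
      then obtain f f' where ff: "u = \<alpha> f" "v = \<alpha> f'" by blast
      have "?\<tau> f * ?\<tau> f' \<in> P" using uv unfolding ff \<alpha>.hom_mult[symmetric] mem by (simp add: \<tau>.hom_mult)
      then show "u \<in> ?P \<or> v \<in> ?P"
        unfolding ff mem using P(1) by (auto simp: prime_of_def)
    qed auto
    moreover have "a \<notin> ?P" unfolding f0 mem by (rule P(3))
    ultimately obtain \<Theta> where \<Theta>: "prime_of B \<Theta>" "\<Theta> \<inter> A = ?P" using ext by blast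
    have \<Theta>id: "ideal_of B \<Theta>" using \<Theta>(1) by (simp add: prime_of_def)
    \<comment> \<open>Left multiplication by the inverse of g on the group undoes the translation
      that was applied to P.\<close>
    define \<sigma> where "\<sigma> p = gl_generic (gl_translation h g p)" for p
    interpret \<sigma>: comm_ring_hom \<sigma> unfolding \<sigma>_def
      by (rule comm_ring_hom_comp[OF gl_translation_hom gl_generic.comm_ring_hom_axioms])
    have \<sigma>B: "\<sigma> p \<in> B" for p unfolding \<sigma>_def by (rule in_B)
    define Q where "Q = {p. \<sigma> p \<in> \<Theta>}"
    have "prime_of UNIV Q"
      using \<Theta>(1) ideal_ofD[OF \<Theta>id] \<sigma>B unfolding prime_of_def ideal_of_def Q_def by (auto simp: \<sigma>.homs)
    moreover have "gl_ideal \<subseteq> Q"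
      by (auto simp: Q_def \<sigma>_def gl_generic_ideal[OF gl_translation_ideal[OF gh(2,1)]] ideal_ofD(2)[OF \<Theta>id])
    moreover have "P = {f. orbit_comorphism x f \<in> Q}"
    proof -
      have "orbit_comorphism x f \<in> Q \<longleftrightarrow> f \<in> P" for f
      proof -
        have "orbit_comorphism x f \<in> Q \<longleftrightarrow> \<alpha> (?\<tau>' f) \<in> \<Theta>"
          by (simp add: Q_def \<sigma>_def \<alpha>_def orbit_comorphism_translation)
        also have "\<dots> \<longleftrightarrow> \<alpha> (?\<tau>' f) \<in> \<Theta> \<inter> A" by (simp add: A_def)
        also have "\<dots> \<longleftrightarrow> f \<in> P" unfolding \<Theta>(2) mem translation_inverse[OF gh] ..
        finally show ?thesis .
      qed
      then show ?thesis by blast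
    qed
    ultimately show ?thesis by blast
  qed
  ultimately show ?thesis by blast
qed

section \<open>Spectra of quotient rings\<close>

abbreviation type_coset :: "'a::comm_ring_1 set \<Rightarrow> 'a \<Rightarrow> 'a set" where
  "type_coset J f \<equiv> J +>\<^bsub>(ring_of_type_algebra :: 'a ring)\<^esub> f"

abbreviation type_quot :: "'a::comm_ring_1 set \<Rightarrow> 'a set ring" where
  "type_quot J \<equiv> (ring_of_type_algebra :: 'a ring) Quot J"

context tideal
begin

lemma ideal_type: "ideal I (ring_of_type_algebra :: 'a ring)"
  by (simp add: ideal_iff_tideal tideal_axioms)

lemma coset_eq_iff: "type_coset I f = type_coset I g \<longleftrightarrow> f - g \<in> I"
proof
  have c: "type_coset I f = (\<lambda>j. j + f) ` I" for f
    by (auto simp: a_r_coset_def' type_ring_simps)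
  assume "type_coset I f = type_coset I g"
  then have "(\<lambda>j. j + f) ` I = (\<lambda>j. j + g) ` I" unfolding c .
  moreover have "f \<in> (\<lambda>j. j + f) ` I" using ideal_zero by force
  ultimately obtain j where "j \<in> I" "f = j + g" by blast
  then show "f - g \<in> I" by simp
next
  have c: "type_coset I f = (\<lambda>j. j + f) ` I" for f
    by (auto simp: a_r_coset_def' type_ring_simps)
  assume fg: "f - g \<in> I"
  have "(\<lambda>j. j + f) ` I \<subseteq> (\<lambda>j. j + g) ` I" if "f - g \<in> I" for f g
  proof
    fix u assume "u \<in> (\<lambda>j. j + f) ` I"
    then obtain j where "j \<in> I" "u = (j + (f - g)) + g" by auto
    then show "u \<in> (\<lambda>j. j + g) ` I" using ideal_add[OF _ that] by blast
  qed
  then show "type_coset I f = type_coset I g" unfolding c using fg cong_sym[OF fg] by blast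
qed

lemma carrier_quot: "carrier (type_quot I) = range (type_coset I)"
  by (auto simp: FactRing_def A_RCOSETS_def' type_ring_simps)

lemma cring_quot: "cring (type_quot I)"
  by (rule ideal.quotient_is_cring[OF ideal_type cring_from_type_algebra])

lemma quot_hom: "ring_hom_ring (ring_of_type_algebra :: 'a ring) (type_quot I) (type_coset I)"
  by (rule ideal.rcos_ring_hom_ring[OF ideal_type])

lemma coset_add: "type_coset I f \<oplus>\<^bsub>type_quot I\<^esub> type_coset I g = type_coset I (f + g)"
  using ring_hom_add[OF ring_hom_ring.homh[OF quot_hom], of f g] by (simp add: type_ring_simps)

lemma coset_mult: "type_coset I f \<otimes>\<^bsub>type_quot I\<^esub> type_coset I g = type_coset I (f * g)"
  using ring_hom_mult[OF ring_hom_ring.homh[OF quot_hom], of f g] by (simp add: type_ring_simps)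

lemma coset_one: "\<one>\<^bsub>type_quot I\<^esub> = type_coset I 1"
  using ring_hom_one[OF ring_hom_ring.homh[OF quot_hom]] by (simp add: type_ring_simps)

lemma coset_zero: "\<zero>\<^bsub>type_quot I\<^esub> = type_coset I 0"
proof -
  have "type_coset I 0 = I" by (auto simp: a_r_coset_def' type_ring_simps)
  then show ?thesis by (simp add: FactRing_def)
qed

lemma coset_uminus: "\<ominus>\<^bsub>type_quot I\<^esub> type_coset I f = type_coset I (- f)"
proof -
  interpret S: cring "type_quot I" by (rule cring_quot)
  have mem: "type_coset I g \<in> carrier (type_quot I)" for g by (simp add: carrier_quot)
  have "type_coset I (- f) \<oplus>\<^bsub>type_quot I\<^esub> type_coset I f = \<zero>\<^bsub>type_quot I\<^esub>"
    by (simp add: coset_add coset_zero)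
  then show ?thesis by (intro S.minus_equality mem)
qed

text \<open>Together with \<open>Spec_quotI\<close> this is the correspondence between primes of the
  quotient and primes containing \<open>I\<close>, which lets all arguments about spectra run on
  polynomials.\<close>

lemma Spec_quotD:
  assumes "P \<in> Spec (type_quot I)"
  shows "prime_of UNIV {f. type_coset I f \<in> P}" "I \<subseteq> {f. type_coset I f \<in> P}"
    "P = {type_coset I f | f. type_coset I f \<in> P}"
proof -
  let ?Q = "{f. type_coset I f \<in> P}"
  interpret P: primeideal P "type_quot I" using assms by (simp add: Spec_def)
  have mem: "type_coset I f \<in> carrier (type_quot I)" for f by (simp add: carrier_quot)
  have zero: "type_coset I 0 \<in> P" using additive_subgroup.zero_closed[OF P.additive_subgroup_axioms] by (simp add: coset_zero)
  have "1 \<notin> ?Q"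
    using P.I_notcarr P.one_imp_carrier by (auto simp: coset_one)
  moreover have "a \<in> ?Q \<or> b \<in> ?Q"
    if "a * b \<in> ?Q" for a b
    using P.I_prime[OF mem[of a] mem[of b]] that by (simp add: coset_mult)
  moreover have "a + b \<in> ?Q"
    if "a \<in> ?Q" "b \<in> ?Q" for a b
    using P.a_closed that by (simp flip: coset_add)
  moreover have "r * a \<in> ?Q" if "a \<in> ?Q" for r a
    using P.I_l_closed[OF _ mem] that by (simp flip: coset_mult)
  ultimately show "prime_of UNIV ?Q"
    using zero unfolding prime_of_def ideal_of_def by blast
  show "I \<subseteq> ?Q"
  proof
    fix f assume "f \<in> I"
    then have "type_coset I f = type_coset I 0" by (simp add: coset_eq_iff)
    then show "f \<in> ?Q" using zero by simp
  qed
  show "P = {type_coset I f | f. type_coset I f \<in> P}"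
    using P.Icarr by (auto simp: carrier_quot)
qed

lemma Spec_quotI:
  assumes Q: "prime_of UNIV Q" and "I \<subseteq> Q"
  shows "type_coset I f \<in> {type_coset I f | f. f \<in> Q} \<longleftrightarrow> f \<in> Q"
    "{type_coset I f | f. f \<in> Q} \<in> Spec (type_quot I)"
proof -
  interpret S: cring "type_quot I" by (rule cring_quot)
  have id: "ideal_of UNIV Q" using Q by (simp add: prime_of_def)
  let ?P = "{type_coset I f | f. f \<in> Q}"
  have mem: "type_coset I f \<in> ?P \<longleftrightarrow> f \<in> Q" for f
  proof
    assume "type_coset I f \<in> ?P"
    then obtain g where g: "g \<in> Q" "type_coset I f = type_coset I g" by blast
    then have "f - g \<in> Q" using \<open>I \<subseteq> Q\<close> by (auto simp: coset_eq_iff)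
    then show "f \<in> Q" using ideal_ofD(3)[OF id _ g(1), of "f - g"] by simp
  qed blast
  then show "type_coset I f \<in> {type_coset I f | f. f \<in> Q} \<longleftrightarrow> f \<in> Q" .
  have uminus: "- f \<in> Q" if "f \<in> Q" for f using ideal_ofD(4)[OF id _ that, of "- 1"] by simp
  have "subgroup ?P (add_monoid (type_quot I))"
  proof (rule S.add.subgroupI)
    show "?P \<subseteq> carrier (type_quot I)" by (auto simp: carrier_quot)
    show "?P \<noteq> {}" using ideal_ofD(2)[OF id] by blast
    fix a assume "a \<in> ?P"
    then obtain f where f: "a = type_coset I f" "f \<in> Q" by blast
    show "\<ominus>\<^bsub>type_quot I\<^esub> a \<in> ?P"
      unfolding f(1) coset_uminus mem by (rule uminus[OF f(2)])
    fix b assume "b \<in> ?P"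
    then obtain g where g: "b = type_coset I g" "g \<in> Q" by blast
    show "a \<oplus>\<^bsub>type_quot I\<^esub> b \<in> ?P"
      unfolding f(1) g(1) coset_add mem by (rule ideal_ofD(3)[OF id f(2) g(2)])
  qed
  then have ideal: "ideal ?P (type_quot I)"
  proof (rule idealI[OF S.ring_axioms])
    fix a r assume "a \<in> ?P" "r \<in> carrier (type_quot I)"
    then obtain f g where fg: "a = type_coset I f" "f \<in> Q" "r = type_coset I g" by (auto simp: carrier_quot)
    show "r \<otimes>\<^bsub>type_quot I\<^esub> a \<in> ?P" "a \<otimes>\<^bsub>type_quot I\<^esub> r \<in> ?P"
      unfolding fg(1,3) coset_mult mem mult.commute[of f] by (rule ideal_ofD(4)[OF id UNIV_I fg(2)])+
  qed
  have "primeideal ?P (type_quot I)"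
  proof (rule primeidealI[OF ideal cring_quot])
    have "type_coset I 1 \<notin> ?P" unfolding mem using Q by (simp add: prime_of_def)
    then show "carrier (type_quot I) \<noteq> ?P" unfolding carrier_quot by blast
    fix a b assume "a \<in> carrier (type_quot I)" "b \<in> carrier (type_quot I)" and ab: "a \<otimes>\<^bsub>type_quot I\<^esub> b \<in> ?P"
    then obtain f g where fg: "a = type_coset I f" "b = type_coset I g" by (auto simp: carrier_quot)
    have "f * g \<in> Q" using ab unfolding fg coset_mult mem .
    then show "a \<in> ?P \<or> b \<in> ?P" unfolding fg mem using Q by (auto simp: prime_of_def)
  qed
  then show "{type_coset I f | f. f \<in> Q} \<in> Spec (type_quot I)" by (simp add: Spec_def)
qed

end

section \<open>Openness of the orbit\<close>

lemma prime_of_point: "prime_of UNIV {f. meval x f = (0 :: 'k::field)}"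
proof -
  interpret ev: comm_ring_hom "meval x" by (rule ident.msubst_hom)
  show ?thesis by (simp add: prime_of_def ideal_of_def ev.homs)
qed

lemma lie_ideal_vanishes:
  assumes "x \<in> lie_points" "f \<in> lie_ideal" shows "meval x f = 0"
proof -
  interpret ev: comm_ring_hom "meval x" by (rule ident.msubst_hom)
  have "lie_ideal \<subseteq> {f. meval x f \<in> {0}}"
    unfolding lie_ideal_def
  proof (rule Idl_least)
    show "tideal {f. meval x f \<in> {0}}" by (rule tideal_vimage[OF ident.msubst_hom tideal_zero])
    have "meval x ` lie_equations mvar = lie_equations x"
      using ev.hom_lie_equations[of mvar] by (simp add: ident.msubst_mvar)
    then show "lie_equations mvar \<subseteq> {f. meval x f \<in> {0}}"
      using assms(1) by (auto simp: lie_points_def)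
  qed
  then show ?thesis using assms(2) by blast
qed

theorem orbit_contains_open:
  fixes x :: "('k::field_char_0, 'n::finite) struct_consts"
  assumes x: "x \<in> U_Lie"
  shows "\<exists>U. openin (zariski_topology lie_ring) U \<and> scheme_point x \<in> U \<and> U \<subseteq> scheme_orbit x"
proof -
  interpret ev: comm_ring_hom "meval x" by (rule ident.msubst_hom)
  have lp: "x \<in> lie_points" using x by (simp add: U_Lie_def)
  obtain s where s: "meval x s \<noteq> 0" "\<And>f. f \<in> orbit_ideal x \<Longrightarrow> s * f \<in> lie_ideal"
    using orbit_ideal_localized[OF x] by blast
  obtain f1 where f1: "meval x f1 \<noteq> 0" "\<And>P. prime_of UNIV P \<Longrightarrow> orbit_ideal x \<subseteq> P \<Longrightarrow> f1 \<notin> P \<Longrightarrow>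
    \<exists>Q. prime_of UNIV Q \<and> gl_ideal \<subseteq> Q \<and> P = {f. orbit_comorphism x f \<in> Q}"
    using orbit_lifting[of x] by blast
  \<comment> \<open>Where s is nonzero a prime contains the orbit ideal as soon as it contains the
    Lie ideal; where f1 is nonzero it then lifts to the group.\<close>
  define U where "U = {P \<in> Spec lie_ring. lie_class (s * f1) \<notin> P}"
  have "openin (zariski_topology lie_ring) U"
    unfolding zariski_topology_def U_def
    by (rule topology_generated_by_Basis)
      (use lie.carrier_quot in \<open>auto simp: lie_ring_def lie_class_def\<close>)
  moreover have "scheme_point x \<in> U"
  proof -
    have sub: "lie_ideal \<subseteq> {f. meval x f = 0}" using lie_ideal_vanishes[OF lp] by blast
    have pt: "scheme_point x = {lie_class f | f. f \<in> {f. meval x f = 0}}" by (simp add: scheme_point_def)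
    have "s * f1 \<notin> {f. meval x f = 0}" using s(1) f1(1) by (simp add: ev.hom_mult)
    then have "lie_class (s * f1) \<notin> scheme_point x"
      unfolding pt lie_class_def lie.Spec_quotI(1)[OF prime_of_point sub] .
    moreover have "scheme_point x \<in> Spec lie_ring"
      unfolding pt lie_class_def lie_ring_def by (rule lie.Spec_quotI(2)[OF prime_of_point sub])
    ultimately show ?thesis by (simp add: U_def)
  qed
  moreover have "U \<subseteq> scheme_orbit x"
  proof
    fix P assume "P \<in> U"
    then have P: "P \<in> Spec lie_ring" "lie_class (s * f1) \<notin> P" by (auto simp: U_def)
    define R where "R = {f. lie_class f \<in> P}"
    have R: "prime_of UNIV R" "lie_ideal \<subseteq> R" "P = {lie_class f | f. f \<in> R}"
      using lie.Spec_quotD[of P] P(1) by (auto simp: R_def lie_ring_def lie_class_def)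
    have id: "ideal_of UNIV R" using R(1) by (simp add: prime_of_def)
    have "s * f1 \<notin> R" using P(2) by (simp add: R_def)
    then have notR: "s \<notin> R" "f1 \<notin> R"
      using ideal_ofD(4)[OF id, of s f1] ideal_ofD(4)[OF id, of f1 s] by (auto simp: mult.commute)
    have "orbit_ideal x \<subseteq> R"
      using s(2) R(1,2) notR(1) unfolding prime_of_def by blast
    then obtain Q where Q: "prime_of UNIV Q" "gl_ideal \<subseteq> Q" "R = {f. orbit_comorphism x f \<in> Q}"
      using f1(2)[OF R(1) _ notR(2)] by blast
    let ?Q = "{gl_class p | p. p \<in> Q}"
    have "?Q \<in> Spec gl_ring" "\<And>p. gl_class p \<in> ?Q \<longleftrightarrow> p \<in> Q"
      using gl.Spec_quotI[OF Q(1,2)] by (auto simp: gl_ring_def gl_class_def)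
    moreover from this(2) have "P = {lie_class f | f. gl_class (orbit_comorphism x f) \<in> ?Q}"
      by (simp add: R(3) Q(3))
    ultimately show "P \<in> scheme_orbit x" using P(1) unfolding scheme_orbit_def by blast
  qed
  ultimately show ?thesis by blast
qed

section \<open>The invariant ring\<close>

text \<open>The action of the scalar matrix 2 on functions, as \<open>translate_two\<close> shows.
  It multiplies a monomial of degree d by 2^d.\<close>

definition scaling :: "('v, 'k::comm_ring_1) mpoly \<Rightarrow> ('v, 'k) mpoly" where
  "scaling = msubst mconst (\<lambda>v. mconst 2 * mvar v)"

interpretation scaling: comm_ring_hom scaling
  unfolding scaling_def by (rule mconst.msubst_hom)

definition total_degree :: "('v \<Rightarrow>\<^sub>0 nat) \<Rightarrow> nat" where
  "total_degree m = (\<Sum>v\<in>keys m. lookup m v)"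

lemma total_degree_eq_0: "total_degree m = 0 \<longleftrightarrow> m = 0"
  by (auto simp: total_degree_def poly_mapping_eq_iff fun_eq_iff in_keys_iff)

lemma scaling_single:
  "scaling (single m c) = mconst (2 ^ total_degree m) * single m (c :: 'k::comm_ring_1)"
proof -
  have "monomial_eval (\<lambda>v. mconst 2 * mvar v) m = mconst (2 ^ total_degree m) * single m (1 :: 'k)"
    unfolding monomial_eval_pointwise_mult monomial_eval_mvar
    by (simp add: monomial_eval_def total_degree_def power_sum mconst.homs)
  then show ?thesis
    unfolding scaling_def mconst.msubst_single by (simp add: mconst_def mult_single mult.commute)
qed

text \<open>The product of the operators \<open>scaling - 2\<^sup>d\<close> for \<open>1 \<le> d \<le> D\<close>, which kills every
  homogeneous component of degree between \<open>1\<close> and \<open>D\<close>.\<close>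

fun project_const :: "nat \<Rightarrow> ('v, 'k::comm_ring_1) mpoly \<Rightarrow> ('v, 'k) mpoly" where
  "project_const 0 f = f"
| "project_const (Suc D) f = scaling (project_const D f) - mconst (2 ^ Suc D) * project_const D f"

text \<open>The scalar by which \<open>project_const D\<close> acts on constants.\<close>

fun project_factor :: "nat \<Rightarrow> 'k::comm_ring_1" where
  "project_factor 0 = 1"
| "project_factor (Suc D) = (1 - 2 ^ Suc D) * project_factor D"

lemma project_factor_nonzero: "project_factor D \<noteq> (0 :: 'k::field_char_0)"
proof (induction D)
  case (Suc D)
  have "(2 :: 'k) ^ Suc D \<noteq> 1"
    by (metis of_nat_1 of_nat_eq_iff of_nat_numeral of_nat_power one_less_numeral_iff
        power_inject_exp power_0 semiring_norm(76) nat.simps(3))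
  with Suc show ?case by simp
qed simp

lemma project_const_add: "project_const D (f + g) = project_const D f + project_const D g"
  by (induction D) (simp_all add: scaling.hom_add algebra_simps)

text \<open>Monomials are eigenvectors of all the operators, so each can be treated separately; a
  bound on the degrees gives one D for the whole polynomial.\<close>

lemma project_const_eventually:
  fixes f :: "('v, 'k::field_char_0) mpoly"
  shows "\<exists>D0. \<forall>D\<ge>D0. project_const D f = mconst (project_factor D) * mconst (lookup f 0)"
proof (induction f rule: poly_mapping_single_induct)
  case zero
  have "project_const D (0 :: ('v, 'k) mpoly) = 0" for D
    by (induction D) (simp_all add: scaling.hom_zero)
  then show ?case by (simp add: mconst.hom_zero)
next
  case (single f m c)
  then obtain D0 where D0: "\<And>D. D \<ge> D0 \<Longrightarrow> project_const D f = mconst (project_factor D) * mconst (lookup f 0)"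
    by blast
  let ?s = "single m c"
  have step: "project_const (Suc D) ?s = mconst a * (mconst (2 ^ total_degree m - 2 ^ Suc D) * ?s)"
    if "project_const D ?s = mconst a * ?s" for D a
    using that by (simp add: scaling.hom_mult scaling_single mconst.homs algebra_simps)
      (simp add: scaling_def mconst.msubst_mconst)
  have single: "\<exists>D1. \<forall>D\<ge>D1. project_const D ?s = mconst (project_factor D) * mconst (lookup ?s 0)"
  proof (cases "m = 0")
    case True
    have "project_const D ?s = mconst (project_factor D) * ?s" for D
    proof (induction D)
      case (Suc D)
      show ?case
        using step[OF Suc] True by (simp add: total_degree_def mconst.hom_mult mult_ac)
    qed (simp add: mconst.hom_one)
    moreover have "?s = mconst (lookup ?s 0)" by (simp add: True mconst_def)
    ultimately show ?thesis by metis
  next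
    case False
    have "\<exists>a. project_const D ?s = mconst a * ?s" for D
    proof (induction D)
      case 0
      then show ?case by (intro exI[of _ 1]) (simp add: mconst.hom_one)
    next
      case (Suc D)
      then obtain a where "project_const D ?s = mconst a * ?s" by blast
      from step[OF this] have "project_const (Suc D) ?s = mconst (a * (2 ^ total_degree m - 2 ^ Suc D)) * ?s"
        by (simp only: mconst.hom_mult mult.assoc)
      then show ?case by blast
    qed
    note scalar = this
    obtain e where e: "total_degree m = Suc e" using False total_degree_eq_0 not0_implies_Suc by metis
    \<comment> \<open>The operator of index equal to the degree annihilates the monomial, and later
      operators preserve zero.\<close>
    have "project_const (Suc e + d) ?s = 0" for d
    proof (induction d)
      case 0
      obtain a where "project_const e ?s = mconst a * ?s" using scalar by blast
      from step[OF this] show ?case by (simp add: e mconst.hom_zero del: project_const.simps)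
    qed (simp add: scaling.hom_zero)
    then have "project_const D ?s = 0" if "D \<ge> Suc e" for D using that le_Suc_ex by metis
    moreover have "lookup ?s 0 = 0" using False by (simp add: lookup_single_not_eq)
    ultimately show ?thesis by (auto simp: mconst.hom_zero)
  qed
  then obtain D1 where D1: "\<And>D. D \<ge> D1 \<Longrightarrow> project_const D ?s = mconst (project_factor D) * mconst (lookup ?s 0)"
    by blast
  have "project_const D (?s + f) = mconst (project_factor D) * mconst (lookup (?s + f) 0)"
    if "D \<ge> max D0 D1" for D
    using D0[of D] D1[of D] that by (simp add: project_const_add lookup_add mconst.hom_add distrib_left)
  then show ?case by blast
qed

text \<open>Modulo J the polynomial is an eigenvector of \<open>scaling\<close> with eigenvalue 1,
  so the projector acts on it by the nonzero \<open>project_factor\<close>; for large D it also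
  leaves only the constant term. Stability of J under \<open>scaling\<close> takes the place of a
  grading.\<close>

lemma scaling_invariant_const:
  fixes f :: "('v, 'k::field_char_0) mpoly"
  assumes J: "tideal J" "\<And>g. g \<in> J \<Longrightarrow> scaling g \<in> J" and f: "scaling f - f \<in> J"
  shows "f - mconst (lookup f 0) \<in> J"
proof -
  interpret tideal J by (rule J(1))
  have proj: "project_const D f - mconst (project_factor D) * f \<in> J" for D
  proof (induction D)
    case (Suc D)
    let ?c = "mconst (project_factor D) :: ('v, 'k) mpoly" and ?d = "mconst (2 ^ Suc D) :: ('v, 'k) mpoly"
    have c: "scaling ?c = ?c" by (simp add: scaling_def mconst.msubst_mconst)
    have "project_const (Suc D) f - mconst (project_factor (Suc D)) * f =
        scaling (project_const D f - ?c * f) - ?d * (project_const D f - ?c * f) + ?c * (scaling f - f)"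
      by (simp add: scaling.homs c mconst.homs algebra_simps del: power_Suc)
    then show ?case using J(2)[OF Suc] ideal_mult[OF Suc] ideal_mult[OF f] by (auto intro!: ideal_add ideal_diff simp del: project_const.simps)
  qed (simp add: mconst.hom_one ideal_zero)
  obtain D where D: "project_const D f = mconst (project_factor D) * mconst (lookup f 0)"
    using project_const_eventually[of f] by blast
  let ?K = "project_factor D :: 'k"
  have "mconst (1 / ?K) * (mconst ?K * (mconst (lookup f 0) - f)) \<in> J"
    using ideal_mult[OF proj[of D], of "mconst (1 / ?K)"] by (simp add: D right_diff_distrib)
  moreover have "mconst (1 / ?K) * mconst ?K = (1 :: ('v, 'k) mpoly)"
    using project_factor_nonzero[of D, where 'k = 'k] by (simp flip: mconst.hom_mult add: mconst.hom_one)
  ultimately show ?thesis by (simp add: cong_sym flip: mult.assoc)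
qed

section \<open>The scalar matrix 2 acting on brackets\<close>

lemma mat_two_inverse:
  "mat 2 ** mat (1/2) = (mat 1 :: 'k::field_char_0^'n^'n::finite)"
  "mat (1/2) ** mat 2 = (mat 1 :: 'k^'n^'n)"
  by (simp_all add: vec_eq_iff matrix_matrix_mult_def mat_def if_distrib[of "\<lambda>u. u * _"]
      if_distrib[of "\<lambda>u. _ * u"] cong: if_cong)

text \<open>A bracket has two inputs and one output: two factors 2 and one factor 1/2 leave
  2.\<close>

lemma gl_act_two:
  "gl_act (map_mat mconst (mat (1/2))) (map_mat mconst (mat 2)) mvar =
    (\<lambda>v. mconst 2 * mvar v :: ('n::finite, 'k::field_char_0) bracket_poly)"
proof
  fix v :: "'n \<times> 'n \<times> 'n"
  have scal: "map_mat mconst (mat c :: 'k^'n^'n) *v u = mconst c *s u"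
    for c and u :: "('n, 'k) bracket_poly ^ 'n"
    by (simp add: vec_eq_iff matrix_vector_mult_def mat_def if_distrib[of mconst] mconst.hom_zero
        if_distrib[of "\<lambda>u. u * _"] cong: if_cong)
  obtain i j l where v: "v = (i, j, l)" by (cases v)
  have "mconst (1/2) * (mconst 2 * mconst 2) = (mconst 2 :: ('n, 'k) bracket_poly)"
    by (simp flip: mconst.hom_mult)
  then show "gl_act (map_mat mconst (mat (1/2))) (map_mat mconst (mat 2)) mvar v =
      (mconst 2 * mvar v :: ('n, 'k) bracket_poly)"
    by (simp add: v gl_act_def struct_consts_of_def scal bprod_linear bprod_basis)
qed

lemma translate_two:
  "translate (mat 2) f = scaling (f :: ('n::finite, 'k::field_char_0) bracket_poly)"
  "invertible (mat 2 :: 'k^'n^'n)"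
proof -
  let ?a = "mat 2 :: 'k^'n^'n" and ?b = "mat (1/2) :: 'k^'n^'n"
  show inv: "invertible ?a" unfolding invertible_def using mat_two_inverse by blast
  have "matrix_inv ?a = ?b ** (?a ** matrix_inv ?a)"
    unfolding matrix_mul_assoc mat_two_inverse by simp
  then have mi: "matrix_inv ?a = ?b" by (simp add: matrix_inv_right[OF inv])
  have m: "(\<chi> i j. mconst (A $ i $ j)) = map_mat mconst A" for A :: "'k^'n^'n"
    by (simp add: vec_eq_iff)
  show "translate ?a f = scaling f"
    unfolding translate_def mi m scaling_def by (simp add: gl_act_two)
qed

text \<open>Scaling is the action of a group element, and group elements preserve the Lie
  equations.\<close>

lemma scaling_lie_ideal:
  fixes f :: "('n::finite, 'k::field_char_0) bracket_poly"
  assumes "f \<in> lie_ideal" shows "scaling f \<in> lie_ideal"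
proof -
  let ?a = "map_mat mconst (mat 2 :: 'k^'n^'n) :: ('n, 'k) bracket_poly ^ 'n ^ 'n"
    and ?b = "map_mat mconst (mat (1/2) :: 'k^'n^'n) :: ('n, 'k) bracket_poly ^ 'n ^ 'n"
  have "Idl\<^bsub>mpoly_ring\<^esub> (lie_equations mvar) \<subseteq> {f :: ('n, 'k) bracket_poly. scaling f \<in> lie_ideal}"
  proof (rule Idl_least)
    show "tideal {f :: ('n, 'k) bracket_poly. scaling f \<in> lie_ideal}"
      by (rule tideal_vimage[OF scaling.comm_ring_hom_axioms tideal_lie_ideal])
    show "lie_equations mvar \<subseteq> {f :: ('n, 'k) bracket_poly. scaling f \<in> lie_ideal}"
    proof
      fix e :: "('n, 'k) bracket_poly" assume "e \<in> lie_equations mvar"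
      moreover have "(\<lambda>v. scaling (mvar v)) = gl_act ?b ?a (mvar :: _ \<Rightarrow> ('n, 'k) bracket_poly)"
        by (simp add: gl_act_two scaling_def mconst.msubst_mvar)
      ultimately have "scaling e \<in> lie_equations (gl_act ?b ?a mvar)"
        using scaling.hom_lie_equations[of "mvar :: _ \<Rightarrow> ('n, 'k) bracket_poly"] by auto
      then have "scaling e \<in> lie_ideal"
      proof (rule lie_equations_gl_act_mem[OF tideal_lie_ideal, rotated -1])
        show "(?a ** ?b - mat 1) $ i $ j \<in> lie_ideal" for i j
          by (simp add: mat_two_inverse mconst.map_mat_one lie.ideal_zero flip: mconst.map_mat_mult)
        show "e \<in> lie_ideal" if "e \<in> lie_equations mvar" for e :: "('n, 'k) bracket_poly"
          unfolding lie_ideal_def by (rule subsetD[OF Idl_subset that])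
      qed
      then show "e \<in> {f. scaling f \<in> lie_ideal}" by simp
    qed
  qed
  then show ?thesis using assms unfolding lie_ideal_def[symmetric] by blast
qed

lemma carrier_invariant_ring:
  "carrier (invariant_ring :: ('n::finite, 'k::field_char_0) bracket_poly set ring) =
    range (\<lambda>c. lie_class (mconst c))"
proof -
  have eq: "lie_class f = lie_class g \<longleftrightarrow> f - g \<in> lie_ideal" for f g :: "('n, 'k) bracket_poly"
    unfolding lie_class_def by (rule lie.coset_eq_iff)
  have "lie_class f \<in> range (\<lambda>c. lie_class (mconst c))"
    if "\<forall>g. invertible g \<longrightarrow> lie_class (translate g f) = lie_class f" for f :: "('n, 'k) bracket_poly"
  proof -
    have "scaling f - f \<in> lie_ideal"
      using that translate_two(1)[of f] translate_two(2) eq by metis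
    then have "lie_class f = lie_class (mconst (lookup f 0))"
      unfolding eq by (intro scaling_invariant_const tideal_lie_ideal scaling_lie_ideal)
    then show ?thesis by blast
  qed
  moreover have "translate g (mconst c) = mconst c" for g :: "'k^'n^'n" and c
    by (simp add: translate_def mconst.msubst_mconst)
  ultimately show ?thesis by (auto simp: invariant_ring_def intro!: exI[of _ "mconst _"])
qed

theorem invariant_ring_point_isolated:
  fixes x :: "('k::field_char_0, 'n::finite) struct_consts"
  assumes x: "x \<in> lie_points"
  shows "openin (zariski_topology (invariant_ring :: ('n, 'k) bracket_poly set ring)) {git_point x}"
proof -
  interpret ev: comm_ring_hom "meval x" by (rule ident.msubst_hom)
  let ?R = "invariant_ring :: ('n, 'k) bracket_poly set ring"
  let ?k = "ring_of_type_algebra :: 'k ring"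
  let ?c = "\<lambda>c :: 'k. lie_class (mconst c) :: ('n, 'k) bracket_poly set"
  have L: "lie_ring = type_quot (lie_ideal :: ('n, 'k) bracket_poly set)" by (simp add: lie_ring_def)
  have cls: "lie_class = (type_coset lie_ideal :: ('n, 'k) bracket_poly \<Rightarrow> _)"
    by (simp add: lie_class_def fun_eq_iff)
  have R: "?R = lie_ring\<lparr>carrier := ?c ` carrier ?k\<rparr>"
    using carrier_invariant_ring[where 'n = 'n and 'k = 'k] by (simp add: invariant_ring_def type_ring_simps)
  have notin: "mconst c \<notin> (lie_ideal :: ('n, 'k) bracket_poly set)" if "c \<noteq> 0" for c
    using lie_ideal_vanishes[OF x, of "mconst c"] that by (auto simp: ident.msubst_mconst)
  interpret k: field ?k by (rule field_from_type_algebra)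
  interpret L: cring "lie_ring :: ('n, 'k) bracket_poly set ring" unfolding L by (rule lie.cring_quot)
  have "?c \<in> ring_hom ?k lie_ring"
    by (rule ring_hom_memI)
      (simp_all add: type_ring_simps L cls lie.carrier_quot lie.coset_add lie.coset_mult lie.coset_one mconst.homs)
  then interpret h: ring_hom_ring ?k lie_ring ?c
    by (intro ring_hom_ringI2 k.ring_axioms L.ring_axioms)
  \<comment> \<open>The coordinate ring is nonzero because x is a point of the scheme: the constant
    1 does not vanish there.\<close>
  have "\<one>\<^bsub>lie_ring\<^esub> \<noteq> (\<zero>\<^bsub>lie_ring\<^esub> :: ('n, 'k) bracket_poly set)"
    using notin[of 1] by (simp add: L lie.coset_one lie.coset_zero lie.coset_eq_iff mconst.hom_one)
  then have "subfield (?c ` carrier ?k) lie_ring"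
    by (rule h.img_is_subfield(2)[OF k.carrier_is_subfield])
  then have "field ?R" unfolding R by (rule L.subfield_iff(2))
  then interpret R: field ?R .
  have zero: "\<zero>\<^bsub>?R\<^esub> = lie_class 0" by (simp add: R L cls lie.coset_zero)
  have "lie_class f = lie_class 0" if "meval x f = 0" "lie_class f = ?c c" for f c
  proof -
    have fc: "f - mconst c \<in> lie_ideal" using that(2) by (simp add: cls lie.coset_eq_iff)
    then have "c = 0" using lie_ideal_vanishes[OF x fc] that(1) by (simp add: ev.hom_diff ident.msubst_mconst)
    with that(2) show ?thesis by (simp add: mconst.hom_zero)
  qed
  moreover have "lie_class 0 = ?c 0" by (simp add: mconst.hom_zero)
  ultimately have pt: "git_point x = {\<zero>\<^bsub>?R\<^esub>}"
    unfolding git_point_def scheme_point_def zero carrier_invariant_ring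
    by (auto intro!: exI[of _ 0] simp: ev.hom_zero) 
  have "Spec ?R = {{\<zero>\<^bsub>?R\<^esub>}}"
  proof (intro equalityI subsetI)
    fix P assume "P \<in> Spec ?R"
    then interpret P: primeideal P ?R by (simp add: Spec_def)
    have "P \<in> {I. ideal I ?R}" using P.ideal_axioms by simp
    then show "P \<in> {{\<zero>\<^bsub>?R\<^esub>}}" unfolding R.all_ideals using P.I_notcarr by blast
  qed (simp add: Spec_def R.zeroprimeideal)
  moreover have "\<one>\<^bsub>?R\<^esub> \<notin> {\<zero>\<^bsub>?R\<^esub>}" using R.one_not_zero by simp
  \<comment> \<open>The point is open as the basic open set of the function 1, since the zero ideal
    is the unique prime.\<close>
  ultimately have "{git_point x} = {P \<in> Spec ?R. \<one>\<^bsub>?R\<^esub> \<notin> P}" unfolding pt by auto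
  then show ?thesis
    unfolding zariski_topology_def using R.one_closed by (intro topology_generated_by_Basis) blast
qed

theorem theorem2p7:
  fixes x :: "('k::field_char_0, 'n::finite) struct_consts"
  assumes "x \<in> U_Lie"
  shows "(tangent_Lie x = tangent_orbit x \<and>
          tangent_stack x = {vcoset (\<lambda>_. 0) (tangent_orbit x)}) \<and>
         ((\<exists>U. openin (zariski_topology lie_ring) U \<and>
               scheme_point x \<in> U \<and> U \<subseteq> scheme_orbit x) \<and>
          openin (zariski_topology (invariant_ring :: ('n \<times> 'n \<times> 'n, 'k) mpoly set ring))
            {git_point x})"
  using tangent_eq[OF assms] tangent_stack_trivial[OF assms] orbit_contains_open[OF assms]
    invariant_ring_point_isolated[of x] assms
  by (simp add: U_Lie_def)

end
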